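(* Let $\bullet$ be nothing, "$\leq 1$", or "$1$". The weak composite monad associated with the weak distributive law $\lambda^\sharp\colon\mathbf V_\bullet\mathcal Q_{\mathsf V}\to\mathcal Q_{\mathsf V}\mathbf V_\bullet$ on $\mathbf{Top}$, given by $$\lambda^\sharp_X(\mu)=\{\nu\in\mathbf V_\bullet X\mid\nu(U)\geq\mu(\Box U)\text{ for every open }U\subseteq X\},$$ is the monad $(\mathbb P_{\mathtt{DP}}^\bullet,\eta^{\mathtt{DP}},\mu^{\mathtt{DP}})$ of superlinear (resp. and subnormalized, resp. and normalized, according to $\bullet$) previsions.
   Context: Weak distributive law and weak composite monad. Let $(S,\eta^S,\mu^S)$ and $(T,\eta^T,\mu^T)$ be monads on a category in which idempotents split. A weak distributive law of $S$ over $T$ is a natural transformation $\lambda\colon TS\to ST$ with (i) $\lambda_X\circ T\eta^S_X=\eta^S_{TX}$; (ii) $\lambda_X\circ T\mu^S_X=\mu^S_{TX}\circ S\lambda_X\circ\lambda_{SX}$; (iii) $\lambda_X\circ\mu^T_{SX}=S\mu^T_X\circ\lambda_{TX}\circ T\lambda_X$. For every $T$-algebra $\alpha\colon TX\to X$, $S\alpha\circ\lambda_X\circ\eta^T_{SX}\colon SX\to SX$ is an idempotent; split it as $\iota_\alpha\circ\pi_\alpha$, with $\pi_\alpha\colon SX\to\overline S_\alpha$, $\iota_\alpha\colon\overline S_\alpha\to SX$, $\pi_\alpha\circ\iota_\alpha=\mathrm{id}$. Then $\overline S\alpha=\pi_\alpha\circ S\alpha\circ\lambda_X\circ T\iota_\alpha\colon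 T\overline S_\alpha\to\overline S_\alpha$ is a $T$-algebra; for a $T$-algebra morphism $f\colon\alpha\to\beta$, $\overline Sf=\pi_\beta\circ Sf\circ\iota_\alpha$. This $\overline S$ is a monad on $T$-algebras with unit $\eta^{\overline S}_\alpha=\pi_\alpha\circ\eta^S_X$ and multiplication $\mu^{\overline S}_\alpha=\pi_\alpha\circ\mu^S_X\circ S\iota_\alpha\circ\iota_{\overline S\alpha}$. With $F^T\dashv U^T$ the free/forgetful adjunction between the base category and $T$-algebras, with counit $\epsilon^T$, the weak composite monad associated with $\lambda$ is $U^T\overline SF^T$ with unit $U^T\eta^{\overline S}F^T\circ\eta^T$ and multiplication $U^T\mu^{\overline S}F^T\circ U^T\overline S\epsilon^T\overline SF^T$. Splittings are only determined up to isomorphism, so this monad is determined up to isomorphism, and "is" is understood accordingly (i.e., for a suitable choice of splittings). Continuous valuations. $\overline{\mathbb R}_+=[0,\infty]$ has the Scott topology (opens: $\emptyset$, the whole set, $]t,\infty]$, $t\in\mathbb R_+=[0,\infty[$). $\mathcal O X$ is the lattice of open subsets of $X$. A continuous valuation on $X$ is a map $\nu\colon\mathcal O X\to\overline{\mathbb R}_+$ with $\nu(\emptyset)=0$, $\nu(U)+\nu(V)=\nu(U\cup V)+\nu(U\cap V)$, and which is Scott-continuous (monotone and preserving directed suprema). $\mathbf V X$ is the space of all of them, with the topology generated by $[U>r]=\{\nu\mid\nu(U)>r\}$, $U\in\mathcal O X$, $r\in\mathbb R_+$; $\mathbf V_{\leq1}X$ and $\mathbf V_1X$ are the subspaces where $\nu(X)\leq1$,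 resp. $\nu(X)=1$. $\mathcal LX$ is the set of continuous maps $X\to\overline{\mathbb R}_+$; for $h\in\mathcal LX$, $\int_{x\in X}h(x)\,d\nu=\int_0^\infty\nu(h^{-1}(]t,\infty]))\,dt$. $\mathbf V_\bullet$ is a monad on $\mathbf{Top}$: $\mathbf V_\bullet f(\nu)(V)=\nu(f^{-1}(V))$, unit $x\mapsto\delta_x$ (Dirac valuation), multiplication $\mu_X(\xi)(U)=\int_{\nu\in\mathbf V_\bullet X}\nu(U)\,d\xi$. The monad $\mathcal Q_{\mathsf V}$. $\mathcal Q_{\mathsf V}X$ is the set of non-empty compact saturated subsets of $X$ (saturated: upwards closed in the specialization preordering $x\leq y$ iff every open neighborhood of $x$ contains $y$), with basic opens $\Box U=\{Q\mid Q\subseteq U\}$, $U\in\mathcal O X$. It is a monad on $\mathbf{Top}$: $\mathcal Q_{\mathsf V}f(Q)=\uparrow f[Q]$, unit $x\mapsto\uparrow x$, multiplication $\mathcal Q'\mapsto\bigcup\mathcal Q'$ ($\uparrow$ is upward closure). Previsions. $\mathcal LX$ is ordered pointwise, with the Scott topology. A prevision on $X$ is a Scott-continuous map $F\colon\mathcal LX\to\overline{\mathbb R}_+$ with $F(ah)=aF(h)$ for all $a\in\mathbb R_+$, $h\in\mathcal LX$. It is superlinear if $F(h+h')\geq F(h)+F(h')$ for all $h,h'$; subnormalized (resp. normalized) if $F(\mathbf 1+h)\leq1+F(h)$ (resp. $=$) for all $h$, where $\mathbf 1$ is the constant function $1$. $\mathbb P_{\mathtt{DP}}^\bullet X$ is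 the set of superlinear previsions on $X$ (subnormalized if $\bullet$ is "$\leq1$", normalized if $\bullet$ is "$1$"), with the topology generated by $[h>r]=\{F\mid F(h)>r\}$, $h\in\mathcal LX$, $r\in\mathbb R_+$. For continuous $f\colon X\to Y$, $\mathbb P_{\mathtt{DP}}^\bullet f(F)(h)=F(h\circ f)$. The monad structure is $\eta^{\mathtt{DP}}_X(x)(h)=h(x)$ and $\mu^{\mathtt{DP}}_X(\mathcal F)(h)=\mathcal F(F\mapsto F(h))$, $F$ ranging over $\mathbb P_{\mathtt{DP}}^\bullet X$. *)

theory Defs
  imports "HOL-Analysis.Analysis"
begin

(* Topological spaces are rendered by the library type 'a topology, with arbitrary carrier topspace X.
   Encoding of partial maps: a map whose mathematical domain is a proper subset D of a HOL type is
   extended by 0 outside D, so that HOL equality, the pointwise order and pointwise suprema of such maps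
   are the mathematical ones.  Equations between continuous maps are stated on the carrier. *)

definition zero_ext :: "'a set \<Rightarrow> ('a \<Rightarrow> ennreal) \<Rightarrow> 'a \<Rightarrow> ennreal" where
  "zero_ext D f = (\<lambda>x. if x \<in> D then f x else 0)"

section \<open>Scott-continuity and the Scott topology on the extended non-negative reals\<close>

definition directed :: "'a::order set \<Rightarrow> bool" where
  "directed D \<longleftrightarrow> D \<noteq> {} \<and> (\<forall>x\<in>D. \<forall>y\<in>D. \<exists>z\<in>D. x \<le> z \<and> y \<le> z)"

(* Used only for sets A closed under directed suprema of the ambient complete lattice (the open sets
   of a space, or the functions in LX below), so that Sup D is the supremum of D inside A. *)
definition scott_continuous_on :: "'a::complete_lattice set \<Rightarrow> ('a \<Rightarrow> ennreal) \<Rightarrow> bool" where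
  "scott_continuous_on A F \<longleftrightarrow>
     (\<forall>x\<in>A. \<forall>y\<in>A. x \<le> y \<longrightarrow> F x \<le> F y) \<and>
     (\<forall>D. D \<subseteq> A \<and> directed D \<longrightarrow> F (Sup D) = (SUP d\<in>D. F d))"

definition ennreal_scott :: "ennreal topology" where
  "ennreal_scott = topology (\<lambda>U. U = {} \<or> U = UNIV \<or> (\<exists>t::real. 0 \<le> t \<and> U = {ennreal t<..}))"

lemma istopology_ennreal_scott:
  "istopology (\<lambda>U. U = {} \<or> U = UNIV \<or> (\<exists>t::real. 0 \<le> t \<and> U = {ennreal t<..}))"
proof -
  define P :: "ennreal set \<Rightarrow> bool"
    where "P = (\<lambda>U. U = {} \<or> U = UNIV \<or> (\<exists>t::real. 0 \<le> t \<and> U = {ennreal t<..}))"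
  have empty: "{top<..} = ({} :: ennreal set)"
    by (simp add: set_eq_iff)
  have ray: "P {t<..}" for t :: ennreal
  proof (cases t)
    case (real r)
    then show ?thesis unfolding P_def by blast
  next
    case top
    then show ?thesis unfolding P_def using empty by simp
  qed
  have shape: "U = UNIV \<or> (\<exists>t. U = {t<..})" if "P U" for U
    using that empty unfolding P_def by blast
  have inter: "P (U \<inter> V)" if U: "P U" and V: "P V" for U V
  proof (cases "U = UNIV \<or> V = UNIV")
    case True
    then show ?thesis using U V by auto
  next
    case False
    then obtain s t where "U = {s<..}" "V = {t<..}"
      using shape[OF U] shape[OF V] by blast
    then have "U \<inter> V = {max s t<..}" by (simp add: set_eq_iff)
    then show ?thesis using ray by simp
  qed
  have union: "P (\<Union>K)" if K: "\<forall>U\<in>K. P U" for K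
  proof (cases "UNIV \<in> K")
    case True
    then have "\<Union>K = UNIV" by blast
    then show ?thesis unfolding P_def by blast
  next
    case False
    define T where "T = {t. {t<..} \<in> K}"
    have "K = (\<lambda>t. {t<..}) ` T"
    proof
      show "K \<subseteq> (\<lambda>t. {t<..}) ` T"
        using shape K False unfolding T_def by blast
      show "(\<lambda>t. {t<..}) ` T \<subseteq> K" unfolding T_def by blast
    qed
    then have "\<Union>K = (\<Union>t\<in>T. {t<..})" by blast
    also have "\<dots> = {Inf T<..}"
      by (simp add: set_eq_iff Inf_less_iff)
    finally have "\<Union>K = {Inf T<..}" .
    then show ?thesis using ray by simp
  qed
  show ?thesis
    unfolding istopology_def P_def[symmetric] using inter union by blast
qed

lemma openin_ennreal_scott:
  "openin ennreal_scott U \<longleftrightarrow> U = {} \<or> U = UNIV \<or> (\<exists>t::real. 0 \<le> t \<and> U = {ennreal t<..})"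
  unfolding ennreal_scott_def by (simp add: topology_inverse'[OF istopology_ennreal_scott])

definition LX :: "'a topology \<Rightarrow> ('a \<Rightarrow> ennreal) set" where
  "LX X = {h. continuous_map X ennreal_scott h \<and> (\<forall>x. x \<notin> topspace X \<longrightarrow> h x = 0)}"

section \<open>Continuous valuations\<close>

text \<open>The three readings of the bullet: no constraint, total mass at most 1, total mass 1.\<close>

datatype mass = Any_Mass | Mass_Le_1 | Mass_1

fun mass_ok :: "mass \<Rightarrow> ennreal \<Rightarrow> bool" where
  "mass_ok Any_Mass m \<longleftrightarrow> True"
| "mass_ok Mass_Le_1 m \<longleftrightarrow> m \<le> 1"
| "mass_ok Mass_1 m \<longleftrightarrow> m = 1"

definition valuations :: "'a topology \<Rightarrow> ('a set \<Rightarrow> ennreal) set" where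
  "valuations X = {\<nu>. \<nu> {} = 0 \<and>
     (\<forall>U V. openin X U \<and> openin X V \<longrightarrow> \<nu> U + \<nu> V = \<nu> (U \<union> V) + \<nu> (U \<inter> V)) \<and>
     scott_continuous_on {U. openin X U} \<nu> \<and>
     (\<forall>U. \<not> openin X U \<longrightarrow> \<nu> U = 0)}"

(* The sets [U>r] form a subbase.  The whole space is added because topology_generated_by takes the
   union of the generators as carrier, and the zero valuation lies in no set [U>r]. *)
definition V_all :: "'a topology \<Rightarrow> ('a set \<Rightarrow> ennreal) topology" where
  "V_all X = topology_generated_by (insert (valuations X)
     {{\<nu> \<in> valuations X. ennreal r < \<nu> U} | U r. openin X U \<and> 0 \<le> (r::real)})"

definition V_space :: "mass \<Rightarrow> 'a topology \<Rightarrow> ('a set \<Rightarrow> ennreal) topology" where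
  "V_space b X = subtopology (V_all X) {\<nu>. mass_ok b (\<nu> (topspace X))}"

lemma topspace_V_space:
  "topspace (V_space b X) = {\<nu> \<in> valuations X. mass_ok b (\<nu> (topspace X))}"
  unfolding V_space_def V_all_def by auto

definition val_integral :: "'a topology \<Rightarrow> ('a set \<Rightarrow> ennreal) \<Rightarrow> ('a \<Rightarrow> ennreal) \<Rightarrow> ennreal" where
  "val_integral X \<nu> h = (\<integral>\<^sup>+ t \<in> {0..}. \<nu> {x \<in> topspace X. ennreal t < h x} \<partial>lborel)"

definition V_map :: "'a topology \<Rightarrow> 'b topology \<Rightarrow> ('a \<Rightarrow> 'b) \<Rightarrow> ('a set \<Rightarrow> ennreal) \<Rightarrow> 'b set \<Rightarrow> ennreal" where
  "V_map X Y f \<nu> = zero_ext {V. openin Y V} (\<lambda>V. \<nu> {x \<in> topspace X. f x \<in> V})"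

definition V_unit :: "'a topology \<Rightarrow> 'a \<Rightarrow> 'a set \<Rightarrow> ennreal" where
  "V_unit X x = zero_ext {U. openin X U} (\<lambda>U. if x \<in> U then 1 else 0)"

definition V_mult :: "mass \<Rightarrow> 'a topology \<Rightarrow> (('a set \<Rightarrow> ennreal) set \<Rightarrow> ennreal) \<Rightarrow> 'a set \<Rightarrow> ennreal" where
  "V_mult b X \<xi> = zero_ext {U. openin X U} (\<lambda>U. val_integral (V_space b X) \<xi> (\<lambda>\<nu>. \<nu> U))"

section \<open>The upper Vietoris monad\<close>

definition spec_le :: "'a topology \<Rightarrow> 'a \<Rightarrow> 'a \<Rightarrow> bool" where
  "spec_le X x y \<longleftrightarrow> (\<forall>U. openin X U \<and> x \<in> U \<longrightarrow> y \<in> U)"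

definition up_closure :: "'a topology \<Rightarrow> 'a set \<Rightarrow> 'a set" where
  "up_closure X A = {y \<in> topspace X. \<exists>x\<in>A. spec_le X x y}"

definition Q_set :: "'a topology \<Rightarrow> 'a set set" where
  "Q_set X = {Q. Q \<noteq> {} \<and> compactin X Q \<and>
     (\<forall>x\<in>Q. \<forall>y\<in>topspace X. spec_le X x y \<longrightarrow> y \<in> Q)}"

definition box :: "'a topology \<Rightarrow> 'a set \<Rightarrow> 'a set set" where
  "box X U = {Q \<in> Q_set X. Q \<subseteq> U}"

definition Q_space :: "'a topology \<Rightarrow> 'a set topology" where
  "Q_space X = topology_generated_by {box X U | U. openin X U}"

lemma topspace_Q_space: "topspace (Q_space X) = Q_set X"
proof -
  have "box X (topspace X) = Q_set X"
    unfolding box_def Q_set_def by (auto dest: compactin_subset_topspace)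
  then have "Q_set X \<subseteq> \<Union>{box X U | U. openin X U}" by blast
  moreover have "\<Union>{box X U | U. openin X U} \<subseteq> Q_set X"
    unfolding box_def by blast
  ultimately show ?thesis unfolding Q_space_def by simp
qed

definition Q_map :: "'b topology \<Rightarrow> ('a \<Rightarrow> 'b) \<Rightarrow> 'a set \<Rightarrow> 'b set" where
  "Q_map Y f Q = up_closure Y (f ` Q)"

definition Q_unit :: "'a topology \<Rightarrow> 'a \<Rightarrow> 'a set" where
  "Q_unit X x = up_closure X {x}"

definition Q_mult :: "'a set set \<Rightarrow> 'a set" where
  "Q_mult \<Q> = \<Union>\<Q>"

section \<open>The monad of superlinear previsions\<close>

definition one_on :: "'a topology \<Rightarrow> 'a \<Rightarrow> ennreal" where
  "one_on X = zero_ext (topspace X) (\<lambda>x. 1)"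

definition prevision :: "'a topology \<Rightarrow> (('a \<Rightarrow> ennreal) \<Rightarrow> ennreal) \<Rightarrow> bool" where
  "prevision X F \<longleftrightarrow> scott_continuous_on (LX X) F \<and>
     (\<forall>a::real. \<forall>h\<in>LX X. 0 \<le> a \<longrightarrow> F (\<lambda>x. ennreal a * h x) = ennreal a * F h) \<and>
     (\<forall>h. h \<notin> LX X \<longrightarrow> F h = 0)"

definition superlinear :: "'a topology \<Rightarrow> (('a \<Rightarrow> ennreal) \<Rightarrow> ennreal) \<Rightarrow> bool" where
  "superlinear X F \<longleftrightarrow> (\<forall>h\<in>LX X. \<forall>h'\<in>LX X. F h + F h' \<le> F (\<lambda>x. h x + h' x))"

fun prev_mass_ok :: "mass \<Rightarrow> 'a topology \<Rightarrow> (('a \<Rightarrow> ennreal) \<Rightarrow> ennreal) \<Rightarrow> bool" where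
  "prev_mass_ok Any_Mass X F \<longleftrightarrow> True"
| "prev_mass_ok Mass_Le_1 X F \<longleftrightarrow> (\<forall>h\<in>LX X. F (\<lambda>x. one_on X x + h x) \<le> 1 + F h)"
| "prev_mass_ok Mass_1 X F \<longleftrightarrow> (\<forall>h\<in>LX X. F (\<lambda>x. one_on X x + h x) = 1 + F h)"

definition DP_set :: "mass \<Rightarrow> 'a topology \<Rightarrow> (('a \<Rightarrow> ennreal) \<Rightarrow> ennreal) set" where
  "DP_set b X = {F. prevision X F \<and> superlinear X F \<and> prev_mass_ok b X F}"

(* The carrier is added to the subbase for the same reason as in V_all. *)
definition DP_space :: "mass \<Rightarrow> 'a topology \<Rightarrow> (('a \<Rightarrow> ennreal) \<Rightarrow> ennreal) topology" where
  "DP_space b X = topology_generated_by (insert (DP_set b X)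
     {{F \<in> DP_set b X. ennreal r < F h} | h r. h \<in> LX X \<and> 0 \<le> (r::real)})"

lemma topspace_DP_space: "topspace (DP_space b X) = DP_set b X"
  unfolding DP_space_def by auto

definition DP_map :: "'a topology \<Rightarrow> 'b topology \<Rightarrow> ('a \<Rightarrow> 'b) \<Rightarrow>
    (('a \<Rightarrow> ennreal) \<Rightarrow> ennreal) \<Rightarrow> ('b \<Rightarrow> ennreal) \<Rightarrow> ennreal" where
  "DP_map X Y f F = zero_ext (LX Y) (\<lambda>h. F (zero_ext (topspace X) (h \<circ> f)))"

definition DP_unit :: "'a topology \<Rightarrow> 'a \<Rightarrow> ('a \<Rightarrow> ennreal) \<Rightarrow> ennreal" where
  "DP_unit X x = zero_ext (LX X) (\<lambda>h. h x)"

definition DP_mult :: "mass \<Rightarrow> 'a topology \<Rightarrow>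
    (((('a \<Rightarrow> ennreal) \<Rightarrow> ennreal) \<Rightarrow> ennreal) \<Rightarrow> ennreal) \<Rightarrow> ('a \<Rightarrow> ennreal) \<Rightarrow> ennreal" where
  "DP_mult b X \<F> = zero_ext (LX X) (\<lambda>h. \<F> (zero_ext (DP_set b X) (\<lambda>F. F h)))"

section \<open>The weak distributive law\<close>

text \<open>HOL has no variables ranging over functors on spaces of all types, so the notions attached to a
  weak distributive law of S over T are spelled out for the upper Vietoris monad as S, the monad of
  continuous valuations (with mass constraint b) as T, and the transformation lam below.\<close>

definition lam :: "mass \<Rightarrow> 'a topology \<Rightarrow> ('a set set \<Rightarrow> ennreal) \<Rightarrow> ('a set \<Rightarrow> ennreal) set" where
  "lam b X \<mu> = {\<nu> \<in> topspace (V_space b X). \<forall>U. openin X U \<longrightarrow> \<mu> (box X U) \<le> \<nu> U}"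

definition lam_natural :: "mass \<Rightarrow> 'a topology \<Rightarrow> 'b topology \<Rightarrow> bool" where
  "lam_natural b X Y \<longleftrightarrow>
     (\<forall>f. continuous_map X Y f \<longrightarrow>
        (\<forall>\<mu> \<in> topspace (V_space b (Q_space X)).
           Q_map (V_space b Y) (V_map X Y f) (lam b X \<mu>)
           = lam b Y (V_map (Q_space X) (Q_space Y) (Q_map Y f) \<mu>)))"

definition lam_weak_distributive :: "mass \<Rightarrow> 'a topology \<Rightarrow> bool" where
  "lam_weak_distributive b X \<longleftrightarrow>
     continuous_map (V_space b (Q_space X)) (Q_space (V_space b X)) (lam b X) \<and>
     (\<forall>\<nu> \<in> topspace (V_space b X).
        lam b X (V_map X (Q_space X) (Q_unit X) \<nu>) = Q_unit (V_space b X) \<nu>) \<and>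
     (\<forall>\<mu> \<in> topspace (V_space b (Q_space (Q_space X))).
        lam b X (V_map (Q_space (Q_space X)) (Q_space X) Q_mult \<mu>)
        = Q_mult (Q_map (Q_space (V_space b X)) (lam b X) (lam b (Q_space X) \<mu>))) \<and>
     (\<forall>\<xi> \<in> topspace (V_space b (V_space b (Q_space X))).
        lam b X (V_mult b (Q_space X) \<xi>)
        = Q_map (V_space b X) (V_mult b X)
            (lam b (V_space b X)
              (V_map (V_space b (Q_space X)) (Q_space (V_space b X)) (lam b X) \<xi>)))"

section \<open>The weakly lifted monad on algebras and the weak composite monad\<close>

record 'x algebra =
  alg_space :: "'x topology"
  alg_map :: "('x set \<Rightarrow> ennreal) \<Rightarrow> 'x"

definition is_algebra :: "mass \<Rightarrow> 'x algebra \<Rightarrow> bool" where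
  "is_algebra b A \<longleftrightarrow>
     continuous_map (V_space b (alg_space A)) (alg_space A) (alg_map A) \<and>
     (\<forall>x \<in> topspace (alg_space A). alg_map A (V_unit (alg_space A) x) = x) \<and>
     (\<forall>\<xi> \<in> topspace (V_space b (V_space b (alg_space A))).
        alg_map A (V_mult b (alg_space A) \<xi>)
        = alg_map A (V_map (V_space b (alg_space A)) (alg_space A) (alg_map A) \<xi>))"

definition free_algebra :: "mass \<Rightarrow> 'a topology \<Rightarrow> ('a set \<Rightarrow> ennreal) algebra" where
  "free_algebra b X = \<lparr>alg_space = V_space b X, alg_map = V_mult b X\<rparr>"

definition alg_idem :: "mass \<Rightarrow> 'x algebra \<Rightarrow> 'x set \<Rightarrow> 'x set" where
  "alg_idem b A =
     Q_map (alg_space A) (alg_map A) \<circ> lam b (alg_space A) \<circ> V_unit (Q_space (alg_space A))"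

record ('x, 'e) splitting =
  spl_space :: "'e topology"
  spl_proj :: "'x set \<Rightarrow> 'e"
  spl_incl :: "'e \<Rightarrow> 'x set"

definition is_splitting :: "mass \<Rightarrow> 'x algebra \<Rightarrow> ('x, 'e) splitting \<Rightarrow> bool" where
  "is_splitting b A s \<longleftrightarrow>
     is_algebra b A \<and>
     continuous_map (Q_space (alg_space A)) (spl_space s) (spl_proj s) \<and>
     continuous_map (spl_space s) (Q_space (alg_space A)) (spl_incl s) \<and>
     (\<forall>e \<in> topspace (spl_space s). spl_proj s (spl_incl s e) = e) \<and>
     (\<forall>Q \<in> topspace (Q_space (alg_space A)). spl_incl s (spl_proj s Q) = alg_idem b A Q)"

text \<open>The lifted monad, each part depending on the splittings chosen for the algebras involved.\<close>

definition lift_alg :: "mass \<Rightarrow> 'x algebra \<Rightarrow> ('x, 'e) splitting \<Rightarrow> 'e algebra" where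
  "lift_alg b A s = \<lparr>alg_space = spl_space s,
     alg_map = spl_proj s \<circ> Q_map (alg_space A) (alg_map A) \<circ> lam b (alg_space A)
       \<circ> V_map (spl_space s) (Q_space (alg_space A)) (spl_incl s)\<rparr>"

definition lift_map :: "('x, 'e) splitting \<Rightarrow> 'y algebra \<Rightarrow> ('y, 'f) splitting \<Rightarrow> ('x \<Rightarrow> 'y) \<Rightarrow> 'e \<Rightarrow> 'f" where
  "lift_map s B t f = spl_proj t \<circ> Q_map (alg_space B) f \<circ> spl_incl s"

definition lift_unit :: "'x algebra \<Rightarrow> ('x, 'e) splitting \<Rightarrow> 'x \<Rightarrow> 'e" where
  "lift_unit A s = spl_proj s \<circ> Q_unit (alg_space A)"

(* s splits the idempotent of A, and s' that of lift_alg b A s. *)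
definition lift_mult :: "'x algebra \<Rightarrow> ('x, 'e) splitting \<Rightarrow> ('e, 'f) splitting \<Rightarrow> 'f \<Rightarrow> 'e" where
  "lift_mult A s s' = spl_proj s \<circ> Q_mult \<circ> Q_map (Q_space (alg_space A)) (spl_incl s) \<circ> spl_incl s'"

text \<open>The weak composite monad sends X to \<open>spl_space s\<close>, where s splits the idempotent of
  \<open>free_algebra b X\<close>.\<close>

definition wc_map :: "mass \<Rightarrow> 'a topology \<Rightarrow> ('a set \<Rightarrow> ennreal, 'e) splitting \<Rightarrow>
    'b topology \<Rightarrow> ('b set \<Rightarrow> ennreal, 'f) splitting \<Rightarrow> ('a \<Rightarrow> 'b) \<Rightarrow> 'e \<Rightarrow> 'f" where
  "wc_map b X s Y t f = lift_map s (free_algebra b Y) t (V_map X Y f)"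

definition wc_unit :: "mass \<Rightarrow> 'a topology \<Rightarrow> ('a set \<Rightarrow> ennreal, 'e) splitting \<Rightarrow> 'a \<Rightarrow> 'e" where
  "wc_unit b X s = lift_unit (free_algebra b X) s \<circ> V_unit X"

(* s splits the idempotent of the free algebra on X, t that of the free algebra on spl_space s, and
   s' that of the lifted algebra lift_alg b (free_algebra b X) s.  The counit of the free/forgetful
   adjunction at an algebra is its structure map. *)
definition wc_mult :: "mass \<Rightarrow> 'a topology \<Rightarrow> ('a set \<Rightarrow> ennreal, 'e) splitting \<Rightarrow>
    ('e set \<Rightarrow> ennreal, 'f) splitting \<Rightarrow> ('e, 'g) splitting \<Rightarrow> 'f \<Rightarrow> 'e" where
  "wc_mult b X s t s' =
     (let A = free_algebra b X; B = lift_alg b A s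
      in lift_mult A s s' \<circ> lift_map t B s' (alg_map B))"

text \<open>The choice of splittings on free algebras for which the weak composite monad is the monad of
  previsions on the nose.\<close>

definition DP_splitting :: "mass \<Rightarrow> 'a topology \<Rightarrow>
    ('a set \<Rightarrow> ennreal, ('a \<Rightarrow> ennreal) \<Rightarrow> ennreal) splitting" where
  "DP_splitting b X = \<lparr>spl_space = DP_space b X,
     spl_proj = (\<lambda>Q. zero_ext (LX X) (\<lambda>h. INF \<nu>\<in>Q. val_integral X \<nu> h)),
     spl_incl = (\<lambda>F. {\<nu> \<in> topspace (V_space b X). \<forall>h\<in>LX X. F h \<le> val_integral X \<nu> h})\<rparr>"

end

theory Submission
  imports Defs
begin

text \<open>
  Two maps relate superlinear previsions \<open>F\<close> and compact saturated sets \<open>K\<close> of valuations: \<open>F\<close> gives the set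
  \<open>core b X F\<close> of the valuations whose integral is above \<open>F\<close>, and \<open>K\<close> gives the prevision \<open>val_env X K\<close> that
  maps \<open>h\<close> to the infimum of the integrals of \<open>h\<close> over \<open>K\<close>. They split the idempotent of the free algebra,
  and with this splitting the structure of the weak composite monad can be computed on previsions.

  The analytic core is a sandwich theorem (\<open>sandwich\<close>): if \<open>F\<close> lies below a cone of constraints
  \<open>(k, r)\<close>, then some valuation \<open>\<nu>\<close> has an integral that is above \<open>F\<close> everywhere and at most \<open>r\<close> at \<open>k\<close> for
  each constraint. Its proof takes a minimal monotone sublinear functional above \<open>F\<close> and below the
  constraints. Minimality forces it to be superadditive, because lowering its value at one point would give a
  smaller sublinear functional, and Scott-continuous, because its Scott-continuous envelope is sublinear and
  still above \<open>F\<close>. A Scott-continuous linear functional is the integral against a valuation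
  (\<open>val_integral_val_of\<close>).

  The sandwich theorem has three consequences. The infimum of the integrals over \<open>core b X F\<close> is \<open>F\<close>
  again (\<open>INF_core\<close>). The set \<open>core b X F\<close> is compact and depends continuously on \<open>F\<close>
  (\<open>core_Q_set\<close>, \<open>continuous_map_core\<close>), since a cover by subbasic open sets says that a system of constraints
  is unsolvable, which a single inequality for \<open>F\<close> witnesses. And if \<open>F\<close>, composed with a superadditive
  transformation of functions, lies below a valuation on another space, then so does some valuation above
  \<open>F\<close> (\<open>core_push\<close>).

  The law enters through \<open>lam_eq_core\<close>: \<open>lam b X \<mu>\<close> is the core of the prevision that maps \<open>h\<close> to the
  \<open>\<mu>\<close>-integral of \<open>Q \<mapsto> inf h[Q]\<close>. Hence naturality and the laws compare cores of previsions, where the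
  previsions agree by a computation with integrals and \<open>core_push\<close> provides the valuations that have to exist.
  In the same way the idempotent of a free algebra is \<open>core b X \<circ> val_env X\<close>, the lifted algebra averages
  previsions (\<open>alg_map_lifted\<close>), and the multiplication of the weak composite monad evaluates
  \<open>\<F>\<close> at \<open>F \<mapsto> F h\<close>: the idempotent of the lifted algebra, whatever its splitting, leaves pointwise infima
  unchanged (\<open>INF_alg_idem_lifted\<close>).
\<close>

section \<open>Lower semicontinuous functions\<close>

text \<open>As functions in \<open>LX X\<close> vanish off the carrier, their level sets need no reference to it, and membership
  is a property of the level sets alone.\<close>

lemma LX_iff: "h \<in> LX X \<longleftrightarrow> (\<forall>t. openin X {x. t < h x})"
proof
  assume h: "h \<in> LX X"
  then have z: "h x = 0" if "x \<notin> topspace X" for x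
    using that by (auto simp: LX_def)
  have c: "openin X {x \<in> topspace X. h x \<in> U}" if "openin ennreal_scott U" for U
    using h that by (auto simp: LX_def continuous_map_def)
  have "x \<in> topspace X" if "t < h x" for t x
    using z[of x] that not_less_zero by metis
  then have e: "{x. t < h x} = {x \<in> topspace X. h x \<in> {t<..}}" for t
    by auto
  show "\<forall>t. openin X {x. t < h x}"
  proof
    fix t :: ennreal
    show "openin X {x. t < h x}"
    proof (cases t)
      case (real r)
      then have "openin ennreal_scott {t<..}"
        by (auto simp: openin_ennreal_scott)
      from c[OF this] show ?thesis by (simp add: e)
    qed auto
  qed
next
  assume o: "\<forall>t. openin X {x. t < h x}"
  have z: "h x = 0" if "x \<notin> topspace X" for x
    using openin_subset[OF o[rule_format, of 0]] that by (auto simp: subset_iff zero_less_iff_neq_zero)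
  have "openin X {x \<in> topspace X. h x \<in> U}" if U: "openin ennreal_scott U" for U
  proof -
    have "x \<in> topspace X" if "t < h x" for t x
      using z[of x] that not_less_zero by metis
    then have e: "{x \<in> topspace X. h x \<in> {t<..}} = {x. t < h x}" for t
      by auto
    consider "U = {}" | "U = UNIV" | t where "U = {ennreal t<..}"
      using U unfolding openin_ennreal_scott by blast
    then show ?thesis
      by cases (simp_all only: e o[rule_format], simp_all)
  qed
  moreover have "topspace ennreal_scott = UNIV"
    using openin_ennreal_scott openin_subset by blast
  ultimately show "h \<in> LX X"
    using z by (auto simp: LX_def continuous_map_def)
qed

lemma LX_open: "h \<in> LX X \<Longrightarrow> openin X {x. t < h x}"
  by (simp add: LX_iff)

lemma LX_outside: "h \<in> LX X \<Longrightarrow> x \<notin> topspace X \<Longrightarrow> h x = 0"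
  by (simp add: LX_def)

lemma LX_pos_topspace: "h \<in> LX X \<Longrightarrow> t < h x \<Longrightarrow> x \<in> topspace X"
  by (metis LX_outside not_less_zero)

lemma zero_ext_LX:
  assumes "\<And>t. openin X {x \<in> topspace X. t < h x}"
  shows "zero_ext (topspace X) h \<in> LX X"
proof -
  have "{x. t < zero_ext (topspace X) h x} = {x \<in> topspace X. t < h x}" for t
    by (auto simp: zero_ext_def split: if_splits)
  then show ?thesis using assms by (simp add: LX_iff)
qed

lemma LX_zero: "(\<lambda>x. 0) \<in> LX X"
  by (simp add: LX_iff)

lemma LX_indicator: "openin X U \<Longrightarrow> indicator U \<in> LX X"
  unfolding LX_iff
proof
  fix t :: ennreal
  assume U: "openin X U"
  have "{x. t < indicator U x} = (if t < 1 then U else {})"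
    by (auto simp: indicator_def split: if_splits)
  then show "openin X {x. t < indicator U x}" using U by simp
qed

lemma one_on_eq_indicator: "one_on X = indicator (topspace X)"
  by (auto simp: one_on_def zero_ext_def indicator_def fun_eq_iff)

lemma LX_one_on: "one_on X \<in> LX X"
  by (simp add: one_on_eq_indicator LX_indicator)

text \<open>The first two disjuncts are there for a summand \<open>0\<close>, below which there is no \<open>a\<close> or \<open>b\<close>.\<close>

lemma ennreal_less_add_iff:
  fixes t u v :: ennreal
  shows "t < u + v \<longleftrightarrow> t < u \<or> t < v \<or> (\<exists>a b. a < u \<and> b < v \<and> t < a + b)"
proof
  assume t: "t < u + v"
  show "t < u \<or> t < v \<or> (\<exists>a b. a < u \<and> b < v \<and> t < a + b)"
  proof (rule ccontr)
    assume n: "\<not> ?thesis"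
    then have le: "u \<le> t" "v \<le> t" by auto
    have pos: "u \<noteq> 0" "v \<noteq> 0" using t n by auto
    have "u + v \<le> t"
    proof -
      have ne: "{..<w} \<noteq> {}" if "w \<noteq> 0" for w :: ennreal
        using that zero_less_iff_neq_zero[of w] by blast
      have "a + b \<le> t" if "a < u" "b < v" for a b
        using n that by (meson not_less)
      then have 1: "a + (SUP b\<in>{..<v}. b) \<le> t" if "a < u" for a
        using that by (subst ennreal_SUP_add_right[OF ne[OF pos(2)]]) (auto intro!: SUP_least)
      have S: "(SUP b\<in>{..<w}. b) = w" if "w \<noteq> 0" for w :: ennreal
        by (rule SUP_eqI) (auto intro: less_imp_le dense_le)
      have "(SUP a\<in>{..<u}. a + v) \<le> t"
        using 1 S pos by (auto intro!: SUP_least)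
      moreover have "(SUP a\<in>{..<u}. a + v) = (SUP a\<in>{..<u}. a) + v"
        by (rule ennreal_SUP_add_left[OF ne[OF pos(1)]])
      ultimately show ?thesis using S pos by simp
    qed
    then show False using t by simp
  qed
next
  assume "t < u \<or> t < v \<or> (\<exists>a b. a < u \<and> b < v \<and> t < a + b)"
  then consider "t < u" | "t < v" | a b where "a < u" "b < v" "t < a + b" by blast
  then show "t < u + v"
  proof cases
    case 1
    moreover have "u \<le> u + v" by simp
    ultimately show ?thesis by (rule order_less_le_trans)
  next
    case 2
    moreover have "v \<le> u + v" by simp
    ultimately show ?thesis by (rule order_less_le_trans)
  next
    case 3
    have "a + b \<le> u + v" using 3 by (intro add_mono less_imp_le)
    then show ?thesis using 3(3) by (rule order_less_le_trans[rotated])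
  qed
qed

lemma LX_add:
  assumes "h \<in> LX X" "k \<in> LX X"
  shows "(\<lambda>x. h x + k x) \<in> LX X"
  unfolding LX_iff
proof
  fix t
  have "{x. t < h x + k x} = {x. t < h x} \<union> {x. t < k x} \<union>
     (\<Union>p\<in>{p. t < fst p + snd p}. {x. fst p < h x} \<inter> {x. snd p < k x})"
  proof (rule set_eqI)
    fix x
    show "x \<in> {x. t < h x + k x} \<longleftrightarrow> x \<in> {x. t < h x} \<union> {x. t < k x} \<union>
     (\<Union>p\<in>{p. t < fst p + snd p}. {x. fst p < h x} \<inter> {x. snd p < k x})"
      using ennreal_less_add_iff[of t "h x" "k x"] by auto
  qed
  also have "openin X \<dots>"
    using assms by (intro openin_Un openin_Union) (auto simp: LX_iff)
  finally show "openin X {x. t < h x + k x}" .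
qed

lemma ennreal_less_mult_iff:
  assumes "0 < a"
  shows "t < ennreal a * u \<longleftrightarrow> ennreal (1/a) * t < u"
proof -
  have inv: "ennreal (1/a) * ennreal a = 1" "ennreal a * ennreal (1/a) = 1"
    using assms by (simp_all add: ennreal_mult[symmetric])
  have "ennreal (1/a) * (ennreal a * u) = u" "ennreal a * (ennreal (1/a) * t) = t"
    using inv by (simp_all add: mult.assoc[symmetric])
  then show ?thesis
    using assms by (metis mult_left_mono not_less zero_le)
qed

lemma LX_scale:
  assumes "h \<in> LX X"
  shows "(\<lambda>x. ennreal a * h x) \<in> LX X"
proof (cases "a > 0")
  case True
  then show ?thesis
    using assms by (simp add: LX_iff ennreal_less_mult_iff)
next
  case False
  then show ?thesis by (simp add: ennreal_neg LX_zero)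
qed

lemma LX_Sup:
  assumes "D \<subseteq> LX X"
  shows "Sup D \<in> LX X"
  unfolding LX_iff
proof
  fix t
  have "{x. t < Sup D x} = (\<Union>d\<in>D. {x. t < d x})"
    by (auto simp: less_SUP_iff)
  also have "openin X \<dots>" using assms by (auto intro!: openin_Union simp: LX_iff)
  finally show "openin X {x. t < Sup D x}" .
qed

lemma LX_SUP:
  assumes "\<And>i. i \<in> I \<Longrightarrow> f i \<in> LX X"
  shows "(\<lambda>x. SUP i\<in>I. f i x) \<in> LX X"
  using LX_Sup[of "f ` I" X] assms by (simp add: image_subset_iff image_comp Sup_fun_def)

lemma LX_sum: "finite I \<Longrightarrow> (\<And>i. i \<in> I \<Longrightarrow> f i \<in> LX X) \<Longrightarrow> (\<lambda>x. \<Sum>i\<in>I. f i x) \<in> LX X"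
  by (induction I rule: finite_induct) (auto simp: LX_zero LX_add)

section \<open>Dyadic approximation\<close>

text \<open>Applied to the values of a function \<open>h\<close>, this is a step function built from level sets of \<open>h\<close>, whose
  coefficients and thresholds do not depend on \<open>h\<close>.\<close>

definition dyadic_approx :: "nat \<Rightarrow> ennreal \<Rightarrow> ennreal" where
  "dyadic_approx n u =
     (\<Sum>i = 1..n * 2 ^ n :: nat. ennreal (1 / 2 ^ n) * indicator {ennreal (real i / 2 ^ n)<..} u)"

lemma dyadic_approx_le: "dyadic_approx n u \<le> u"
proof -
  have "(\<Sum>i = 1..N. ennreal (1 / 2 ^ n) * indicator {ennreal (real i / 2 ^ n)<..} u) \<le> min u (ennreal (N / 2 ^ n))" for N
  proof (induction N)
    case (Suc N)
    show ?case
    proof (cases "ennreal (real (Suc N) / 2 ^ n) < u")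
      case True
      have "ennreal (real N / 2 ^ n) + ennreal (1 / 2 ^ n) = ennreal (real (Suc N) / 2 ^ n)"
        by (simp add: ennreal_plus[symmetric] add_divide_distrib del: ennreal_plus)
      moreover have "(\<Sum>i = 1..N. ennreal (1 / 2 ^ n) * indicator {ennreal (real i / 2 ^ n)<..} u) \<le> ennreal (N / 2 ^ n)"
        using Suc by simp
      moreover have "(\<Sum>i = 1..Suc N. ennreal (1 / 2 ^ n) * indicator {ennreal (real i / 2 ^ n)<..} u)
          = (\<Sum>i = 1..N. ennreal (1 / 2 ^ n) * indicator {ennreal (real i / 2 ^ n)<..} u) + ennreal (1 / 2 ^ n)"
        using True by simp
      ultimately have "(\<Sum>i = 1..Suc N. ennreal (1 / 2 ^ n) * indicator {ennreal (real i / 2 ^ n)<..} u)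
          \<le> ennreal (real (Suc N) / 2 ^ n)"
        by (metis add_right_mono)
      then show ?thesis using True by (simp only: min.bounded_iff) (meson less_imp_le order.trans)
    next
      case False
      have "ennreal (real N / 2 ^ n) \<le> ennreal (real (Suc N) / 2 ^ n)"
        by (intro ennreal_leI divide_right_mono) auto
      then show ?thesis using Suc False by auto
    qed
  qed simp
  from this[of "n * 2 ^ n"] show ?thesis unfolding dyadic_approx_def min.bounded_iff by blast
qed

lemma sum_le_sum_pairs:
  fixes f g :: "nat \<Rightarrow> ennreal"
  assumes "\<And>i. f (Suc i) \<le> g (2 * i + 1) + g (2 * i + 2)"
  shows "sum f {1..N} \<le> sum g {1..2 * N}"
proof (induction N)
  case (Suc N)
  have "sum f {1..Suc N} = sum f {1..N} + f (Suc N)" by simp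
  also have "\<dots> \<le> sum g {1..2 * N} + (g (2 * N + 1) + g (2 * N + 2))"
    using Suc assms by (rule add_mono)
  also have "\<dots> = sum g {1..2 * Suc N}" by (simp add: add.assoc)
  finally show ?case .
qed simp

text \<open>Each threshold of level \<open>n\<close> reappears at level \<open>Suc n\<close>, and one more lies just below it: a single
  step of height \<open>1 / 2 ^ n\<close> is dominated by these two steps of half the height.\<close>

lemma dyadic_approx_Suc: "dyadic_approx n u \<le> dyadic_approx (Suc n) u"
proof -
  let ?a = "\<lambda>n i. ennreal (1 / 2 ^ n) * indicator {ennreal (real i / 2 ^ n)<..} u"
  have half: "ennreal (1 / 2 ^ n) = ennreal (1 / 2 ^ Suc n) + ennreal (1 / 2 ^ Suc n)"
    by (subst ennreal_plus[symmetric]) (auto simp: field_simps)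
  have step: "?a n (Suc i) \<le> ?a (Suc n) (2 * i + 1) + ?a (Suc n) (2 * i + 2)" for i
  proof (cases "ennreal (real (Suc i) / 2 ^ n) < u")
    case True
    have "ennreal (real (2 * i + 1) / 2 ^ Suc n) \<le> ennreal (real (Suc i) / 2 ^ n)"
      by (intro ennreal_leI) (simp add: field_simps)
    then have 1: "ennreal (real (2 * i + 1) / 2 ^ Suc n) < u"
      using True by (rule order_le_less_trans)
    have "real (2 * i + 2) / 2 ^ Suc n = real (Suc i) / 2 ^ n"
      by (simp add: field_simps)
    then have 2: "ennreal (real (2 * i + 2) / 2 ^ Suc n) < u"
      using True by (simp only:)
    show ?thesis using True 1 2 unfolding half by (simp add: indicator_def)
  qed (simp add: indicator_def)
  have "dyadic_approx n u \<le> (\<Sum>i = 1..2 * (n * 2 ^ n). ?a (Suc n) i)"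
    unfolding dyadic_approx_def by (rule sum_le_sum_pairs) (rule step)
  also have "\<dots> \<le> dyadic_approx (Suc n) u"
    unfolding dyadic_approx_def by (rule sum_mono2) auto
  finally show ?thesis .
qed

lemma SUP_dyadic_approx: "(SUP n. dyadic_approx n u) = u"
proof (rule antisym)
  show "(SUP n. dyadic_approx n u) \<le> u"
    by (auto intro: SUP_least dyadic_approx_le)
  show "u \<le> (SUP n. dyadic_approx n u)"
  proof (rule dense_le)
    fix w assume w: "w < u"
    then obtain r where r: "w = ennreal r" "r \<ge> 0"
      by (cases w) auto
    obtain e where e: "e > 0" "ennreal (r + e) < u"
    proof (cases u)
      case (real v)
      then have "r < v" using w r by (simp add: ennreal_less_iff)
      moreover from this have "r + (v - r) / 2 < v" "0 \<le> r + (v - r) / 2" using r by (simp_all add: field_simps)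
      ultimately show ?thesis using real that[of "(v - r) / 2"]
        by (simp add: ennreal_less_iff)
    next
      case top
      then show ?thesis using that[of 1] by simp
    qed
    obtain m where m: "(1/2 :: real) ^ m < e"
      using e(1) real_arch_pow_inv[of e "1/2"] by auto
    \<comment> \<open>The grid of level \<open>n\<close> has mesh less than \<open>e\<close> and reaches \<open>r + 1\<close>, so that its first
      \<open>N\<close> points, the last of which is the first point above \<open>r\<close>, are all below \<open>u\<close>.\<close>
    define n where "n = max m (nat \<lceil>r\<rceil> + 1)"
    have n1: "1 / 2 ^ n < e"
    proof -
      have "(1/2 :: real) ^ n \<le> (1/2) ^ m" by (rule power_decreasing) (auto simp: n_def)
      then show ?thesis using m by (simp add: power_one_over)
    qed
    have n2: "r + 1 \<le> n" unfolding n_def by linarith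
    define N where "N = nat \<lfloor>r * 2 ^ n\<rfloor> + 1"
    have "real N = of_int \<lfloor>r * 2 ^ n\<rfloor> + 1"
      using r(2) by (simp add: N_def)
    then have N1: "r * 2 ^ n \<le> N" "real N \<le> r * 2 ^ n + 1"
      by linarith+
    have "real N \<le> n * 2 ^ n"
    proof -
      have "r * 2 ^ n + 1 \<le> (r + 1) * 2 ^ n" by (simp add: algebra_simps)
      also have "\<dots> \<le> real n * 2 ^ n" using n2 by (intro mult_right_mono) auto
      finally show ?thesis using N1 by simp
    qed
    then have N2: "N \<le> n * 2 ^ n"
      by (metis of_nat_le_iff of_nat_mult of_nat_numeral of_nat_power)
    have lt: "ennreal (i / 2 ^ n) < u" if "i \<in> {1..N}" for i
    proof -
      have "real i / 2 ^ n \<le> (r * 2 ^ n + 1) / 2 ^ n"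
        using that N1 by (intro divide_right_mono) auto
      also have "\<dots> \<le> r + e" using n1 by (simp add: field_simps)
      finally have "ennreal (i / 2 ^ n) \<le> ennreal (r + e)" by (rule ennreal_leI)
      then show ?thesis using e by simp
    qed
    have "w \<le> ennreal (N * (1 / 2 ^ n))"
      unfolding r using N1 by (intro ennreal_leI) (simp add: field_simps)
    also have "\<dots> = (\<Sum>i = 1..N. ennreal (1 / 2 ^ n))"
      by (simp add: ennreal_mult ennreal_of_nat_eq_real_of_nat del: times_divide_eq_right)
    also have "\<dots> = (\<Sum>i = 1..N. ennreal (1 / 2 ^ n) * indicator {ennreal (i / 2 ^ n)<..} u)"
      using lt by (intro sum.cong) auto
    also have "\<dots> \<le> dyadic_approx n u"
      unfolding dyadic_approx_def using N2 by (intro sum_mono2) auto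
    also have "\<dots> \<le> (SUP n. dyadic_approx n u)" by (rule SUP_upper) simp
    finally show "w \<le> (SUP n. dyadic_approx n u)" .
  qed
qed

section \<open>The integral against a continuous valuation\<close>

lemma scott_continuous_on_mono:
  "scott_continuous_on A F \<Longrightarrow> x \<in> A \<Longrightarrow> y \<in> A \<Longrightarrow> x \<le> y \<Longrightarrow> F x \<le> F y"
  by (simp add: scott_continuous_on_def)

lemma scott_continuous_on_Sup:
  "scott_continuous_on A F \<Longrightarrow> D \<subseteq> A \<Longrightarrow> directed D \<Longrightarrow> F (Sup D) = (SUP d\<in>D. F d)"
  by (simp add: scott_continuous_on_def)

lemma valuations_scott: "\<nu> \<in> valuations X \<Longrightarrow> scott_continuous_on {U. openin X U} \<nu>"
  by (simp add: valuations_def)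

lemma valuations_empty: "\<nu> \<in> valuations X \<Longrightarrow> \<nu> {} = 0"
  by (simp add: valuations_def)

lemma valuations_modular:
  "\<nu> \<in> valuations X \<Longrightarrow> openin X U \<Longrightarrow> openin X V \<Longrightarrow> \<nu> U + \<nu> V = \<nu> (U \<union> V) + \<nu> (U \<inter> V)"
  by (simp add: valuations_def)

lemma valuations_mono:
  "\<nu> \<in> valuations X \<Longrightarrow> openin X U \<Longrightarrow> openin X V \<Longrightarrow> U \<subseteq> V \<Longrightarrow> \<nu> U \<le> \<nu> V"
  by (simp add: valuations_def scott_continuous_on_def)

lemma valuations_outside: "\<nu> \<in> valuations X \<Longrightarrow> \<not> openin X U \<Longrightarrow> \<nu> U = 0"
  by (simp add: valuations_def)

lemma valuations_UNION_directed:
  assumes \<nu>: "\<nu> \<in> valuations X"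
    and o: "\<And>d. d \<in> D \<Longrightarrow> openin X (U d)"
    and ne: "D \<noteq> {}"
    and dir: "\<And>d e. d \<in> D \<Longrightarrow> e \<in> D \<Longrightarrow> \<exists>f\<in>D. U d \<subseteq> U f \<and> U e \<subseteq> U f"
  shows "\<nu> (\<Union>d\<in>D. U d) = (SUP d\<in>D. \<nu> (U d))"
proof -
  have 1: "directed (U ` D)" using ne dir unfolding directed_def by simp
  have 2: "U ` D \<subseteq> {U. openin X U}" using o by auto
  show ?thesis
    using scott_continuous_on_Sup[OF valuations_scott[OF \<nu>] 2 1] by (simp only: image_image)
qed

lemma antimono_ennreal_borel:
  fixes g :: "real \<Rightarrow> ennreal"
  assumes "antimono g"
  shows "g \<in> borel_measurable borel"
proof (rule borel_measurableI_greater)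
  fix y
  define S where "S = {x. y < g x}"
  have "is_interval S"
    unfolding S_def is_interval_1 using antimonoD[OF assms] by (blast intro: less_le_trans)
  from is_real_interval[OF this] have "S \<in> sets borel"
    by (elim exE disjE) simp_all
  then show "{x \<in> space borel. y < g x} \<in> sets borel" by (simp add: S_def)
qed

lemma level_antimono:
  assumes \<nu>: "\<nu> \<in> valuations X" and h: "h \<in> LX X"
  shows "antimono (\<lambda>t. \<nu> {x. ennreal t < h x})"
proof (rule antimonoI)
  fix s t :: real assume "s \<le> t"
  then have "{x. ennreal t < h x} \<subseteq> {x. ennreal s < h x}"
    using ennreal_leI by (auto intro: order_le_less_trans)
  then show "\<nu> {x. ennreal t < h x} \<le> \<nu> {x. ennreal s < h x}"
    using valuations_mono[OF \<nu>] LX_open[OF h] by blast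
qed

lemma level_measurable:
  assumes \<nu>: "\<nu> \<in> valuations X" and h: "h \<in> LX X"
  shows "(\<lambda>t. \<nu> {x. ennreal t < h x}) \<in> borel_measurable borel"
  by (rule antimono_ennreal_borel) (rule level_antimono[OF assms])

lemma val_integral_LX:
  assumes "h \<in> LX X"
  shows "val_integral X \<nu> h = (\<integral>\<^sup>+ t. \<nu> {x. ennreal t < h x} * indicator {0..} t \<partial>lborel)"
proof -
  have "{x \<in> topspace X. ennreal t < h x} = {x. ennreal t < h x}" for t
    using LX_pos_topspace[OF assms] by blast
  then show ?thesis by (simp add: val_integral_def)
qed

lemma val_integral_cong:
  assumes "\<And>x. x \<in> topspace X \<Longrightarrow> h x = k x"
  shows "val_integral X \<nu> h = val_integral X \<nu> k"
proof -
  have "{x \<in> topspace X. ennreal t < h x} = {x \<in> topspace X. ennreal t < k x}" for t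
    using assms by auto
  then show ?thesis by (simp add: val_integral_def)
qed

lemma val_integral_zero_ext:
  "val_integral X \<nu> (zero_ext (topspace X) h) = val_integral X \<nu> h"
  by (rule val_integral_cong) (simp add: zero_ext_def)

lemma val_integral_mono_valuation:
  assumes "h \<in> LX X" and "\<And>U. openin X U \<Longrightarrow> \<nu> U \<le> \<nu>' U"
  shows "val_integral X \<nu> h \<le> val_integral X \<nu>' h"
  unfolding val_integral_LX[OF assms(1)]
  by (intro nn_integral_mono mult_right_mono assms(2) LX_open[OF assms(1)]) auto

lemma val_integral_mono:
  assumes \<nu>: "\<nu> \<in> valuations X" and "h \<in> LX X" "k \<in> LX X" and "\<And>x. h x \<le> k x"
  shows "val_integral X \<nu> h \<le> val_integral X \<nu> k"
  unfolding val_integral_LX[OF assms(2)] val_integral_LX[OF assms(3)]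
proof (intro nn_integral_mono mult_right_mono)
  fix t
  have "{x. ennreal t < h x} \<subseteq> {x. ennreal t < k x}" using assms(4) order_less_le_trans by blast
  then show "\<nu> {x. ennreal t < h x} \<le> \<nu> {x. ennreal t < k x}"
    by (intro valuations_mono[OF \<nu>] LX_open assms)
qed auto

lemma val_integral_zero: "\<nu> \<in> valuations X \<Longrightarrow> val_integral X \<nu> (\<lambda>x. 0) = 0"
  by (simp add: val_integral_def valuations_empty)

text \<open>For \<open>t < c\<close> the set where \<open>h + c\<cdot>1\<^sub>U > t\<close> is \<open>{h > t} \<union> U\<close>; for \<open>t \<ge> c\<close> it is
  \<open>{h > t} \<union> (U \<inter> {h > t - c})\<close>. In both cases the two pieces meet in \<open>U \<inter> {h > t}\<close>, so modularity and
  translation invariance of Lebesgue measure give the equation up to a summand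
  \<open>\<integral> \<nu> (U \<inter> {h > t}) dt\<close> on both sides. That summand is at most the integral of \<open>h\<close>: it can be
  cancelled unless both sides are infinite anyway.\<close>

lemma val_integral_add_indicator:
  assumes \<nu>: "\<nu> \<in> valuations X" and h: "h \<in> LX X" and U: "openin X U" and c: "0 \<le> c"
  shows "val_integral X \<nu> (\<lambda>x. h x + ennreal c * indicator U x) = val_integral X \<nu> h + ennreal c * \<nu> U"
proof -
  let ?k = "\<lambda>x. h x + ennreal c * indicator U x"
  let ?u = "\<lambda>x. h x * indicator U x"
  let ?b = "\<lambda>t. \<nu> {x. ennreal t < ?u x} * indicator {0..} t"
  have k: "?k \<in> LX X" by (intro LX_add h LX_scale LX_indicator U)
  have u_eq: "{x. ennreal t < ?u x} = U \<inter> {x. ennreal t < h x}" for t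
    by (auto simp: indicator_def split: if_splits)
  have u_eq': "{x. t < ?u x} = U \<inter> {x. t < h x}" for t
    by (auto simp: indicator_def split: if_splits)
  have u: "?u \<in> LX X"
    unfolding LX_iff u_eq' by (intro allI openin_Int U LX_open[OF h])
  have pt: "\<nu> {x. ennreal t < ?k x} * indicator {0..} t + ?b t
      = \<nu> {x. ennreal t < h x} * indicator {0..} t + \<nu> U * indicator {0..<c} t + ?b (t - c)" for t
  proof -
    consider "t < 0" | "0 \<le> t" "t < c" | "0 \<le> t" "c \<le> t" by linarith
    then show ?thesis
    proof cases
      case 1
      then show ?thesis using c by simp
    next
      case 2
      then have tc: "ennreal t < ennreal c" by (simp add: ennreal_less_iff)
      have "ennreal t < h x + ennreal c" for x
        using tc by (rule order_less_le_trans) simp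
      then have e: "{x. ennreal t < ?k x} = {x. ennreal t < h x} \<union> U"
        by (auto simp: indicator_def split: if_splits)
      show ?thesis
        using 2 valuations_modular[OF \<nu> LX_open[OF h] U, of "ennreal t"]
        unfolding e u_eq by (simp add: Int_commute)
    next
      case 3
      have tc: "ennreal t = ennreal (t - c) + ennreal c"
        using 3 c by (simp add: ennreal_plus[symmetric] del: ennreal_plus)
      have "ennreal t < h x + ennreal c \<longleftrightarrow> ennreal (t - c) < h x" for x
        unfolding tc by (cases "h x") (auto simp: ennreal_plus[symmetric] ennreal_less_iff 3 c simp del: ennreal_plus)
      moreover have "ennreal (t - c) \<le> ennreal t" using c by (intro ennreal_leI) simp
      ultimately have e: "{x. ennreal t < ?k x} = {x. ennreal t < h x} \<union> (U \<inter> {x. ennreal (t - c) < h x})"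
        and e': "{x. ennreal t < h x} \<inter> (U \<inter> {x. ennreal (t - c) < h x}) = U \<inter> {x. ennreal t < h x}"
        by (auto simp: indicator_def split: if_splits intro: order_le_less_trans)
      show ?thesis
        using 3 valuations_modular[OF \<nu> LX_open[OF h] openin_Int[OF U LX_open[OF h]], of "ennreal t" "ennreal (t - c)"]
        unfolding e e' u_eq by simp
    qed
  qed
  have meas: "(\<lambda>t. g t * indicator {0..} t) \<in> borel_measurable borel"
    if "g \<in> borel_measurable borel" for g :: "real \<Rightarrow> ennreal"
    using that by measurable
  note mb = meas[OF level_measurable[OF \<nu> u]]
  note mh = meas[OF level_measurable[OF \<nu> h]]
  note mk = meas[OF level_measurable[OF \<nu> k]]
  have mc: "(\<lambda>t. ?b (t - c)) \<in> borel_measurable borel"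
    using measurable_compose[OF _ mb, of "\<lambda>t. t - c"] by simp
  have mU: "(\<lambda>t. \<nu> U * indicator {0..<c} t) \<in> borel_measurable borel"
    by measurable
  have shift: "(\<integral>\<^sup>+ t. ?b (t - c) \<partial>lborel) = (\<integral>\<^sup>+ t. ?b t \<partial>lborel)"
    using nn_integral_real_affine[OF mb, of 1 "- c"] by simp
  have "val_integral X \<nu> ?k + val_integral X \<nu> ?u
      = (\<integral>\<^sup>+ t. \<nu> {x. ennreal t < ?k x} * indicator {0..} t + ?b t \<partial>lborel)"
    unfolding val_integral_LX[OF k] val_integral_LX[OF u]
    using mk mb by (intro nn_integral_add[symmetric]) simp_all
  also have "\<dots> = (\<integral>\<^sup>+ t. \<nu> {x. ennreal t < h x} * indicator {0..} t \<partial>lborel)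
      + (\<integral>\<^sup>+ t. \<nu> U * indicator {0..<c} t \<partial>lborel) + (\<integral>\<^sup>+ t. ?b (t - c) \<partial>lborel)"
    unfolding pt using mh mU mc by (simp add: nn_integral_add borel_measurable_add)
  also have "(\<integral>\<^sup>+ t. \<nu> U * indicator {0..<c} t \<partial>lborel) = ennreal c * \<nu> U"
    using c by (simp add: nn_integral_cmult mult.commute)
  finally have eq: "val_integral X \<nu> ?k + val_integral X \<nu> ?u
      = val_integral X \<nu> h + ennreal c * \<nu> U + val_integral X \<nu> ?u"
    unfolding shift val_integral_LX[OF h] val_integral_LX[OF u] .
  have le: "val_integral X \<nu> h \<le> val_integral X \<nu> ?k"
    by (rule val_integral_mono[OF \<nu> h k]) simp
  have "val_integral X \<nu> ?u \<le> val_integral X \<nu> h"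
    by (rule val_integral_mono[OF \<nu> u h]) (simp add: indicator_def)
  show ?thesis
  proof (cases "val_integral X \<nu> h = top")
    case True
    then show ?thesis using le by (simp add: top_unique)
  next
    case False
    then have "val_integral X \<nu> ?u \<noteq> top"
      using \<open>val_integral X \<nu> ?u \<le> val_integral X \<nu> h\<close> by (auto simp: top_unique)
    moreover have "val_integral X \<nu> ?u + val_integral X \<nu> ?k
        = val_integral X \<nu> ?u + (val_integral X \<nu> h + ennreal c * \<nu> U)"
      using eq by (simp only: add.commute)
    ultimately show ?thesis by (simp only: ennreal_add_left_cancel) simp
  qed
qed

lemma val_integral_add_sum:
  assumes \<nu>: "\<nu> \<in> valuations X" and h: "h \<in> LX X" and c: "0 \<le> c" and fin: "finite I"
    and U: "\<And>i. i \<in> I \<Longrightarrow> openin X (U i)"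
  shows "val_integral X \<nu> (\<lambda>x. h x + (\<Sum>i\<in>I. ennreal c * indicator (U i) x))
    = val_integral X \<nu> h + (\<Sum>i\<in>I. ennreal c * \<nu> (U i))"
  using fin U
proof (induction I rule: finite_induct)
  case (insert i I)
  have "(\<lambda>x. h x + (\<Sum>i\<in>I. ennreal c * indicator (U i) x)) \<in> LX X"
    using insert by (intro LX_add h LX_sum LX_scale LX_indicator) auto
  then have "val_integral X \<nu> (\<lambda>x. (h x + (\<Sum>i\<in>I. ennreal c * indicator (U i) x)) + ennreal c * indicator (U i) x)
      = val_integral X \<nu> (\<lambda>x. h x + (\<Sum>i\<in>I. ennreal c * indicator (U i) x)) + ennreal c * \<nu> (U i)"
    using insert by (intro val_integral_add_indicator[OF \<nu> _ _ c]) auto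
  moreover have "(\<lambda>x. h x + (\<Sum>i\<in>insert i I. ennreal c * indicator (U i) x))
      = (\<lambda>x. (h x + (\<Sum>i\<in>I. ennreal c * indicator (U i) x)) + ennreal c * indicator (U i) x)"
    by (simp only: sum.insert[OF insert(1,2)] ac_simps)
  ultimately show ?case
    using insert by (simp only: sum.insert[OF insert(1,2)]) (simp add: ac_simps)
qed simp

lemma val_integral_incseq:
  assumes \<nu>: "\<nu> \<in> valuations X" and f: "\<And>n. f n \<in> LX X" and inc: "incseq f"
  shows "val_integral X \<nu> (\<lambda>x. SUP n. f n x) = (SUP n. val_integral X \<nu> (f n))"
proof -
  have le: "f m x \<le> f n x" if "m \<le> n" for m n x
    using inc that by (auto simp: incseq_def le_fun_def)
  have sub: "{x. t < f m x} \<subseteq> {x. t < f n x}" if "m \<le> n" for m n t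
    using le[OF that] order_less_le_trans by blast
  have S: "(\<lambda>x. SUP n. f n x) \<in> LX X" by (rule LX_SUP) (rule f)
  have lev: "\<nu> {x. t < (SUP n. f n x)} = (SUP n. \<nu> {x. t < f n x})" for t
  proof -
    have "{x. t < (SUP n. f n x)} = (\<Union>n. {x. t < f n x})" by (auto simp: less_SUP_iff)
    also have "\<nu> \<dots> = (SUP n. \<nu> {x. t < f n x})"
    proof (rule valuations_UNION_directed[OF \<nu>])
      fix d e :: nat
      show "\<exists>g\<in>UNIV. {x. t < f d x} \<subseteq> {x. t < f g x} \<and> {x. t < f e x} \<subseteq> {x. t < f g x}"
        using sub[of d "max d e" t] sub[of e "max d e" t] by auto
    qed (auto intro: LX_open f)
    finally show ?thesis .
  qed
  have "val_integral X \<nu> (\<lambda>x. SUP n. f n x)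
      = (\<integral>\<^sup>+ t. (SUP n. \<nu> {x. ennreal t < f n x} * indicator {0..} t) \<partial>lborel)"
    unfolding val_integral_LX[OF S] lev by (simp add: SUP_mult_right_ennreal)
  also have "\<dots> = (SUP n. \<integral>\<^sup>+ t. \<nu> {x. ennreal t < f n x} * indicator {0..} t \<partial>lborel)"
  proof (rule nn_integral_monotone_convergence_SUP)
    show "incseq (\<lambda>n t. \<nu> {x. ennreal t < f n x} * indicator {0..} t)"
      by (intro incseq_SucI le_funI mult_right_mono valuations_mono[OF \<nu>] LX_open f sub) auto
    show "(\<lambda>t. \<nu> {x. ennreal t < f n x} * indicator {0..} t) \<in> borel_measurable lborel" for n
      using level_measurable[OF \<nu> f] by measurable
  qed
  finally show ?thesis unfolding val_integral_LX[OF f] .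
qed

section \<open>Scott-continuous linear functionals are integrals\<close>

lemma directed_range_incseq: "incseq f \<Longrightarrow> directed (range f)"
  unfolding directed_def by (auto simp: incseq_def) (metis max.cobounded1 max.cobounded2)

lemma scott_continuous_on_incseq:
  fixes f :: "nat \<Rightarrow> 'a \<Rightarrow> ennreal"
  assumes "scott_continuous_on A F" "\<And>n. f n \<in> A" "incseq f"
  shows "F (\<lambda>x. SUP n. f n x) = (SUP n. F (f n))"
proof -
  have "F (Sup (range f)) = (SUP d\<in>range f. F d)"
    using assms by (intro scott_continuous_on_Sup directed_range_incseq) auto
  moreover have "Sup (range f) = (\<lambda>x. SUP n. f n x)" by (auto simp: fun_eq_iff image_comp)
  ultimately show ?thesis by (simp add: image_comp)
qed

lemma SUP_sum_directed:
  fixes f :: "'i \<Rightarrow> 'a::order \<Rightarrow> ennreal"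
  assumes D: "directed D" and mono: "\<And>i d e. i \<in> I \<Longrightarrow> d \<in> D \<Longrightarrow> e \<in> D \<Longrightarrow> d \<le> e \<Longrightarrow> f i d \<le> f i e"
    and fin: "finite I"
  shows "(SUP d\<in>D. \<Sum>i\<in>I. f i d) = (\<Sum>i\<in>I. SUP d\<in>D. f i d)"
  using fin mono
proof (induction I rule: finite_induct)
  case empty
  then show ?case using D by (simp add: directed_def)
next
  case (insert i I)
  have "(SUP d\<in>D. f i d + (\<Sum>i\<in>I. f i d)) = (SUP d\<in>D. f i d) + (SUP d\<in>D. \<Sum>i\<in>I. f i d)"
  proof (rule SUP_add_directed_ennreal)
    fix d e assume "d \<in> D" "e \<in> D"
    then obtain g where "g \<in> D" "d \<le> g" "e \<le> g" using D unfolding directed_def by blast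
    then show "\<exists>g\<in>D. f i d + (\<Sum>i\<in>I. f i e) \<le> f i g + (\<Sum>i\<in>I. f i g)"
      using insert.prems \<open>d \<in> D\<close> \<open>e \<in> D\<close> by (intro bexI[of _ g] add_mono sum_mono) auto
  qed
  then show ?case using insert by simp
qed

definition scott_linear :: "'a topology \<Rightarrow> (('a \<Rightarrow> ennreal) \<Rightarrow> ennreal) \<Rightarrow> bool" where
  "scott_linear X G \<longleftrightarrow> scott_continuous_on (LX X) G \<and>
     (\<forall>a::real. \<forall>h\<in>LX X. 0 \<le> a \<longrightarrow> G (\<lambda>x. ennreal a * h x) = ennreal a * G h) \<and>
     (\<forall>h\<in>LX X. \<forall>k\<in>LX X. G (\<lambda>x. h x + k x) = G h + G k)"

lemma scott_linear_add:
  "scott_linear X G \<Longrightarrow> h \<in> LX X \<Longrightarrow> k \<in> LX X \<Longrightarrow> G (\<lambda>x. h x + k x) = G h + G k"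
  by (simp add: scott_linear_def)

lemma scott_linear_scale:
  "scott_linear X G \<Longrightarrow> h \<in> LX X \<Longrightarrow> 0 \<le> a \<Longrightarrow> G (\<lambda>x. ennreal a * h x) = ennreal a * G h"
  by (simp add: scott_linear_def)

lemma scott_linear_scott: "scott_linear X G \<Longrightarrow> scott_continuous_on (LX X) G"
  by (simp add: scott_linear_def)

lemma scott_linear_zero: "scott_linear X G \<Longrightarrow> G (\<lambda>x. 0) = 0"
  using scott_linear_scale[OF _ LX_zero, of X G 0] by simp

lemma scott_linear_sum:
  assumes G: "scott_linear X G" and c: "0 \<le> c" and fin: "finite I" and U: "\<And>i. i \<in> I \<Longrightarrow> openin X (U i)"
  shows "G (\<lambda>x. \<Sum>i\<in>I. ennreal c * indicator (U i) x) = (\<Sum>i\<in>I. ennreal c * G (indicator (U i)))"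
  using fin U
proof (induction I rule: finite_induct)
  case empty
  then show ?case using scott_linear_zero[OF G] by simp
next
  case (insert i I)
  have "G (\<lambda>x. ennreal c * indicator (U i) x + (\<Sum>i\<in>I. ennreal c * indicator (U i) x))
     = G (\<lambda>x. ennreal c * indicator (U i) x) + G (\<lambda>x. \<Sum>i\<in>I. ennreal c * indicator (U i) x)"
    using insert by (intro scott_linear_add[OF G] LX_scale LX_sum LX_indicator) auto
  moreover have "G (\<lambda>x. ennreal c * indicator (U i) x) = ennreal c * G (indicator (U i))"
    using insert by (intro scott_linear_scale[OF G] c LX_indicator) auto
  moreover have "G (\<lambda>x. \<Sum>i\<in>I. ennreal c * indicator (U i) x) = (\<Sum>i\<in>I. ennreal c * G (indicator (U i)))"
    using insert by blast
  ultimately show ?case by (simp only: sum.insert[OF insert(1,2)])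
qed

lemma dyadic_approx_comp:
  "dyadic_approx n (h x)
     = (\<Sum>i = 1..n * 2 ^ n :: nat. ennreal (1 / 2 ^ n) * indicator {x. ennreal (real i / 2 ^ n) < h x} x)"
  unfolding dyadic_approx_def by (intro sum.cong refl) (auto simp: indicator_def)

lemma LX_dyadic_approx: "h \<in> LX X \<Longrightarrow> (\<lambda>x. dyadic_approx n (h x)) \<in> LX X"
  unfolding dyadic_approx_comp by (intro LX_sum LX_scale LX_indicator LX_open) auto

lemma incseq_dyadic_approx_comp: "incseq (\<lambda>n x. dyadic_approx n (h x))"
  by (intro incseq_SucI le_funI dyadic_approx_Suc)

lemma scott_linear_dyadic:
  assumes G: "scott_linear X G" and h: "h \<in> LX X"
  shows "G h = (SUP n. \<Sum>i = 1..n * 2 ^ n :: nat.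
     ennreal (1 / 2 ^ n) * G (indicator {x. ennreal (real i / 2 ^ n) < h x}))"
proof -
  have "G (\<lambda>x. SUP n. dyadic_approx n (h x)) = (SUP n. G (\<lambda>x. dyadic_approx n (h x)))"
    by (intro scott_continuous_on_incseq[OF scott_linear_scott[OF G]] LX_dyadic_approx h incseq_dyadic_approx_comp)
  then show ?thesis
    unfolding SUP_dyadic_approx unfolding dyadic_approx_comp
    by (subst (asm) scott_linear_sum[OF G]) (auto intro: LX_open h)
qed

lemma val_integral_dyadic:
  assumes \<nu>: "\<nu> \<in> valuations X" and h: "h \<in> LX X" and a: "0 \<le> a"
  shows "val_integral X \<nu> (\<lambda>x. ennreal a * h x) = (SUP n. \<Sum>i = 1..n * 2 ^ n :: nat.
     ennreal (a * (1 / 2 ^ n)) * \<nu> {x. ennreal (real i / 2 ^ n) < h x})"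
proof -
  have "val_integral X \<nu> (\<lambda>x. SUP n. ennreal a * dyadic_approx n (h x))
      = (SUP n. val_integral X \<nu> (\<lambda>x. ennreal a * dyadic_approx n (h x)))"
    by (intro val_integral_incseq[OF \<nu>] LX_scale LX_dyadic_approx h incseq_SucI le_funI
        mult_left_mono dyadic_approx_Suc) auto
  moreover have "(SUP n. ennreal a * dyadic_approx n (h x)) = ennreal a * h x" for x
    using SUP_dyadic_approx[of "h x"] by (simp add: SUP_mult_left_ennreal[symmetric])
  moreover have "val_integral X \<nu> (\<lambda>x. ennreal a * dyadic_approx n (h x)) = (\<Sum>i = 1..n * 2 ^ n :: nat.
     ennreal (a * (1 / 2 ^ n)) * \<nu> {x. ennreal (real i / 2 ^ n) < h x})" for n
  proof -
    have "(\<lambda>x. ennreal a * dyadic_approx n (h x)) = (\<lambda>x. 0 + (\<Sum>i = 1..n * 2 ^ n :: nat.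
        ennreal (a * (1 / 2 ^ n)) * indicator {x. ennreal (real i / 2 ^ n) < h x} x))"
      unfolding dyadic_approx_comp sum_distrib_left
      using a by (simp add: ennreal_mult mult.assoc del: times_divide_eq_right)
    then show ?thesis
      using val_integral_add_sum[OF \<nu> LX_zero, of "a * (1 / 2 ^ n)" "{1..n * 2 ^ n}"
          "\<lambda>i. {x. ennreal (real i / 2 ^ n) < h x}"] a LX_open[OF h] val_integral_zero[OF \<nu>]
      by (simp del: times_divide_eq_right)
  qed
  ultimately show ?thesis by simp
qed

lemma val_integral_dyadic_1:
  assumes \<nu>: "\<nu> \<in> valuations X" and h: "h \<in> LX X"
  shows "val_integral X \<nu> h = (SUP n. \<Sum>i = 1..n * 2 ^ n :: nat.
     ennreal (1 / 2 ^ n) * \<nu> {x. ennreal (real i / 2 ^ n) < h x})"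
  using val_integral_dyadic[OF assms, of 1] by simp

text \<open>Adding a dyadic step function to \<open>h\<close> adds finitely many terms \<open>c * \<nu> U\<close> to the integral, and the
  dyadic approximations of a function increase to it. As their thresholds are fixed, a supremum over an
  arbitrary directed family can be exchanged with the finite sums, although monotone convergence holds
  for sequences only.\<close>

theorem scott_linear_val_integral:
  assumes \<nu>: "\<nu> \<in> valuations X"
  shows "scott_linear X (val_integral X \<nu>)"
  unfolding scott_linear_def scott_continuous_on_def
proof (intro conjI ballI allI impI)
  fix h k assume "h \<in> LX X" "k \<in> LX X" "h \<le> k"
  then show "val_integral X \<nu> h \<le> val_integral X \<nu> k"
    by (intro val_integral_mono[OF \<nu>]) (auto simp: le_fun_def)
next
  fix a :: real and h assume h: "h \<in> LX X" and a: "0 \<le> a"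
  show "val_integral X \<nu> (\<lambda>x. ennreal a * h x) = ennreal a * val_integral X \<nu> h"
    unfolding val_integral_dyadic[OF \<nu> h a] val_integral_dyadic_1[OF \<nu> h]
    using a by (simp add: SUP_mult_left_ennreal sum_distrib_left ennreal_mult mult.assoc del: times_divide_eq_right)
next
  fix h k assume h: "h \<in> LX X" and k: "k \<in> LX X"
  have "val_integral X \<nu> (\<lambda>x. SUP n. h x + dyadic_approx n (k x))
      = (SUP n. val_integral X \<nu> (\<lambda>x. h x + dyadic_approx n (k x)))"
    by (intro val_integral_incseq[OF \<nu>] LX_add LX_dyadic_approx h k incseq_SucI le_funI
        add_left_mono dyadic_approx_Suc)
  moreover have "(SUP n. h x + dyadic_approx n (k x)) = h x + k x" for x
    using SUP_dyadic_approx[of "k x"] ennreal_SUP_add_right[of UNIV "h x" "\<lambda>n. dyadic_approx n (k x)"] by simp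
  moreover have "val_integral X \<nu> (\<lambda>x. h x + dyadic_approx n (k x)) = val_integral X \<nu> h +
     (\<Sum>i = 1..n * 2 ^ n :: nat. ennreal (1 / 2 ^ n) * \<nu> {x. ennreal (real i / 2 ^ n) < k x})" for n
    unfolding dyadic_approx_comp by (intro val_integral_add_sum[OF \<nu> h] LX_open[OF k]) auto
  ultimately show "val_integral X \<nu> (\<lambda>x. h x + k x) = val_integral X \<nu> h + val_integral X \<nu> k"
    unfolding val_integral_dyadic_1[OF \<nu> k] by (simp add: ennreal_SUP_add_right)
next
  fix D assume "D \<subseteq> LX X \<and> directed D"
  then have D: "D \<subseteq> LX X" and dir: "directed D" by auto
  have S: "Sup D \<in> LX X" by (rule LX_Sup) (rule D)
  have sub: "{x. t < d x} \<subseteq> {x. t < e x}" if "d \<le> e" for t :: ennreal and d e :: "'a \<Rightarrow> ennreal"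
    using that by (auto simp: le_fun_def intro: order_less_le_trans)
  have lev: "\<nu> {x. t < Sup D x} = (SUP d\<in>D. \<nu> {x. t < d x})" for t
  proof -
    have "{x. t < Sup D x} = (\<Union>d\<in>D. {x. t < d x})" by (auto simp: less_SUP_iff)
    also have "\<nu> \<dots> = (SUP d\<in>D. \<nu> {x. t < d x})"
    proof (rule valuations_UNION_directed[OF \<nu>])
      fix d e assume "d \<in> D" "e \<in> D"
      then obtain f where "f \<in> D" "d \<le> f" "e \<le> f" using dir unfolding directed_def by blast
      then show "\<exists>f\<in>D. {x. t < d x} \<subseteq> {x. t < f x} \<and> {x. t < e x} \<subseteq> {x. t < f x}"
        using sub by blast
    qed (use D dir in \<open>auto intro: LX_open simp: directed_def\<close>)
    finally show ?thesis .
  qed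
  have "val_integral X \<nu> (Sup D) = (SUP n. \<Sum>i = 1..n * 2 ^ n :: nat.
     SUP d\<in>D. ennreal (1 / 2 ^ n) * \<nu> {x. ennreal (real i / 2 ^ n) < d x})"
    unfolding val_integral_dyadic_1[OF \<nu> S] lev by (simp add: SUP_mult_left_ennreal)
  also have "\<dots> = (SUP n. SUP d\<in>D. \<Sum>i = 1..n * 2 ^ n :: nat.
     ennreal (1 / 2 ^ n) * \<nu> {x. ennreal (real i / 2 ^ n) < d x})"
    by (intro SUP_cong refl SUP_sum_directed[symmetric] dir mult_left_mono valuations_mono[OF \<nu>] LX_open sub)
       (use D in auto)
  also have "\<dots> = (SUP d\<in>D. SUP n. \<Sum>i = 1..n * 2 ^ n :: nat.
     ennreal (1 / 2 ^ n) * \<nu> {x. ennreal (real i / 2 ^ n) < d x})"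
    by (rule SUP_commute)
  also have "\<dots> = (SUP d\<in>D. val_integral X \<nu> d)"
    by (intro SUP_cong refl val_integral_dyadic_1[OF \<nu>, symmetric]) (use D in auto)
  finally show "val_integral X \<nu> (Sup D) = (SUP d\<in>D. val_integral X \<nu> d)" .
qed

lemmas val_integral_add = scott_linear_add[OF scott_linear_val_integral]
lemmas val_integral_scale = scott_linear_scale[OF scott_linear_val_integral]

lemma val_integral_indicator:
  assumes \<nu>: "\<nu> \<in> valuations X" and U: "openin X U"
  shows "val_integral X \<nu> (indicator U) = \<nu> U"
  using val_integral_add_indicator[OF \<nu> LX_zero U, of 1] val_integral_zero[OF \<nu>] by simp

text \<open>The Riesz correspondence: on Scott-continuous linear functionals this is the inverse of integration.\<close>

definition val_of :: "'a topology \<Rightarrow> (('a \<Rightarrow> ennreal) \<Rightarrow> ennreal) \<Rightarrow> 'a set \<Rightarrow> ennreal" where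
  "val_of X G = zero_ext {U. openin X U} (\<lambda>U. G (indicator U))"

lemma val_of_open: "openin X U \<Longrightarrow> val_of X G U = G (indicator U)"
  by (simp add: val_of_def zero_ext_def)

text \<open>Modularity is additivity at \<open>1\<^sub>U + 1\<^sub>V = 1\<^bsub>U \<union> V\<^esub> + 1\<^bsub>U \<inter> V\<^esub>\<close>.\<close>

theorem val_of_valuation:
  assumes G: "scott_linear X G"
  shows "val_of X G \<in> valuations X"
  unfolding valuations_def scott_continuous_on_def
proof (intro CollectI conjI ballI allI impI)
  have "indicator {} = (\<lambda>x::'a. 0::ennreal)" by (auto simp: indicator_def)
  then show "val_of X G {} = 0" using scott_linear_zero[OF G] by (simp add: val_of_open)
next
  fix U V assume o: "openin X U \<and> openin X V"
  have "G (\<lambda>x. indicator U x + indicator V x) = G (\<lambda>x. indicator (U \<union> V) x + indicator (U \<inter> V) x)"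
    by (rule arg_cong[of _ _ G]) (auto simp: indicator_def)
  then show "val_of X G U + val_of X G V = val_of X G (U \<union> V) + val_of X G (U \<inter> V)"
    using o by (simp add: val_of_open openin_Un openin_Int scott_linear_add[OF G] LX_indicator)
next
  fix U V assume "U \<in> {U. openin X U}" "V \<in> {U. openin X U}" "U \<subseteq> V"
  then show "val_of X G U \<le> val_of X G V"
    by (simp add: val_of_open)
      (intro scott_continuous_on_mono[OF scott_linear_scott[OF G]] LX_indicator, auto simp: le_fun_def indicator_def)
next
  fix D assume "D \<subseteq> {U. openin X U} \<and> directed D"
  then have D: "\<And>U. U \<in> D \<Longrightarrow> openin X U" and dir: "directed D" by auto
  have "G (Sup (indicator ` D)) = (SUP d\<in>indicator ` D. G d)"
  proof (rule scott_continuous_on_Sup[OF scott_linear_scott[OF G]])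
    show "indicator ` D \<subseteq> LX X" using D by (auto intro: LX_indicator)
    have "indicator U \<le> (indicator V :: 'a \<Rightarrow> ennreal)" if "U \<subseteq> V" for U V
      using that by (auto simp: le_fun_def indicator_def)
    then show "directed (indicator ` D :: ('a \<Rightarrow> ennreal) set)"
      using dir unfolding directed_def by (simp add: ball_simps) blast
  qed
  moreover have "Sup (indicator ` D) = (indicator (\<Union>D) :: 'a \<Rightarrow> ennreal)"
  proof
    fix x
    show "Sup (indicator ` D) x = (indicator (\<Union>D) x :: ennreal)"
    proof (cases "x \<in> \<Union>D")
      case True
      then obtain U where "U \<in> D" "x \<in> U" by blast
      then have "(SUP U\<in>D. indicator U x) = (1 :: ennreal)"
        by (intro antisym SUP_least SUP_upper2[of U]) (auto simp: indicator_def)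
      then show ?thesis using True by (simp add: image_comp)
    next
      case False
      then have "(SUP U\<in>D. indicator U x) = (0 :: ennreal)"
        by (intro antisym SUP_least) (auto simp: indicator_def)
      then show ?thesis using False by (simp add: image_comp)
    qed
  qed
  moreover have "(SUP d\<in>D. val_of X G d) = (SUP d\<in>D. G (indicator d))"
    by (intro SUP_cong refl val_of_open D)
  moreover have "openin X (\<Union>D)" using D by blast
  ultimately show "val_of X G (Sup D) = (SUP d\<in>D. val_of X G d)"
    by (simp add: val_of_open image_comp)
next
  fix U assume "\<not> openin X U"
  then show "val_of X G U = 0" by (simp add: val_of_def zero_ext_def)
qed

text \<open>A Scott-continuous linear functional is determined by its values on indicators of open sets.\<close>

theorem val_integral_val_of:
  assumes G: "scott_linear X G" and h: "h \<in> LX X"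
  shows "val_integral X (val_of X G) h = G h"
proof -
  have "val_of X G {x. t < h x} = G (indicator {x. t < h x})" for t
    by (rule val_of_open) (rule LX_open[OF h])
  then show ?thesis
    unfolding val_integral_dyadic_1[OF val_of_valuation[OF G] h] scott_linear_dyadic[OF G h] by simp
qed

section \<open>A sandwich theorem\<close>

lemma le_INF_add:
  fixes f :: "'i \<Rightarrow> ennreal" and g :: "'j \<Rightarrow> ennreal"
  assumes "\<And>i j. i \<in> I \<Longrightarrow> j \<in> J \<Longrightarrow> x \<le> f i + g j"
  shows "x \<le> (INF i\<in>I. f i) + (INF j\<in>J. g j)"
proof -
  have one: "x \<le> a + (INF k\<in>K. h k)" if "\<And>k. k \<in> K \<Longrightarrow> x \<le> a + h k"
    for a :: ennreal and K :: "'k set" and h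
  proof (cases "a = top")
    case False
    then have "x - a \<le> (INF k\<in>K. h k)"
      using that by (intro INF_greatest) (simp add: ennreal_minus_le_iff)
    then show ?thesis using False by (simp add: ennreal_minus_le_iff)
  qed simp
  have "x \<le> (INF j\<in>J. g j) + f i" if "i \<in> I" for i
    using one[of J "f i" g] assms[OF that] by (simp add: add.commute)
  then have "x \<le> (INF j\<in>J. g j) + (INF i\<in>I. f i)" by (rule one)
  then show ?thesis by (simp add: add.commute)
qed

lemma ennreal_le_mult_iff:
  assumes "0 < a"
  shows "x \<le> ennreal a * y \<longleftrightarrow> ennreal (1 / a) * x \<le> y"
  using ennreal_less_mult_iff[of "1 / a" y x] assms by (simp add: not_less[symmetric])

lemma ennreal_inverse_cancel:
  assumes "0 < a"
  shows "ennreal a * (ennreal (1 / a) * x) = x" "ennreal (1 / a) * (ennreal a * x) = x"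
  using assms by (simp_all add: mult.assoc[symmetric] ennreal_mult[symmetric])

lemma le_mult_INF:
  assumes "0 < a" "\<And>i. i \<in> I \<Longrightarrow> x \<le> ennreal a * f i"
  shows "x \<le> ennreal a * (INF i\<in>I. f i)"
  using assms by (simp add: ennreal_le_mult_iff le_INF_iff)

definition scott_superlinear :: "'a topology \<Rightarrow> (('a \<Rightarrow> ennreal) \<Rightarrow> ennreal) \<Rightarrow> bool" where
  "scott_superlinear X F \<longleftrightarrow> scott_continuous_on (LX X) F \<and>
     (\<forall>a::real. \<forall>h\<in>LX X. 0 \<le> a \<longrightarrow> F (\<lambda>x. ennreal a * h x) = ennreal a * F h) \<and>
     (\<forall>h\<in>LX X. \<forall>k\<in>LX X. F h + F k \<le> F (\<lambda>x. h x + k x))"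

lemma scott_superlinear_mono:
  "scott_superlinear X F \<Longrightarrow> h \<in> LX X \<Longrightarrow> k \<in> LX X \<Longrightarrow> h \<le> k \<Longrightarrow> F h \<le> F k"
  unfolding scott_superlinear_def using scott_continuous_on_mono by blast

lemma scott_superlinear_scale:
  "scott_superlinear X F \<Longrightarrow> h \<in> LX X \<Longrightarrow> 0 \<le> a \<Longrightarrow> F (\<lambda>x. ennreal a * h x) = ennreal a * F h"
  by (simp add: scott_superlinear_def)

lemma scott_superlinear_superadd:
  "scott_superlinear X F \<Longrightarrow> h \<in> LX X \<Longrightarrow> k \<in> LX X \<Longrightarrow> F h + F k \<le> F (\<lambda>x. h x + k x)"
  by (simp add: scott_superlinear_def)

lemma scott_superlinear_zero: "scott_superlinear X F \<Longrightarrow> F (\<lambda>x. 0) = 0"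
  using scott_superlinear_scale[OF _ LX_zero, of X F 0] by simp

text \<open>A constraint \<open>(h, r)\<close> asks a valuation to give \<open>h\<close> an integral of at most \<open>r\<close>. A valuation that
  satisfies a set of constraints satisfies the convex cone which they generate.\<close>

inductive cone_hull :: "(('a \<Rightarrow> ennreal) \<times> ennreal) set \<Rightarrow> ('a \<Rightarrow> ennreal) \<Rightarrow> ennreal \<Rightarrow> bool" for S where
  base: "(h, r) \<in> S \<Longrightarrow> cone_hull S h r"
| zero: "cone_hull S (\<lambda>x. 0) 0"
| add: "cone_hull S h r \<Longrightarrow> cone_hull S k s \<Longrightarrow> cone_hull S (\<lambda>x. h x + k x) (r + s)"
| scale: "cone_hull S h r \<Longrightarrow> 0 < a \<Longrightarrow> cone_hull S (\<lambda>x. ennreal a * h x) (ennreal a * r)"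

lemma cone_hull_LX:
  assumes "cone_hull S h r" and "\<And>h r. (h, r) \<in> S \<Longrightarrow> h \<in> LX X"
  shows "h \<in> LX X"
  using assms by induction (auto intro: LX_zero LX_add LX_scale)

lemma cone_hull_mono: "cone_hull S h r \<Longrightarrow> S \<subseteq> S' \<Longrightarrow> cone_hull S' h r"
  by (induction rule: cone_hull.induct) (auto intro: cone_hull.intros)

lemma cone_hull_finite:
  assumes "cone_hull S h r"
  shows "\<exists>S0. finite S0 \<and> S0 \<subseteq> S \<and> cone_hull S0 h r"
  using assms
proof induction
  case (base h r)
  then show ?case by (intro exI[of _ "{(h, r)}"]) (auto intro: cone_hull.base)
next
  case zero
  show ?case by (intro exI[of _ "{}"]) (auto intro: cone_hull.zero)
next
  case (add h r k s)
  then obtain S1 S2 where "finite S1" "S1 \<subseteq> S" "cone_hull S1 h r" "finite S2" "S2 \<subseteq> S" "cone_hull S2 k s"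
    by blast
  then show ?case
    by (intro exI[of _ "S1 \<union> S2"]) (auto intro: cone_hull.add cone_hull_mono)
next
  case (scale h r a)
  then show ?case by (blast intro: cone_hull.scale)
qed

lemma cone_hull_le_val_integral:
  assumes "cone_hull S k r" and \<nu>: "\<nu> \<in> valuations X"
    and S: "\<And>h r. (h, r) \<in> S \<Longrightarrow> h \<in> LX X" "\<And>h r. (h, r) \<in> S \<Longrightarrow> val_integral X \<nu> h \<le> r"
  shows "val_integral X \<nu> k \<le> r"
  using assms(1)
proof induction
  case (base h r)
  then show ?case by (rule S(2))
next
  case zero
  show ?case by (simp add: val_integral_zero[OF \<nu>])
next
  case (add h r k s)
  then have "h \<in> LX X" "k \<in> LX X" using cone_hull_LX S(1) by blast+
  then show ?case using add by (simp add: val_integral_add[OF \<nu>] add_mono)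
next
  case (scale h r a)
  then have "h \<in> LX X" using cone_hull_LX S(1) by blast
  then show ?case using scale by (simp add: val_integral_scale[OF \<nu>] mult_left_mono)
qed

text \<open>The value \<open>0\<close> off \<open>LX X\<close> makes the pointwise order on these functionals antisymmetric.\<close>

definition sublinear_between ::
  "'a topology \<Rightarrow> (('a \<Rightarrow> ennreal) \<Rightarrow> ennreal) \<Rightarrow> (('a \<Rightarrow> ennreal) \<times> ennreal) set
    \<Rightarrow> (('a \<Rightarrow> ennreal) \<Rightarrow> ennreal) set" where
  "sublinear_between X F S = {p.
     (\<forall>h\<in>LX X. \<forall>k\<in>LX X. h \<le> k \<longrightarrow> p h \<le> p k) \<and>
     (\<forall>a::real. \<forall>h\<in>LX X. 0 < a \<longrightarrow> p (\<lambda>x. ennreal a * h x) \<le> ennreal a * p h) \<and>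
     (\<forall>h\<in>LX X. \<forall>k\<in>LX X. p (\<lambda>x. h x + k x) \<le> p h + p k) \<and>
     p (\<lambda>x. 0) = 0 \<and> (\<forall>h\<in>LX X. F h \<le> p h) \<and> (\<forall>(h, r)\<in>S. p h \<le> r) \<and>
     (\<forall>h. h \<notin> LX X \<longrightarrow> p h = 0)}"

lemma sublinear_betweenI:
  assumes "\<And>h k. h \<in> LX X \<Longrightarrow> k \<in> LX X \<Longrightarrow> h \<le> k \<Longrightarrow> p h \<le> p k"
    and "\<And>a h. h \<in> LX X \<Longrightarrow> 0 < a \<Longrightarrow> p (\<lambda>x. ennreal a * h x) \<le> ennreal a * p h"
    and "\<And>h k. h \<in> LX X \<Longrightarrow> k \<in> LX X \<Longrightarrow> p (\<lambda>x. h x + k x) \<le> p h + p k"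
    and "p (\<lambda>x. 0) \<le> 0"
    and "\<And>h. h \<in> LX X \<Longrightarrow> F h \<le> p h"
    and "\<And>h r. (h, r) \<in> S \<Longrightarrow> p h \<le> r"
    and "\<And>h. h \<notin> LX X \<Longrightarrow> p h = 0"
  shows "p \<in> sublinear_between X F S"
  unfolding sublinear_between_def using assms by auto

lemma sublinear_betweenD:
  assumes "p \<in> sublinear_between X F S"
  shows "\<And>h k. h \<in> LX X \<Longrightarrow> k \<in> LX X \<Longrightarrow> h \<le> k \<Longrightarrow> p h \<le> p k"
    and "\<And>a h. h \<in> LX X \<Longrightarrow> 0 < a \<Longrightarrow> p (\<lambda>x. ennreal a * h x) \<le> ennreal a * p h"
    and "\<And>h k. h \<in> LX X \<Longrightarrow> k \<in> LX X \<Longrightarrow> p (\<lambda>x. h x + k x) \<le> p h + p k"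
    and "p (\<lambda>x. 0) = 0"
    and "\<And>h. h \<in> LX X \<Longrightarrow> F h \<le> p h"
    and "\<And>h r. (h, r) \<in> S \<Longrightarrow> p h \<le> r"
    and "\<And>h. h \<notin> LX X \<Longrightarrow> p h = 0"
  using assms unfolding sublinear_between_def by blast+

text \<open>The largest candidate maps \<open>h\<close> to the infimum of all \<open>r\<close> such that \<open>h \<le> k\<close> for some \<open>(k, r)\<close> in the cone.
  It is above \<open>F\<close> because \<open>F\<close> is below the cone.\<close>

lemma sublinear_between_nonempty:
  assumes S: "\<And>h r. (h, r) \<in> S \<Longrightarrow> h \<in> LX X"
    and F: "scott_superlinear X F"
    and FS: "\<And>k r. cone_hull S k r \<Longrightarrow> F k \<le> r"
  shows "sublinear_between X F S \<noteq> {}"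
proof -
  define K where "K h = {(k, r). cone_hull S k r \<and> h \<le> k}" for h
  define p where "p h = (if h \<in> LX X then INF (k, r)\<in>K h. r else 0)" for h
  have p_le: "p h \<le> r" if "cone_hull S k r" "h \<le> k" for h k r
    using that by (auto simp: p_def K_def intro!: INF_lower2[of "(k, r)"])
  have "p \<in> sublinear_between X F S"
  proof (rule sublinear_betweenI)
    fix h k assume "h \<in> LX X" "k \<in> LX X" "h \<le> k"
    then show "p h \<le> p k"
      by (auto simp: p_def K_def intro!: INF_superset_mono)
  next
    fix a :: real and h assume h: "h \<in> LX X" and a: "0 < a"
    have ph: "p h = (INF (k, r)\<in>K h. r)" using h by (simp add: p_def)
    show "p (\<lambda>x. ennreal a * h x) \<le> ennreal a * p h"
      unfolding ph
    proof (rule le_mult_INF[OF a])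
      fix kr assume "kr \<in> K h"
      then obtain k r where kr: "kr = (k, r)" "cone_hull S k r" "h \<le> k" by (auto simp: K_def)
      then have "p (\<lambda>x. ennreal a * h x) \<le> ennreal a * r"
        by (intro p_le[OF cone_hull.scale[OF kr(2) a]]) (auto simp: le_fun_def intro: mult_left_mono)
      then show "p (\<lambda>x. ennreal a * h x) \<le> ennreal a * (case kr of (k, r) \<Rightarrow> r)" by (simp add: kr)
    qed
  next
    fix h k assume h: "h \<in> LX X" and k: "k \<in> LX X"
    have ph: "p h = (INF (k, r)\<in>K h. r)" "p k = (INF (k, r)\<in>K k. r)" using h k by (simp_all add: p_def)
    show "p (\<lambda>x. h x + k x) \<le> p h + p k"
      unfolding ph
    proof (rule le_INF_add)
      fix kr ls assume "kr \<in> K h" "ls \<in> K k"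
      then obtain k' r l s where kr: "kr = (k', r)" "cone_hull S k' r" "h \<le> k'"
        "ls = (l, s)" "cone_hull S l s" "k \<le> l" by (auto simp: K_def)
      then have "p (\<lambda>x. h x + k x) \<le> r + s"
        by (intro p_le[OF cone_hull.add[OF kr(2,5)]]) (auto simp: le_fun_def intro: add_mono)
      then show "p (\<lambda>x. h x + k x) \<le> (case kr of (k, r) \<Rightarrow> r) + (case ls of (k, r) \<Rightarrow> r)" by (simp add: kr)
    qed
  next
    show "p (\<lambda>x. 0) \<le> 0" by (rule p_le[OF cone_hull.zero]) simp
  next
    fix h assume h: "h \<in> LX X"
    have "F h \<le> r" if "cone_hull S k r" "h \<le> k" for k r
      using scott_superlinear_mono[OF F h cone_hull_LX[OF that(1) S] that(2)] FS[OF that(1)]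
      by (meson order.trans)
    then show "F h \<le> p h" using h by (auto simp: p_def K_def intro!: INF_greatest)
  next
    fix h r assume "(h, r) \<in> S"
    then show "p h \<le> r" by (intro p_le[of h r] cone_hull.base) auto
  qed (simp add: p_def)
  then show ?thesis by blast
qed

text \<open>Zorn's lemma applies because the infimum of a chain of sublinear functionals is subadditive: any two
  members have a common lower bound in the chain.\<close>

lemma sublinear_between_minimal:
  assumes ne: "sublinear_between X F S \<noteq> {}"
  obtains p where "p \<in> sublinear_between X F S"
    and "\<And>q. q \<in> sublinear_between X F S \<Longrightarrow> q \<le> p \<Longrightarrow> q = p"
proof -
  let ?A = "sublinear_between X F S"
  have "\<exists>m\<in>?A. \<forall>a\<in>?A. a \<le> m \<longrightarrow> a = m"
  proof (rule predicate_Zorn)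
    show "partial_order_on ?A (relation_of (\<lambda>p q. q \<le> p) ?A)"
      by (rule partial_order_on_relation_ofI) auto
  next
    fix C assume "C \<in> Chains (relation_of (\<lambda>p q. q \<le> p) ?A)"
    then have CA: "\<And>p. p \<in> C \<Longrightarrow> p \<in> ?A" and chain: "\<And>p q. p \<in> C \<Longrightarrow> q \<in> C \<Longrightarrow> p \<le> q \<or> q \<le> p"
      unfolding Chains_def relation_of_def by blast+
    show "\<exists>u\<in>?A. \<forall>a\<in>C. u \<le> a"
    proof (cases "C = {}")
      case True
      then show ?thesis using ne by auto
    next
      case False
      define u where "u h = (INF p\<in>C. p h)" for h
      note D = sublinear_betweenD[OF CA]
      have le: "u h \<le> p h" if "p \<in> C" for p h
        unfolding u_def using that by (rule INF_lower)
      have "u \<in> ?A"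
      proof (rule sublinear_betweenI)
        fix h k assume "h \<in> LX X" "k \<in> LX X" "h \<le> k"
        then show "u h \<le> u k" unfolding u_def by (intro INF_mono) (use D(1) in blast)
      next
        fix a :: real and h assume "h \<in> LX X" "0 < a"
        then show "u (\<lambda>x. ennreal a * h x) \<le> ennreal a * u h"
          unfolding u_def[of h] by (intro le_mult_INF) (auto intro: order.trans[OF le D(2)])
      next
        fix h k assume hk: "h \<in> LX X" "k \<in> LX X"
        show "u (\<lambda>x. h x + k x) \<le> u h + u k"
          unfolding u_def[of h] u_def[of k]
        proof (rule le_INF_add)
          fix p q assume "p \<in> C" "q \<in> C"
          then obtain w where w: "w \<in> C" "w \<le> p" "w \<le> q" using chain by blast
          have "u (\<lambda>x. h x + k x) \<le> w h + w k" using le[OF w(1)] D(3)[OF w(1) hk] by (meson order.trans)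
          also have "\<dots> \<le> p h + q k" using w(2,3) by (intro add_mono) (auto simp: le_fun_def)
          finally show "u (\<lambda>x. h x + k x) \<le> p h + q k" .
        qed
      next
        obtain p where "p \<in> C" using False by blast
        then show "u (\<lambda>x. 0) \<le> 0" using le[of p "\<lambda>x. 0"] D(4)[of p] by simp
      next
        fix h assume "h \<in> LX X"
        then show "F h \<le> u h" unfolding u_def by (intro INF_greatest D(5))
      next
        obtain p where p: "p \<in> C" using False by blast
        fix h r assume "(h, r) \<in> S"
        then show "u h \<le> r" using le[OF p] D(6)[OF p] by (meson order.trans)
      next
        fix h assume "h \<notin> LX X"
        moreover obtain p where "p \<in> C" using False by blast
        ultimately show "u h = 0" using le[of p h] D(7)[of p h] by simp
      qed
      then show ?thesis using le by (auto simp: le_fun_def)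
    qed
  qed
  then show ?thesis using that by blast
qed

text \<open>Given \<open>a\<close>, lowering the value at \<open>a\<close> to \<open>s\<close> while staying sublinear yields
  \<open>q x = inf {p y + l * s | x \<le> y + l * a}\<close>, which remains above \<open>F\<close> as long as \<open>s\<close> dominates all the
  differences \<open>F x - p y\<close> with \<open>x \<le> y + a\<close>. Minimality of \<open>p\<close> hence forces \<open>p a\<close> to be at most the
  supremum of these differences. If \<open>F x - p y\<close> and \<open>F x' - p y'\<close> are nearly \<open>p a\<close> and \<open>p b\<close>, then
  superadditivity of \<open>F\<close> bounds their sum by \<open>p (y + y' + a + b) - p y - p y' \<le> p (a + b)\<close>.\<close>

lemma minimal_sublinear_superadditive:
  assumes F: "scott_superlinear X F"
    and p: "p \<in> sublinear_between X F S"
    and min: "\<And>q. q \<in> sublinear_between X F S \<Longrightarrow> q \<le> p \<Longrightarrow> q = p"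
    and S: "\<And>h r. (h, r) \<in> S \<Longrightarrow> h \<in> LX X"
    and a: "a \<in> LX X" and b: "b \<in> LX X"
  shows "p a + p b \<le> p (\<lambda>x. a x + b x)"
proof -
  note P = sublinear_betweenD[OF p]
  \<comment> \<open>A member of \<open>T a\<close> is a lower bound of some difference \<open>F x - p y\<close>; the form \<open>t + p y \<le> F x\<close> keeps
    subtraction out of the estimates.\<close>
  define T where "T a = {t. \<exists>x\<in>LX X. \<exists>y\<in>LX X. x \<le> (\<lambda>z. y z + a z) \<and> p y < top \<and> t + p y \<le> F x}" for a
  have bound: "p a \<le> Sup (T a)" if a: "a \<in> LX X" for a
  proof -
    define s where "s = Sup (T a)"
    define K where "K x = {(y, l). y \<in> LX X \<and> 0 \<le> l \<and> x \<le> (\<lambda>z. y z + ennreal l * a z)}" for x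
    define q where "q x = (if x \<in> LX X then INF (y, l)\<in>K x. p y + ennreal l * s else 0)" for x
    have q_le: "q x \<le> p y + ennreal l * s"
      if "y \<in> LX X" "0 \<le> l" "x \<le> (\<lambda>z. y z + ennreal l * a z)" for x y l
      using that by (auto simp: q_def K_def intro!: INF_lower2[of "(y, l)"])
    have q_le_p: "q x \<le> p x" for x
      using q_le[of x 0 x] P(7) by (cases "x \<in> LX X") (auto simp: q_def)
    have "q \<in> sublinear_between X F S"
    proof (rule sublinear_betweenI)
      fix h k assume "h \<in> LX X" "k \<in> LX X" "h \<le> k"
      then show "q h \<le> q k"
        by (auto simp: q_def K_def intro!: INF_superset_mono)
    next
      fix c :: real and h assume h: "h \<in> LX X" and c: "0 < c"
      have qh: "q h = (INF (y, l)\<in>K h. p y + ennreal l * s)" using h by (simp add: q_def)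
      show "q (\<lambda>x. ennreal c * h x) \<le> ennreal c * q h"
        unfolding qh
      proof (rule le_mult_INF[OF c])
        fix yl assume "yl \<in> K h"
        then obtain y l where yl: "yl = (y, l)" "y \<in> LX X" "0 \<le> l" "h \<le> (\<lambda>z. y z + ennreal l * a z)"
          by (auto simp: K_def)
        have "ennreal c * h x \<le> ennreal c * y x + ennreal (c * l) * a x" for x
          using mult_left_mono[OF le_funD[OF yl(4)], of "ennreal c" x] c yl(3)
          by (simp add: distrib_left ennreal_mult mult.assoc)
        then have "q (\<lambda>x. ennreal c * h x) \<le> p (\<lambda>z. ennreal c * y z) + ennreal (c * l) * s"
          using c yl by (intro q_le LX_scale) (auto simp: le_fun_def)
        also have "\<dots> \<le> ennreal c * p y + ennreal (c * l) * s"
          using c yl by (intro add_right_mono P(2))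
        also have "\<dots> = ennreal c * (p y + ennreal l * s)"
          using c yl by (simp add: distrib_left ennreal_mult mult.assoc)
        finally show "q (\<lambda>x. ennreal c * h x) \<le> ennreal c * (case yl of (y, l) \<Rightarrow> p y + ennreal l * s)"
          by (simp add: yl)
      qed
    next
      fix h k assume h: "h \<in> LX X" and k: "k \<in> LX X"
      have qh: "q h = (INF (y, l)\<in>K h. p y + ennreal l * s)" "q k = (INF (y, l)\<in>K k. p y + ennreal l * s)"
        using h k by (simp_all add: q_def)
      show "q (\<lambda>x. h x + k x) \<le> q h + q k"
        unfolding qh
      proof (rule le_INF_add)
        fix yl zm assume "yl \<in> K h" "zm \<in> K k"
        then obtain y l y' m where yl: "yl = (y, l)" "y \<in> LX X" "0 \<le> l" "h \<le> (\<lambda>z. y z + ennreal l * a z)"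
          and zm: "zm = (y', m)" "y' \<in> LX X" "0 \<le> m" "k \<le> (\<lambda>z. y' z + ennreal m * a z)"
          by (auto simp: K_def)
        have "h x + k x \<le> (y x + y' x) + ennreal (l + m) * a x" for x
          using add_mono[OF le_funD[OF yl(4), of x] le_funD[OF zm(4), of x]] yl(3) zm(3)
          by (simp add: ennreal_plus distrib_left distrib_right ac_simps)
        then have "q (\<lambda>x. h x + k x) \<le> p (\<lambda>z. y z + y' z) + ennreal (l + m) * s"
          using yl zm by (intro q_le LX_add) (auto simp: le_fun_def)
        also have "\<dots> \<le> (p y + p y') + ennreal (l + m) * s"
          using yl zm by (intro add_right_mono P(3))
        also have "\<dots> = (p y + ennreal l * s) + (p y' + ennreal m * s)"
          using yl zm by (simp add: ennreal_plus distrib_left distrib_right ac_simps)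
        finally show "q (\<lambda>x. h x + k x)
            \<le> (case yl of (y, l) \<Rightarrow> p y + ennreal l * s) + (case zm of (y, l) \<Rightarrow> p y + ennreal l * s)"
          by (simp add: yl zm)
      qed
    next
      show "q (\<lambda>x. 0) \<le> 0" using q_le_p[of "\<lambda>x. 0"] P(4) by simp
    next
      fix x assume x: "x \<in> LX X"
      have "F x \<le> p y + ennreal l * s"
        if y: "y \<in> LX X" and l: "0 \<le> l" and le: "x \<le> (\<lambda>z. y z + ennreal l * a z)" for y l
      \<comment> \<open>Division by \<open>l\<close> reduces the claim to \<open>l = 1\<close>, the case used in the definition of \<open>s\<close>.\<close>
      proof (cases "l = 0 \<or> p y = top")
        case True
        then show ?thesis
        proof
          assume "l = 0"
          then have "F x \<le> F y" using scott_superlinear_mono[OF F x y] le by (simp add: le_fun_def)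
          also have "\<dots> \<le> p y" by (rule P(5)[OF y])
          finally show ?thesis using \<open>l = 0\<close> by simp
        qed simp
      next
        case False
        with l have l: "0 < l" and fin: "p y < top" by (auto simp: top.not_eq_extremum)
        let ?x = "\<lambda>z. ennreal (1 / l) * x z" and ?y = "\<lambda>z. ennreal (1 / l) * y z"
        have py: "p ?y \<le> ennreal (1 / l) * p y" using y l by (intro P(2)) auto
        also have "\<dots> < top" using fin by (simp add: ennreal_mult_less_top)
        finally have fin': "p ?y < top" .
        have xy: "?x z \<le> ?y z + a z" for z
          using mult_left_mono[OF le_funD[OF le], of "ennreal (1 / l)" z] ennreal_inverse_cancel(2)[OF l, of "a z"]
          by (simp add: distrib_left)
        show ?thesis
        proof (cases "p ?y \<le> F ?x")
          case True
          have "F ?x - p ?y \<in> T a"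
            unfolding T_def using x y xy fin' True
            by (intro CollectI bexI[of _ ?x] bexI[of _ ?y] conjI LX_scale)
              (auto simp: le_fun_def add.commute add_diff_inverse_ennreal)
          then have "F ?x - p ?y \<le> s" unfolding s_def by (rule Sup_upper)
          then have "F ?x \<le> p ?y + s" using fin' by (simp add: ennreal_minus_le_iff)
          also have "\<dots> \<le> ennreal (1 / l) * p y + s" using py by (rule add_right_mono)
          finally have "ennreal (1 / l) * F x \<le> ennreal (1 / l) * p y + s"
            using scott_superlinear_scale[OF F x, of "1 / l"] l by simp
          then have "ennreal l * (ennreal (1 / l) * F x) \<le> ennreal l * (ennreal (1 / l) * p y + s)"
            by (rule mult_left_mono) simp
          then show ?thesis by (simp add: distrib_left ennreal_inverse_cancel[OF l])
        next
          case False
          then have "F ?x \<le> ennreal (1 / l) * p y" using py by simp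
          then have "ennreal (1 / l) * F x \<le> ennreal (1 / l) * p y"
            using scott_superlinear_scale[OF F x, of "1 / l"] l by simp
          then have "ennreal l * (ennreal (1 / l) * F x) \<le> ennreal l * (ennreal (1 / l) * p y)"
            by (rule mult_left_mono) simp
          then have "F x \<le> p y" by (simp add: ennreal_inverse_cancel[OF l])
          then show ?thesis by (rule order.trans) simp
        qed
      qed
      then show "F x \<le> q x" using x by (auto simp: q_def K_def intro!: INF_greatest)
    next
      fix h r assume "(h, r) \<in> S"
      then show "q h \<le> r" using q_le_p[of h] P(6) by (meson order.trans)
    qed (simp add: q_def)
    then have "q = p" using min q_le_p by (auto simp: le_fun_def)
    then have "p a \<le> p (\<lambda>x. 0) + ennreal 1 * s"
      using q_le[OF LX_zero, of 1 a] by (simp add: le_fun_def)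
    then show ?thesis using P(4) by (simp add: s_def)
  qed
  have T_sum: "t + t' \<le> p (\<lambda>x. a x + b x)" if "t \<in> T a" "t' \<in> T b" for t t'
  proof -
    obtain x y where 1: "x \<in> LX X" "y \<in> LX X" "x \<le> (\<lambda>z. y z + a z)" "p y < top" "t + p y \<le> F x"
      using \<open>t \<in> T a\<close> unfolding T_def by blast
    obtain x' y' where 2: "x' \<in> LX X" "y' \<in> LX X" "x' \<le> (\<lambda>z. y' z + b z)" "p y' < top" "t' + p y' \<le> F x'"
      using \<open>t' \<in> T b\<close> unfolding T_def by blast
    let ?ab = "\<lambda>z. a z + b z"
    let ?yy = "\<lambda>z. y z + y' z"
    have ab: "?ab \<in> LX X" and yy: "?yy \<in> LX X" using a b 1 2 by (auto intro: LX_add)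
    have "(t + t') + (p y + p y') = (t + p y) + (t' + p y')" by (simp add: ac_simps)
    also have "\<dots> \<le> F x + F x'" using 1 2 by (intro add_mono)
    also have "\<dots> \<le> F (\<lambda>z. x z + x' z)" using 1 2 by (intro scott_superlinear_superadd[OF F])
    also have "\<dots> \<le> p (\<lambda>z. x z + x' z)" using 1 2 by (intro P(5) LX_add)
    also have "\<dots> \<le> p (\<lambda>z. ?ab z + ?yy z)"
    proof (rule P(1))
      have "x z + x' z \<le> ?ab z + ?yy z" for z
        using add_mono[OF le_funD[OF 1(3), of z] le_funD[OF 2(3), of z]] by (simp add: ac_simps)
      then show "(\<lambda>z. x z + x' z) \<le> (\<lambda>z. ?ab z + ?yy z)" by (simp add: le_fun_def)
    qed (use ab yy 1 2 in \<open>auto intro: LX_add\<close>)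
    also have "\<dots> \<le> p ?ab + p ?yy" by (rule P(3)[OF ab yy])
    also have "\<dots> \<le> p ?ab + (p y + p y')" using 1 2 by (intro add_left_mono P(3))
    finally show ?thesis
      using 1(4) 2(4) by (auto simp: ennreal_add_left_cancel_le add.commute[of _ "p y + p y'"])
  qed
  have "0 \<in> T a" for a
    unfolding T_def using LX_zero[of X] P(4) by (auto intro!: bexI[of _ "\<lambda>x. 0"] simp: le_fun_def)
  then have T_ne: "T a \<noteq> {}" for a by blast
  have "p a + p b \<le> Sup (T a) + Sup (T b)"
    using bound a b by (intro add_mono)
  also have "\<dots> = (SUP t\<in>T a. t + Sup (T b))"
    using ennreal_SUP_add_left[OF T_ne, of "\<lambda>t. t" "Sup (T b)" a] by simp
  also have "\<dots> = (SUP t\<in>T a. SUP t'\<in>T b. t + t')"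
    using ennreal_SUP_add_right[OF T_ne, of _ "\<lambda>t. t" b] by simp
  also have "\<dots> \<le> p (\<lambda>x. a x + b x)"
    by (intro SUP_least T_sum)
  finally show ?thesis .
qed

text \<open>Replacing \<open>p h\<close> by the infimum of \<open>sup p D\<close> over the directed families \<open>D\<close> that cover \<open>h\<close> keeps
  sublinearity, because sums of directed families are directed, and stays above \<open>F\<close>, because \<open>F\<close> is
  Scott-continuous. A minimal \<open>p\<close> is therefore its own Scott-continuous envelope.\<close>

lemma minimal_sublinear_scott:
  assumes F: "scott_superlinear X F"
    and p: "p \<in> sublinear_between X F S"
    and min: "\<And>q. q \<in> sublinear_between X F S \<Longrightarrow> q \<le> p \<Longrightarrow> q = p"
    and S: "\<And>h r. (h, r) \<in> S \<Longrightarrow> h \<in> LX X"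
  shows "scott_continuous_on (LX X) p"
proof -
  note P = sublinear_betweenD[OF p]
  define K where "K h = {D. D \<subseteq> LX X \<and> directed D \<and> h \<le> Sup D}" for h
  define q where "q h = (if h \<in> LX X then INF D\<in>K h. SUP d\<in>D. p d else 0)" for h
  have q_le: "q h \<le> (SUP d\<in>D. p d)" if "D \<subseteq> LX X" "directed D" "h \<le> Sup D" for h D
    using that by (auto simp: q_def K_def intro!: INF_lower2[of D])
  have q_le_p: "q x \<le> p x" for x
    using q_le[of "{x}" x] P(7) by (cases "x \<in> LX X") (auto simp: q_def directed_def)
  have "q \<in> sublinear_between X F S"
  proof (rule sublinear_betweenI)
    fix h k assume "h \<in> LX X" "k \<in> LX X" "h \<le> k"
    then show "q h \<le> q k"
      by (auto simp: q_def K_def intro!: INF_superset_mono)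
  next
    fix c :: real and h assume h: "h \<in> LX X" and c: "0 < c"
    have qh: "q h = (INF D\<in>K h. SUP d\<in>D. p d)" using h by (simp add: q_def)
    show "q (\<lambda>x. ennreal c * h x) \<le> ennreal c * q h"
      unfolding qh
    proof (rule le_mult_INF[OF c])
      fix D assume "D \<in> K h"
      then have D: "D \<subseteq> LX X" "directed D" "h \<le> Sup D" by (auto simp: K_def)
      let ?s = "\<lambda>d x. ennreal c * d x"
      have "q (?s h) \<le> (SUP d\<in>?s ` D. p d)"
      proof (rule q_le)
        show "?s ` D \<subseteq> LX X" using D by (auto intro: LX_scale)
        have "?s d \<le> ?s e" if "d \<le> e" for d e :: "'a \<Rightarrow> ennreal"
          using that by (auto simp: le_fun_def intro: mult_left_mono)
        then show "directed (?s ` D)"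
          using D(2) unfolding directed_def by (simp add: ball_simps) metis
        have "ennreal c * h x \<le> (SUP d\<in>D. ennreal c * d x)" for x
          using mult_left_mono[OF le_funD[OF D(3)], of "ennreal c" x] by (simp add: SUP_mult_left_ennreal image_comp)
        then show "?s h \<le> Sup (?s ` D)" by (simp add: le_fun_def image_comp)
      qed
      also have "\<dots> = (SUP d\<in>D. p (?s d))" by (simp add: image_comp)
      also have "\<dots> \<le> (SUP d\<in>D. ennreal c * p d)"
        using D c by (intro SUP_subset_mono order_refl P(2)) auto
      finally show "q (?s h) \<le> ennreal c * (SUP d\<in>D. p d)" by (simp add: SUP_mult_left_ennreal)
    qed
  next
    fix h k assume h: "h \<in> LX X" and k: "k \<in> LX X"
    have qh: "q h = (INF D\<in>K h. SUP d\<in>D. p d)" "q k = (INF D\<in>K k. SUP d\<in>D. p d)"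
      using h k by (simp_all add: q_def)
    show "q (\<lambda>x. h x + k x) \<le> q h + q k"
      unfolding qh
    proof (rule le_INF_add)
      fix D E assume "D \<in> K h" "E \<in> K k"
      then have D: "D \<subseteq> LX X" "directed D" "h \<le> Sup D" and E: "E \<subseteq> LX X" "directed E" "k \<le> Sup E"
        by (auto simp: K_def)
      have ne: "D \<noteq> {}" "E \<noteq> {}" using D(2) E(2) by (auto simp: directed_def)
      define G where "G = (\<lambda>(d, e) x. d x + e x) ` (D \<times> E)"
      have "q (\<lambda>x. h x + k x) \<le> (SUP g\<in>G. p g)"
      proof (rule q_le)
        show "G \<subseteq> LX X" using D(1) E(1) by (auto simp: G_def intro!: LX_add)
        show "directed G"
          unfolding directed_def
        proof (intro conjI ballI)
          show "G \<noteq> {}" using ne by (auto simp: G_def)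
          fix g g' assume "g \<in> G" "g' \<in> G"
          then obtain d e d' e' where g: "d \<in> D" "e \<in> E" "d' \<in> D" "e' \<in> E"
            "g = (\<lambda>x. d x + e x)" "g' = (\<lambda>x. d' x + e' x)" by (auto simp: G_def)
          obtain d'' e'' where "d'' \<in> D" "d \<le> d''" "d' \<le> d''" "e'' \<in> E" "e \<le> e''" "e' \<le> e''"
            using g D(2) E(2) unfolding directed_def by meson
          then show "\<exists>z\<in>G. g \<le> z \<and> g' \<le> z"
            by (intro bexI[of _ "\<lambda>x. d'' x + e'' x"])
              (auto simp: g(5,6) G_def le_fun_def intro!: add_mono)
        qed
        have "h x + k x \<le> Sup G x" for x
        proof -
          have "h x + k x \<le> (SUP d\<in>D. d x) + (SUP e\<in>E. e x)"
            using add_mono[OF le_funD[OF D(3), of x] le_funD[OF E(3), of x]] by (simp add: image_comp)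
          also have "\<dots> = (SUP d\<in>D. SUP e\<in>E. d x + e x)"
            using ne by (simp add: ennreal_SUP_add_left[symmetric] ennreal_SUP_add_right) (rule SUP_commute)
          also have "\<dots> \<le> Sup G x"
            unfolding Sup_apply by (intro SUP_least SUP_upper2[of "\<lambda>x. _ x + _ x"]) (auto simp: G_def)
          finally show ?thesis .
        qed
        then show "(\<lambda>x. h x + k x) \<le> Sup G" by (rule le_funI)
      qed
      also have "\<dots> \<le> (SUP d\<in>D. p d) + (SUP e\<in>E. p e)"
      proof (rule SUP_least)
        fix g assume "g \<in> G"
        then obtain d e where g: "d \<in> D" "e \<in> E" "g = (\<lambda>x. d x + e x)" by (auto simp: G_def)
        then have "p g \<le> p d + p e" using D(1) E(1) P(3) by auto
        also have "\<dots> \<le> (SUP d\<in>D. p d) + (SUP e\<in>E. p e)"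
          using g by (intro add_mono SUP_upper)
        finally show "p g \<le> (SUP d\<in>D. p d) + (SUP e\<in>E. p e)" .
      qed
      finally show "q (\<lambda>x. h x + k x) \<le> (SUP d\<in>D. p d) + (SUP e\<in>E. p e)" .
    qed
  next
    show "q (\<lambda>x. 0) \<le> 0" using q_le_p[of "\<lambda>x. 0"] P(4) by simp
  next
    fix h assume h: "h \<in> LX X"
    have "F h \<le> (SUP d\<in>D. p d)" if D: "D \<subseteq> LX X" "directed D" "h \<le> Sup D" for D
    proof -
      have "F h \<le> F (Sup D)" by (rule scott_superlinear_mono[OF F h LX_Sup[OF D(1)] D(3)])
      also have "\<dots> = (SUP d\<in>D. F d)"
        using F D unfolding scott_superlinear_def by (blast intro: scott_continuous_on_Sup)
      also have "\<dots> \<le> (SUP d\<in>D. p d)" using D by (intro SUP_subset_mono order_refl P(5)) auto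
      finally show ?thesis .
    qed
    then show "F h \<le> q h" using h by (auto simp: q_def K_def intro!: INF_greatest)
  next
    fix h r assume "(h, r) \<in> S"
    then show "q h \<le> r" using q_le_p[of h] P(6) by (meson order.trans)
  qed (simp add: q_def)
  then have "q = p" using min q_le_p by (auto simp: le_fun_def)
  show ?thesis
    unfolding scott_continuous_on_def
  proof (intro conjI ballI allI impI)
    fix D assume D: "D \<subseteq> LX X \<and> directed D"
    show "p (Sup D) = (SUP d\<in>D. p d)"
    proof (rule antisym)
      show "p (Sup D) \<le> (SUP d\<in>D. p d)" using q_le[of D "Sup D"] D \<open>q = p\<close> by simp
      show "(SUP d\<in>D. p d) \<le> p (Sup D)"
        using D by (intro SUP_least P(1) LX_Sup Sup_upper) auto
    qed
  qed (rule P(1))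
qed

text \<open>A minimal sublinear functional above \<open>F\<close> and below the constraints is linear and Scott-continuous, hence
  the integral against a valuation.\<close>

theorem sandwich:
  assumes F: "scott_superlinear X F"
    and S: "\<And>h r. (h, r) \<in> S \<Longrightarrow> h \<in> LX X"
    and FS: "\<And>k r. cone_hull S k r \<Longrightarrow> F k \<le> r"
  shows "\<exists>\<nu>\<in>valuations X. (\<forall>h\<in>LX X. F h \<le> val_integral X \<nu> h) \<and> (\<forall>(h, r)\<in>S. val_integral X \<nu> h \<le> r)"
proof -
  have "sublinear_between X F S \<noteq> {}"
    by (rule sublinear_between_nonempty[OF S F FS])
  then obtain p where p: "p \<in> sublinear_between X F S"
    and min: "\<And>q. q \<in> sublinear_between X F S \<Longrightarrow> q \<le> p \<Longrightarrow> q = p"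
    using sublinear_between_minimal[of X F S] by metis
  note P = sublinear_betweenD[OF p]
  have lin: "scott_linear X p"
    unfolding scott_linear_def
  proof (intro conjI ballI allI impI)
    show "scott_continuous_on (LX X) p" by (rule minimal_sublinear_scott[OF F p min S])
  next
    fix a :: real and h assume h: "h \<in> LX X" and "0 \<le> a"
    then consider "a = 0" | "0 < a" by linarith
    then show "p (\<lambda>x. ennreal a * h x) = ennreal a * p h"
    proof cases
      case 1
      then show ?thesis using P(4) by simp
    next
      case 2
      have "p h = p (\<lambda>x. ennreal (1 / a) * (ennreal a * h x))"
        using ennreal_inverse_cancel[OF 2] by simp
      also have "\<dots> \<le> ennreal (1 / a) * p (\<lambda>x. ennreal a * h x)"
        using h 2 by (intro P(2) LX_scale) auto
      finally have "ennreal a * p h \<le> ennreal a * (ennreal (1 / a) * p (\<lambda>x. ennreal a * h x))"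
        by (rule mult_left_mono) simp
      then have "ennreal a * p h \<le> p (\<lambda>x. ennreal a * h x)" using ennreal_inverse_cancel[OF 2] by simp
      then show ?thesis using P(2)[OF h 2] by (rule antisym[rotated])
    qed
  next
    fix h k assume "h \<in> LX X" "k \<in> LX X"
    then show "p (\<lambda>x. h x + k x) = p h + p k"
      by (intro antisym P(3) minimal_sublinear_superadditive[OF F p min S])
  qed
  show ?thesis
  proof (intro bexI conjI ballI)
    show "val_of X p \<in> valuations X" by (rule val_of_valuation[OF lin])
    show "F h \<le> val_integral X (val_of X p) h" if "h \<in> LX X" for h
      using that P(5) val_integral_val_of[OF lin] by simp
    fix hr assume "hr \<in> S"
    then show "case hr of (h, r) \<Rightarrow> val_integral X (val_of X p) h \<le> r"
      using P(6) S val_integral_val_of[OF lin] by (cases hr) auto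
  qed
qed

section \<open>Topologies given by a subbase\<close>

lemma generated_nbhd:
  assumes "openin (topology_generated_by \<S>) U" "x \<in> U"
  shows "\<exists>F. finite F \<and> F \<subseteq> \<S> \<and> x \<in> \<Inter>F \<and> \<Inter>F \<subseteq> U"
proof -
  have "(arbitrary union_of finite' intersection_of (\<lambda>s. s \<in> \<S>)) U"
    using openin_topology_generated_by[OF assms(1)] by (simp only: generate_topology_on_eq)
  then obtain \<U> where \<U>: "\<Union>\<U> = U" "\<And>u. u \<in> \<U> \<Longrightarrow> (finite' intersection_of (\<lambda>s. s \<in> \<S>)) u"
    by (auto simp: union_of_def)
  obtain u where u: "u \<in> \<U>" "x \<in> u" using assms(2) \<U>(1) by blast
  obtain F where "finite F" "F \<subseteq> \<S>" "\<Inter>F = u" using \<U>(2)[OF u(1)] by (auto simp: intersection_of_def)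
  then show ?thesis using u \<U>(1) by blast
qed

lemma openin_generated_Int_Inter:
  "openin (topology_generated_by \<S>) U \<Longrightarrow> finite F \<Longrightarrow> F \<subseteq> \<S> \<Longrightarrow> openin (topology_generated_by \<S>) (U \<inter> \<Inter>F)"
  by (rule openin_Int_Inter) (auto intro: topology_generated_by_Basis)

lemma spec_le_generated:
  "spec_le (topology_generated_by \<S>) x y \<longleftrightarrow> (\<forall>S\<in>\<S>. x \<in> S \<longrightarrow> y \<in> S)"
proof
  show "spec_le (topology_generated_by \<S>) x y \<Longrightarrow> \<forall>S\<in>\<S>. x \<in> S \<longrightarrow> y \<in> S"
    unfolding spec_le_def using topology_generated_by_Basis by blast
next
  assume S: "\<forall>S\<in>\<S>. x \<in> S \<longrightarrow> y \<in> S"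
  show "spec_le (topology_generated_by \<S>) x y"
    unfolding spec_le_def
  proof (intro allI impI)
    fix U assume "openin (topology_generated_by \<S>) U \<and> x \<in> U"
    then obtain F where "F \<subseteq> \<S>" "x \<in> \<Inter>F" "\<Inter>F \<subseteq> U" using generated_nbhd[of \<S> U x] by blast
    then show "y \<in> U" using S by blast
  qed
qed

lemma subtopology_generated:
  "subtopology (topology_generated_by \<S>) A = topology_generated_by ((\<lambda>S. S \<inter> A) ` \<S>)" (is "_ = ?Y")
  unfolding topology_eq
proof (intro allI iffI)
  fix T assume "openin (subtopology (topology_generated_by \<S>) A) T"
  then obtain U where U: "generate_topology_on \<S> U" "T = U \<inter> A"
    by (auto simp: openin_subtopology openin_topology_generated_by_iff)
  have "istopology (\<lambda>U. openin ?Y (U \<inter> A))"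
    unfolding istopology_def
  proof (intro conjI allI impI)
    fix S T assume "openin ?Y (S \<inter> A)" "openin ?Y (T \<inter> A)"
    then have "openin ?Y ((S \<inter> A) \<inter> (T \<inter> A))" by (rule openin_Int)
    then show "openin ?Y (S \<inter> T \<inter> A)" by (simp only: Int_ac Int_absorb Int_left_absorb)
  next
    fix K assume "\<forall>k\<in>K. openin ?Y (k \<inter> A)"
    then have "openin ?Y (\<Union>k\<in>K. k \<inter> A)" by blast
    then show "openin ?Y (\<Union>K \<inter> A)" by (simp only: Int_Union2)
  qed
  then have "openin ?Y (U \<inter> A)"
    by (rule generate_topology_on_coarsest[OF _ _ U(1)]) (blast intro: topology_generated_by_Basis)
  then show "openin ?Y T" by (simp only: U(2))
next
  fix T assume "openin ?Y T"
  then have T: "generate_topology_on ((\<lambda>S. S \<inter> A) ` \<S>) T" by (rule openin_topology_generated_by)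
  show "openin (subtopology (topology_generated_by \<S>) A) T"
    by (rule generate_topology_on_coarsest[OF istopology_openin _ T])
      (auto simp: openin_subtopology intro: topology_generated_by_Basis)
qed

text \<open>This is Alexander's subbase theorem for the subspace topology on \<open>K\<close>.\<close>

lemma compactin_generated:
  assumes K: "K \<subseteq> \<Union>\<S>"
    and fin: "\<And>\<C>. \<C> \<subseteq> \<S> \<Longrightarrow> K \<subseteq> \<Union>\<C> \<Longrightarrow> \<exists>\<C>'. finite \<C>' \<and> \<C>' \<subseteq> \<C> \<and> K \<subseteq> \<Union>\<C>'"
  shows "compactin (topology_generated_by \<S>) K"
proof -
  let ?I = "finite intersection_of (\<lambda>x. x \<in> \<S>) relative_to K"
  let ?Y = "subtopology (topology_generated_by \<S>) K"
  have "topology (arbitrary union_of ?I) = ?Y"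
    unfolding topology_eq
  proof (intro allI iffI)
    fix T assume "openin (topology (arbitrary union_of ?I)) T"
    then have "(arbitrary union_of ?I) T" by (simp only: openin_subbase)
    then obtain \<U> where U: "\<Union>\<U> = T" "\<And>u. u \<in> \<U> \<Longrightarrow> ?I u"
      by (auto simp: union_of_def)
    have "openin ?Y u" if u: "u \<in> \<U>" for u
    proof -
      obtain F where F: "finite F" "F \<subseteq> \<S>" "u = K \<inter> \<Inter>F"
        using U(2)[OF u] by (auto simp: relative_to_def intersection_of_def)
      have "openin (topology_generated_by \<S>) (\<Union>\<S> \<inter> \<Inter>F)"
        using F openin_topspace[of "topology_generated_by \<S>"] by (intro openin_generated_Int_Inter) simp_all
      moreover have "u = (\<Union>\<S> \<inter> \<Inter>F) \<inter> K" using F(3) K by blast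
      ultimately show ?thesis unfolding openin_subtopology by blast
    qed
    then show "openin ?Y T" using U(1) by blast
  next
    fix T assume "openin ?Y T"
    then obtain V where V: "openin (topology_generated_by \<S>) V" "T = V \<inter> K" by (auto simp: openin_subtopology)
    have "\<exists>u. ?I u \<and> x \<in> u \<and> u \<subseteq> T" if x: "x \<in> T" for x
    proof -
      obtain F where F: "finite F" "F \<subseteq> \<S>" "x \<in> \<Inter>F" "\<Inter>F \<subseteq> V"
        using generated_nbhd[OF V(1), of x] x V(2) by blast
      have "?I (K \<inter> \<Inter>F)"
        unfolding relative_to_def intersection_of_def using F(1,2) by blast
      then show ?thesis using F x V(2) by (intro exI[of _ "K \<inter> \<Inter>F"]) auto
    qed
    then have "(arbitrary union_of ?I) T"
      unfolding union_of_def arbitrary_def by (intro exI[of _ "{u. ?I u \<and> u \<subseteq> T}"]) blast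
    then show "openin (topology (arbitrary union_of ?I)) T" by (simp add: openin_subbase)
  qed
  then have "compact_space ?Y"
    using Alexander_subbase_alt[OF K fin] by blast
  then show ?thesis using K by (simp add: compactin_subspace)
qed

text \<open>A finite union of finite intersections of subbasic sets is a finite intersection of finite unions:
  the clauses are the finite unions that contain \<open>K\<close>.\<close>

lemma compactin_generated_clauses:
  assumes K: "compactin (topology_generated_by \<S>) K" and U: "openin (topology_generated_by \<S>) U" "K \<subseteq> U"
  shows "\<exists>\<G>. finite \<G> \<and> (\<forall>G\<in>\<G>. G \<subseteq> \<S> \<and> K \<subseteq> \<Union>G) \<and> (\<Inter>G\<in>\<G>. \<Union>G) \<subseteq> U"
proof -
  have "\<forall>x\<in>K. \<exists>F. finite F \<and> F \<subseteq> \<S> \<and> x \<in> \<Inter>F \<and> \<Inter>F \<subseteq> U"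
    using generated_nbhd[OF U(1) subsetD[OF U(2)]] by (intro ballI)
  then obtain F where F: "\<And>x. x \<in> K \<Longrightarrow> finite (F x) \<and> F x \<subseteq> \<S> \<and> x \<in> \<Inter>(F x) \<and> \<Inter>(F x) \<subseteq> U"
    by metis
  have op: "openin (topology_generated_by \<S>) (U \<inter> \<Inter>(F x))" if "x \<in> K" for x
    using F[OF that] by (intro openin_generated_Int_Inter U(1)) simp_all
  let ?C = "(\<lambda>x. U \<inter> \<Inter>(F x)) ` K"
  have "K \<subseteq> \<Union>?C" using F U(2) by fastforce
  moreover have "\<forall>V\<in>?C. openin (topology_generated_by \<S>) V" using op by simp
  ultimately obtain C where C: "finite C" "C \<subseteq> ?C" "K \<subseteq> \<Union>C"
    using K unfolding compactin_def by meson
  then obtain N where N: "finite N" "N \<subseteq> K" "C = (\<lambda>x. U \<inter> \<Inter>(F x)) ` N"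
    by (meson finite_subset_image)
  have KN: "K \<subseteq> (\<Union>x\<in>N. \<Inter>(F x))" using C(3) unfolding N(3) by auto
  define \<G> where "\<G> = {G \<in> Pow (\<Union>x\<in>N. F x). K \<subseteq> \<Union>G}"
  have "finite (\<Union>x\<in>N. F x)" using N F by auto
  then have "finite \<G>" unfolding \<G>_def by simp
  moreover have "\<forall>G\<in>\<G>. G \<subseteq> \<S> \<and> K \<subseteq> \<Union>G"
    unfolding \<G>_def using N(2) F by fastforce
  moreover have "(\<Inter>G\<in>\<G>. \<Union>G) \<subseteq> U"
  proof
    fix y assume y: "y \<in> (\<Inter>G\<in>\<G>. \<Union>G)"
    show "y \<in> U"
    proof (rule ccontr)
      assume "y \<notin> U"
      then have "\<forall>x\<in>N. \<exists>s\<in>F x. y \<notin> s" using F N(2) by (metis Inter_iff subsetD)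
      then obtain w where w: "\<And>x. x \<in> N \<Longrightarrow> w x \<in> F x \<and> y \<notin> w x" by metis
      have "w ` N \<subseteq> (\<Union>x\<in>N. F x)" using w by auto
      moreover have "K \<subseteq> \<Union>(w ` N)"
      proof
        fix z assume "z \<in> K"
        then obtain x where "x \<in> N" "z \<in> \<Inter>(F x)" using KN by auto
        then show "z \<in> \<Union>(w ` N)" using w[of x] by auto
      qed
      ultimately have "w ` N \<in> \<G>" unfolding \<G>_def by simp
      then have "y \<in> \<Union>(w ` N)" by (rule INT_D[OF y])
      then show False using w by auto
    qed
  qed
  ultimately show ?thesis by blast
qed

section \<open>Topologies of pointwise evaluation\<close>

text \<open>Valuations are tested on open sets, and previsions on lower semicontinuous functions.\<close>

definition eval_subbase :: "'a set \<Rightarrow> 'i set \<Rightarrow> ('i \<Rightarrow> 'a \<Rightarrow> ennreal) \<Rightarrow> 'a set set" where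
  "eval_subbase C I e = insert C {{x \<in> C. ennreal r < e i x} | i r. i \<in> I \<and> 0 \<le> (r::real)}"

lemma eval_subbase_open:
  assumes "i \<in> I"
  shows "openin (topology_generated_by (eval_subbase C I e)) {x \<in> C. t < e i x}"
proof (cases t)
  case (real r)
  then have "{x \<in> C. t < e i x} \<in> eval_subbase C I e" using assms unfolding eval_subbase_def by blast
  then show ?thesis by (rule topology_generated_by_Basis)
qed simp

lemma continuous_map_into_eval:
  assumes f: "\<And>z. z \<in> topspace Z \<Longrightarrow> f z \<in> C"
    and o: "\<And>i t. i \<in> I \<Longrightarrow> openin Z {z \<in> topspace Z. t < e i (f z)}"
  shows "continuous_map Z (topology_generated_by (eval_subbase C I e)) f"
proof (rule continuous_on_generated_topo)
  fix S assume "S \<in> eval_subbase C I e"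
  then consider "S = C" | i r where "i \<in> I" "S = {x \<in> C. ennreal r < e i x}"
    unfolding eval_subbase_def by blast
  then show "openin Z (f -` S \<inter> topspace Z)"
  proof cases
    case 1
    then have "f -` S \<inter> topspace Z = topspace Z" using f by auto
    then show ?thesis by simp
  next
    case 2
    then have "f -` S \<inter> topspace Z = {z \<in> topspace Z. ennreal r < e i (f z)}" using f by auto
    then show ?thesis using o[OF 2(1)] by simp
  qed
qed (use f in \<open>auto simp: eval_subbase_def\<close>)

section \<open>The spaces of valuations, of compact saturated sets and of previsions\<close>

lemma topspace_V_valuations: "\<nu> \<in> topspace (V_space b X) \<Longrightarrow> \<nu> \<in> valuations X"
  by (simp add: topspace_V_space)

lemma topspace_V_mass: "\<nu> \<in> topspace (V_space b X) \<Longrightarrow> mass_ok b (\<nu> (topspace X))"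
  by (simp add: topspace_V_space)

abbreviation V_subbase :: "mass \<Rightarrow> 'a topology \<Rightarrow> ('a set \<Rightarrow> ennreal) set set" where
  "V_subbase b X \<equiv> eval_subbase (topspace (V_space b X)) {U. openin X U} (\<lambda>U \<nu>. \<nu> U)"

lemma V_space_generated: "V_space b X = topology_generated_by (V_subbase b X)"
proof -
  let ?m = "{\<nu>. mass_ok b (\<nu> (topspace X))}"
  let ?f = "\<lambda>U (r::real). {\<nu> \<in> valuations X. ennreal r < \<nu> U}"
  have eq: "valuations X \<inter> ?m = topspace (V_space b X)"
    "?f U r \<inter> ?m = {\<nu> \<in> topspace (V_space b X). ennreal r < \<nu> U}" for U r
    unfolding topspace_V_space by blast+
  have "(\<lambda>S. S \<inter> ?m) ` {?f U r | U r. openin X U \<and> 0 \<le> r} = {?f U r \<inter> ?m | U r. openin X U \<and> 0 \<le> r}"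
    by blast
  then have "(\<lambda>S. S \<inter> ?m) ` insert (valuations X) {?f U r | U r. openin X U \<and> 0 \<le> r} = V_subbase b X"
    unfolding eval_subbase_def image_insert eq mem_Collect_eq by (rule arg_cong)
  then show ?thesis
    unfolding V_space_def V_all_def subtopology_generated by (simp only:)
qed

lemma openin_V_eval:
  assumes U: "openin X U"
  shows "openin (V_space b X) {\<nu> \<in> topspace (V_space b X). t < \<nu> U}"
  using eval_subbase_open[of U "{U. openin X U}" "topspace (V_space b X)" "\<lambda>U \<nu>. \<nu> U" t] U
  by (simp only: V_space_generated[symmetric] mem_Collect_eq)

lemma continuous_map_into_V:
  assumes "\<And>z. z \<in> topspace Z \<Longrightarrow> f z \<in> topspace (V_space b X)"
    and "\<And>U t. openin X U \<Longrightarrow> openin Z {z \<in> topspace Z. t < f z U}"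
  shows "continuous_map Z (V_space b X) f"
proof -
  have "continuous_map Z (topology_generated_by (V_subbase b X)) f"
    using assms by (intro continuous_map_into_eval) auto
  then show ?thesis by (simp only: V_space_generated[symmetric])
qed

lemma spec_le_V:
  assumes "\<nu> \<in> topspace (V_space b X)" "\<nu>' \<in> topspace (V_space b X)"
  shows "spec_le (V_space b X) \<nu> \<nu>' \<longleftrightarrow> (\<forall>U. openin X U \<longrightarrow> \<nu> U \<le> \<nu>' U)"
proof
  assume s: "spec_le (V_space b X) \<nu> \<nu>'"
  show "\<forall>U. openin X U \<longrightarrow> \<nu> U \<le> \<nu>' U"
  proof (intro allI impI)
    fix U assume U: "openin X U"
    show "\<nu> U \<le> \<nu>' U"
    proof (rule ccontr)
      assume "\<not> \<nu> U \<le> \<nu>' U"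
      then have "\<nu> \<in> {\<nu> \<in> topspace (V_space b X). \<nu>' U < \<nu> U}" using assms by simp
      then have "\<nu>' \<in> {\<nu> \<in> topspace (V_space b X). \<nu>' U < \<nu> U}"
        using s openin_V_eval[OF U, of b "\<nu>' U"] unfolding spec_le_def by blast
      then show False by simp
    qed
  qed
next
  assume le: "\<forall>U. openin X U \<longrightarrow> \<nu> U \<le> \<nu>' U"
  have "spec_le (topology_generated_by (V_subbase b X)) \<nu> \<nu>'"
    unfolding spec_le_generated
    using le assms by (auto simp: eval_subbase_def intro: order_less_le_trans)
  then show "spec_le (V_space b X) \<nu> \<nu>'" by (simp only: V_space_generated[symmetric])
qed

definition ev :: "mass \<Rightarrow> 'a topology \<Rightarrow> ('a \<Rightarrow> ennreal) \<Rightarrow> ('a set \<Rightarrow> ennreal) \<Rightarrow> ennreal" where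
  "ev b X h = zero_ext (topspace (V_space b X)) (\<lambda>\<nu>. val_integral X \<nu> h)"

lemma ev_eq: "\<nu> \<in> topspace (V_space b X) \<Longrightarrow> ev b X h \<nu> = val_integral X \<nu> h"
  by (simp add: ev_def zero_ext_def)

lemma LX_V_eval:
  "openin X U \<Longrightarrow> zero_ext (topspace (V_space b X)) (\<lambda>\<nu>. \<nu> U) \<in> LX (V_space b X)"
  by (intro zero_ext_LX openin_V_eval)

lemma LX_ev:
  assumes h: "h \<in> LX X"
  shows "ev b X h \<in> LX (V_space b X)"
proof -
  have "ev b X h = (\<lambda>\<nu>. SUP n. \<Sum>i = 1..n * 2 ^ n :: nat. ennreal (1 / 2 ^ n) *
     zero_ext (topspace (V_space b X)) (\<lambda>\<nu>. \<nu> {x. ennreal (real i / 2 ^ n) < h x}) \<nu>)"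
  proof
    fix \<nu>
    show "ev b X h \<nu> = (SUP n. \<Sum>i = 1..n * 2 ^ n :: nat. ennreal (1 / 2 ^ n) *
     zero_ext (topspace (V_space b X)) (\<lambda>\<nu>. \<nu> {x. ennreal (real i / 2 ^ n) < h x}) \<nu>)"
      using val_integral_dyadic_1[OF topspace_V_valuations h]
      by (cases "\<nu> \<in> topspace (V_space b X)") (auto simp: ev_def zero_ext_def)
  qed
  moreover have "\<dots> \<in> LX (V_space b X)"
    by (intro LX_SUP LX_sum LX_scale LX_V_eval LX_open h) auto
  ultimately show ?thesis by simp
qed

lemma Q_setD:
  assumes "Q \<in> Q_set X"
  shows "Q \<noteq> {}" "compactin X Q" "Q \<subseteq> topspace X"
    and "\<And>x y. x \<in> Q \<Longrightarrow> y \<in> topspace X \<Longrightarrow> spec_le X x y \<Longrightarrow> y \<in> Q"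
  using assms compactin_subset_topspace[of X Q] by (auto simp: Q_set_def)

lemma openin_box: "openin X U \<Longrightarrow> openin (Q_space X) (box X U)"
  unfolding Q_space_def by (rule topology_generated_by_Basis) blast

lemma continuous_map_into_Q:
  assumes "\<And>z. z \<in> topspace Z \<Longrightarrow> f z \<in> Q_set X"
    and "\<And>U. openin X U \<Longrightarrow> openin Z {z \<in> topspace Z. f z \<subseteq> U}"
  shows "continuous_map Z (Q_space X) f"
  unfolding Q_space_def
proof (rule continuous_on_generated_topo)
  fix S assume "S \<in> {box X U |U. openin X U}"
  then obtain U where "openin X U" "S = box X U" by blast
  moreover from this have "f -` S \<inter> topspace Z = {z \<in> topspace Z. f z \<subseteq> U}"
    using assms(1) by (auto simp: box_def)
  ultimately show "openin Z (f -` S \<inter> topspace Z)" using assms(2) by simp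
next
  show "f ` topspace Z \<subseteq> \<Union>{box X U |U. openin X U}"
    using assms(1) topspace_Q_space[of X] by (auto simp: Q_space_def)
qed

text \<open>A saturated set is the intersection of its open neighbourhoods, so the specialization preordering
  of the upper Vietoris topology is reverse inclusion.\<close>

lemma spec_le_Q:
  assumes "A \<in> Q_set X" "B \<in> Q_set X"
  shows "spec_le (Q_space X) A B \<longleftrightarrow> B \<subseteq> A"
proof
  assume s: "spec_le (Q_space X) A B"
  show "B \<subseteq> A"
  proof (rule ccontr)
    assume "\<not> B \<subseteq> A"
    then obtain y where y: "y \<in> B" "y \<notin> A" by blast
    have "\<forall>a\<in>A. \<exists>U. openin X U \<and> a \<in> U \<and> y \<notin> U"
      using Q_setD(4)[OF assms(1)] Q_setD(3)[OF assms(2)] y unfolding spec_le_def by blast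
    then obtain U where U: "\<And>a. a \<in> A \<Longrightarrow> openin X (U a) \<and> a \<in> U a \<and> y \<notin> U a" by metis
    have "openin (Q_space X) (box X (\<Union>a\<in>A. U a))" using U by (intro openin_box) blast
    moreover have "A \<in> box X (\<Union>a\<in>A. U a)" using U assms(1) by (auto simp: box_def)
    ultimately have "B \<in> box X (\<Union>a\<in>A. U a)" using s unfolding spec_le_def by blast
    then show False using y U by (auto simp: box_def)
  qed
next
  assume "B \<subseteq> A"
  then show "spec_le (Q_space X) A B"
    unfolding Q_space_def spec_le_generated using assms by (auto simp: box_def)
qed

lemma DP_space_generated:
  "DP_space b X = topology_generated_by (eval_subbase (DP_set b X) (LX X) (\<lambda>h F. F h))"
  by (simp add: DP_space_def eval_subbase_def)

lemma openin_DP_eval: "h \<in> LX X \<Longrightarrow> openin (DP_space b X) {F \<in> DP_set b X. t < F h}"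
  unfolding DP_space_generated by (rule eval_subbase_open)

lemma continuous_map_into_DP:
  assumes "\<And>z. z \<in> topspace Z \<Longrightarrow> f z \<in> DP_set b X"
    and "\<And>h t. h \<in> LX X \<Longrightarrow> openin Z {z \<in> topspace Z. t < f z h}"
  shows "continuous_map Z (DP_space b X) f"
  unfolding DP_space_generated using assms by (intro continuous_map_into_eval) auto

lemma DP_set_scott_superlinear: "F \<in> DP_set b X \<Longrightarrow> scott_superlinear X F"
  by (simp add: DP_set_def prevision_def superlinear_def scott_superlinear_def)

lemma DP_set_outside: "F \<in> DP_set b X \<Longrightarrow> h \<notin> LX X \<Longrightarrow> F h = 0"
  by (simp add: DP_set_def prevision_def)

lemma DP_setI:
  assumes "scott_superlinear X F" "\<And>h. h \<notin> LX X \<Longrightarrow> F h = 0" "prev_mass_ok b X F"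
  shows "F \<in> DP_set b X"
  using assms by (simp add: DP_set_def prevision_def superlinear_def scott_superlinear_def)

lemma DP_set_mass: "F \<in> DP_set b X \<Longrightarrow> prev_mass_ok b X F"
  by (simp add: DP_set_def)

lemma DP_eqI:
  assumes "F \<in> DP_set b X" "G \<in> DP_set b X" "\<And>h. h \<in> LX X \<Longrightarrow> F h = G h"
  shows "F = G"
proof
  fix h show "F h = G h"
    using assms(3) DP_set_outside[OF assms(1)] DP_set_outside[OF assms(2)] by (cases "h \<in> LX X") simp_all
qed

text \<open>Homogeneity turns subnormalization, which concerns the constant \<open>1\<close>, into a statement about all constants.\<close>

lemma DP_set_add_const:
  assumes F: "F \<in> DP_set b X" and b: "b \<noteq> Any_Mass" and h: "h \<in> LX X" and c: "0 \<le> c"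
  shows "F (\<lambda>x. h x + ennreal c * one_on X x) \<le> F h + ennreal c"
proof (cases "c = 0")
  case False
  with c have c: "0 < c" by simp
  let ?k = "\<lambda>x. ennreal (1 / c) * h x"
  have k: "?k \<in> LX X" by (rule LX_scale[OF h])
  have k1: "(\<lambda>x. one_on X x + ?k x) \<in> LX X" by (intro LX_add LX_one_on k)
  have 1: "F (\<lambda>x. one_on X x + ?k x) \<le> 1 + F ?k"
    using DP_set_mass[OF F] b k by (cases b) auto
  have "(\<lambda>x. h x + ennreal c * one_on X x) = (\<lambda>x. ennreal c * (one_on X x + ?k x))"
    by (simp add: distrib_left ennreal_inverse_cancel[OF c] add.commute)
  then have "F (\<lambda>x. h x + ennreal c * one_on X x) = ennreal c * F (\<lambda>x. one_on X x + ?k x)"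
    using scott_superlinear_scale[OF DP_set_scott_superlinear[OF F] k1, of c] c by simp
  also have "\<dots> \<le> ennreal c * (1 + F ?k)" using 1 by (rule mult_left_mono) simp
  also have "\<dots> = F h + ennreal c"
    using scott_superlinear_scale[OF DP_set_scott_superlinear[OF F] h, of "1 / c"] c
    by (simp add: distrib_left ennreal_inverse_cancel add.commute)
  finally show ?thesis .
qed simp

lemma DP_set_one:
  assumes F: "F \<in> DP_set b X"
  shows "mass_ok b (F (one_on X))"
proof -
  have "prev_mass_ok b X F" "F (\<lambda>x. 0) = 0"
    using DP_set_mass[OF F] scott_superlinear_zero[OF DP_set_scott_superlinear[OF F]] by auto
  then show ?thesis using LX_zero[of X] by (cases b) force+
qed

section \<open>The set of valuations above a superlinear prevision\<close>

definition core :: "mass \<Rightarrow> 'a topology \<Rightarrow> (('a \<Rightarrow> ennreal) \<Rightarrow> ennreal) \<Rightarrow> ('a set \<Rightarrow> ennreal) set" where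
  "core b X F = {\<nu> \<in> topspace (V_space b X). \<forall>h\<in>LX X. F h \<le> val_integral X \<nu> h}"

lemma coreD:
  assumes "\<nu> \<in> core b X F"
  shows "\<nu> \<in> topspace (V_space b X)" "\<nu> \<in> valuations X" "\<And>h. h \<in> LX X \<Longrightarrow> F h \<le> val_integral X \<nu> h"
  using assms by (auto simp: core_def topspace_V_space)

text \<open>The mass bound is one more constraint \<open>(1, 1)\<close>. Subnormalization is exactly what keeps \<open>F\<close> below the
  cone generated by the enlarged set of constraints; and \<open>F 1 = 1\<close> for a normalized \<open>F\<close> gives the
  converse inequality for the mass.\<close>

theorem core_extend:
  assumes F: "F \<in> DP_set b X"
    and S: "\<And>h r. (h, r) \<in> S \<Longrightarrow> h \<in> LX X"
    and FS: "\<And>k r. cone_hull S k r \<Longrightarrow> F k \<le> r"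
  shows "\<exists>\<nu>\<in>core b X F. \<forall>(h, r)\<in>S. val_integral X \<nu> h \<le> r"
proof -
  define S' where "S' = (if b = Any_Mass then S else insert (one_on X, 1) S)"
  have S': "h \<in> LX X" if "(h, r) \<in> S'" for h r
    using that S LX_one_on by (auto simp: S'_def split: if_splits)
  have dec: "\<exists>k s c. cone_hull S k s \<and> 0 \<le> c \<and> (b = Any_Mass \<longrightarrow> c = 0) \<and>
      g = (\<lambda>x. k x + ennreal c * one_on X x) \<and> r = s + ennreal c" if "cone_hull S' g r" for g r
    using that
  proof induction
    case (base h r)
    show ?case
    proof (cases "(h, r) \<in> S")
      case True
      then show ?thesis by (intro exI[of _ h] exI[of _ r] exI[of _ 0]) (auto intro: cone_hull.base)
    next
      case False
      then have "b \<noteq> Any_Mass" "h = one_on X" "r = 1" using base by (auto simp: S'_def split: if_splits)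
      then show ?thesis
        by (intro exI[of _ "\<lambda>x. 0"] exI[of _ 0] exI[of _ 1]) (auto intro: cone_hull.zero)
    qed
  next
    case zero
    show ?case by (intro exI[of _ "\<lambda>x. 0"] exI[of _ 0] exI[of _ 0]) (auto intro: cone_hull.zero)
  next
    case (add h r k s)
    from add.IH(1) obtain h' r' c where
      1: "cone_hull S h' r'" "0 \<le> c" "b = Any_Mass \<longrightarrow> c = 0" "h = (\<lambda>x. h' x + ennreal c * one_on X x)" "r = r' + ennreal c"
      by (elim exE conjE)
    from add.IH(2) obtain k' s' d where
      2: "cone_hull S k' s'" "0 \<le> d" "b = Any_Mass \<longrightarrow> d = 0" "k = (\<lambda>x. k' x + ennreal d * one_on X x)" "s = s' + ennreal d"
      by (elim exE conjE)
    have "cone_hull S (\<lambda>x. h' x + k' x) (r' + s')" by (rule cone_hull.add[OF 1(1) 2(1)])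
    moreover have "h x + k x = (h' x + k' x) + ennreal (c + d) * one_on X x" for x
      unfolding 1(4) 2(4) ennreal_plus[OF 1(2) 2(2)] distrib_right by (simp only: ac_simps)
    moreover have "r + s = (r' + s') + ennreal (c + d)"
      unfolding 1(5) 2(5) ennreal_plus[OF 1(2) 2(2)] by (simp only: ac_simps)
    ultimately show ?case
      using 1(2,3) 2(2,3) by (intro exI[of _ "\<lambda>x. h' x + k' x"] exI[of _ "r' + s'"] exI[of _ "c + d"]) simp
  next
    case (scale h r a)
    from scale.IH obtain h' r' c where
      1: "cone_hull S h' r'" "0 \<le> c" "b = Any_Mass \<longrightarrow> c = 0" "h = (\<lambda>x. h' x + ennreal c * one_on X x)" "r = r' + ennreal c"
      by (elim exE conjE)
    have "cone_hull S (\<lambda>x. ennreal a * h' x) (ennreal a * r')"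
      by (rule cone_hull.scale[OF 1(1) scale.hyps(2)])
    moreover have "ennreal a * h x = ennreal a * h' x + ennreal (a * c) * one_on X x" for x
      unfolding 1(4) using 1(2) scale.hyps(2) by (simp add: ennreal_mult distrib_left mult.assoc)
    moreover have "ennreal a * r = ennreal a * r' + ennreal (a * c)"
      unfolding 1(5) using 1(2) scale.hyps(2) by (simp add: ennreal_mult distrib_left)
    ultimately show ?case
      using 1(2,3) scale.hyps(2)
      by (intro exI[of _ "\<lambda>x. ennreal a * h' x"] exI[of _ "ennreal a * r'"] exI[of _ "a * c"]) simp
  qed
  have FS': "F g \<le> r" if gr: "cone_hull S' g r" for g r
  proof -
    from dec[OF gr] obtain k s c where 1: "cone_hull S k s" "0 \<le> c" "b = Any_Mass \<longrightarrow> c = 0"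
      "g = (\<lambda>x. k x + ennreal c * one_on X x)" "r = s + ennreal c" by (elim exE conjE)
    have "F g \<le> F k + ennreal c"
    proof (cases "b = Any_Mass")
      case False
      then show ?thesis unfolding 1(4)
        by (intro DP_set_add_const[OF F False cone_hull_LX[OF 1(1) S] 1(2)])
    qed (use 1 in simp)
    also have "\<dots> \<le> r" unfolding 1(5) by (intro add_right_mono FS 1(1))
    finally show ?thesis .
  qed
  have "\<exists>\<nu>\<in>valuations X. (\<forall>h\<in>LX X. F h \<le> val_integral X \<nu> h) \<and> (\<forall>(h, r)\<in>S'. val_integral X \<nu> h \<le> r)"
    by (rule sandwich[OF DP_set_scott_superlinear[OF F] S' FS'])
  then obtain \<nu> where \<nu>: "\<nu> \<in> valuations X" "\<forall>h\<in>LX X. F h \<le> val_integral X \<nu> h"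
    and le: "\<forall>(h, r)\<in>S'. val_integral X \<nu> h \<le> r"
    by (elim bexE conjE)
  have one: "val_integral X \<nu> (one_on X) = \<nu> (topspace X)"
    unfolding one_on_eq_indicator by (intro val_integral_indicator \<nu>(1)) simp
  have le1: "\<nu> (topspace X) \<le> 1" if "b \<noteq> Any_Mass"
    using le that one by (simp add: S'_def)
  have "mass_ok b (\<nu> (topspace X))"
  proof (cases b)
    case Mass_1
    then have "F (one_on X) = 1" using DP_set_one[OF F] by simp
    then have "1 \<le> \<nu> (topspace X)" using bspec[OF \<nu>(2) LX_one_on] one by simp
    then show ?thesis using Mass_1 le1 by simp
  qed (use le1 in auto)
  then have "\<nu> \<in> core b X F" using \<nu> by (simp add: core_def topspace_V_space)
  moreover have "\<forall>(h, r)\<in>S. val_integral X \<nu> h \<le> r" using le by (auto simp: S'_def split: if_splits)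
  ultimately show ?thesis by blast
qed

text \<open>By homogeneity \<open>F\<close> lies below the cone generated by the single constraint \<open>(h, F h)\<close>.\<close>

lemma core_attains:
  assumes F: "F \<in> DP_set b X" and h: "h \<in> LX X"
  shows "\<exists>\<nu>\<in>core b X F. val_integral X \<nu> h = F h"
proof -
  note sl = DP_set_scott_superlinear[OF F]
  have "\<exists>a\<ge>0. k = (\<lambda>x. ennreal a * h x) \<and> r = ennreal a * F h" if "cone_hull {(h, F h)} k r" for k r
    using that
  proof induction
    case (base k r)
    then show ?case by (intro exI[of _ 1]) auto
  next
    case zero
    show ?case by (intro exI[of _ 0]) auto
  next
    case (add k r l s)
    then obtain a c where "a \<ge> 0" "k = (\<lambda>x. ennreal a * h x)" "r = ennreal a * F h"
      "c \<ge> 0" "l = (\<lambda>x. ennreal c * h x)" "s = ennreal c * F h" by blast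
    then show ?case by (intro exI[of _ "a + c"]) (auto simp: ennreal_plus distrib_right)
  next
    case (scale k r c)
    then obtain a where "a \<ge> 0" "k = (\<lambda>x. ennreal a * h x)" "r = ennreal a * F h" by blast
    then show ?case using scale by (intro exI[of _ "c * a"]) (auto simp: ennreal_mult mult.assoc)
  qed
  then have "F k \<le> r" if "cone_hull {(h, F h)} k r" for k r
    using scott_superlinear_scale[OF sl h] that by fastforce
  then obtain \<nu> where "\<nu> \<in> core b X F" "val_integral X \<nu> h \<le> F h"
    using core_extend[OF F, of "{(h, F h)}"] h by auto
  then show ?thesis using coreD(3)[of \<nu> b X F h] h by (auto intro: antisym)
qed

lemma INF_core:
  assumes F: "F \<in> DP_set b X" and h: "h \<in> LX X"
  shows "(INF \<nu>\<in>core b X F. val_integral X \<nu> h) = F h"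
proof (rule antisym)
  obtain \<nu> where "\<nu> \<in> core b X F" "val_integral X \<nu> h = F h" using core_attains[OF F h] by blast
  then show "(INF \<nu>\<in>core b X F. val_integral X \<nu> h) \<le> F h" by (metis INF_lower)
  show "F h \<le> (INF \<nu>\<in>core b X F. val_integral X \<nu> h)" using h by (intro INF_greatest coreD(3))
qed

text \<open>If the valuations above \<open>F\<close> are covered by sets \<open>[U > r]\<close>, then no valuation above \<open>F\<close> satisfies all
  the constraints \<open>(1\<^sub>U, r)\<close>, so by the sandwich theorem some cone combination \<open>(k, s)\<close> of finitely many
  of them has \<open>s < F k\<close>. This is an open condition on \<open>F\<close>, and it implies that the finitely many sets used
  still cover.\<close>

lemma core_cover_open:
  assumes F: "F \<in> DP_set b X" and G: "G \<subseteq> V_subbase b X" and cov: "core b X F \<subseteq> \<Union>G"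
  shows "\<exists>G0 N. finite G0 \<and> G0 \<subseteq> G \<and> openin (DP_space b X) N \<and> F \<in> N \<and> (\<forall>F'\<in>N. core b X F' \<subseteq> \<Union>G0)"
proof (cases "topspace (V_space b X) \<in> G")
  case True
  then show ?thesis
    using F openin_topspace[of "DP_space b X"] unfolding topspace_DP_space
    by (intro exI[of _ "{topspace (V_space b X)}"] exI[of _ "DP_set b X"]) (auto dest: coreD(1))
next
  case False
  let ?sub = "\<lambda>U r. {\<nu> \<in> topspace (V_space b X). ennreal r < \<nu> U}"
  define P where "P = {(U, r). openin X U \<and> 0 \<le> r \<and> ?sub U r \<in> G}"
  define S where "S = (\<lambda>(U, r). (indicator U :: 'a \<Rightarrow> ennreal, ennreal r)) ` P"
  have S: "h \<in> LX X" if "(h, r) \<in> S" for h r using that by (auto simp: S_def P_def LX_indicator)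
  have G_form: "\<exists>U r. openin X U \<and> 0 \<le> r \<and> s = ?sub U r" if "s \<in> G" for s
    using that G False unfolding eval_subbase_def by blast
  have "\<not> (\<forall>k r. cone_hull S k r \<longrightarrow> F k \<le> r)"
  proof
    assume hull: "\<forall>k r. cone_hull S k r \<longrightarrow> F k \<le> r"
    have "\<exists>\<nu>\<in>core b X F. \<forall>(h, r)\<in>S. val_integral X \<nu> h \<le> r"
      by (rule core_extend[OF F S hull[rule_format]])
    then obtain \<nu> where \<nu>: "\<nu> \<in> core b X F" and "\<forall>(h, r)\<in>S. val_integral X \<nu> h \<le> r"
      by (elim bexE)
    then have le: "val_integral X \<nu> h \<le> r" if "(h, r) \<in> S" for h r using that by auto
    obtain s where s: "s \<in> G" "\<nu> \<in> s" using \<nu> cov by blast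
    obtain U r where U: "openin X U" "0 \<le> r" "s = ?sub U r" using G_form[OF s(1)] by blast
    then have "val_integral X \<nu> (indicator U) \<le> ennreal r" using s by (intro le) (auto simp: S_def P_def)
    then show False using s U val_integral_indicator[OF coreD(2)[OF \<nu>] U(1)] by auto
  qed
  then obtain k s where ks: "cone_hull S k s" "s < F k" by (auto simp: not_le)
  from cone_hull_finite[OF ks(1)] obtain S0 where S0: "finite S0" "S0 \<subseteq> S" "cone_hull S0 k s"
    by (elim exE conjE)
  have kX: "k \<in> LX X" by (rule cone_hull_LX[OF ks(1) S])
  obtain P0 where P0: "P0 \<subseteq> P" "finite P0" "S0 = (\<lambda>(U, r). (indicator U, ennreal r)) ` P0"
    using finite_subset_image[OF S0(1) S0(2)[unfolded S_def]] by (elim exE conjE)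
  define G0 where "G0 = (\<lambda>(U, r). ?sub U r) ` P0"
  have cover: "core b X F' \<subseteq> \<Union>G0" if F': "s < F' k" for F'
  proof (rule subsetI, rule ccontr)
    fix \<nu> assume \<nu>: "\<nu> \<in> core b X F'" and n: "\<nu> \<notin> \<Union>G0"
    have le: "val_integral X \<nu> h \<le> t" if ht: "(h, t) \<in> S0" for h t
    proof -
      obtain U r where U: "(U, r) \<in> P0" "h = indicator U" "t = ennreal r" using ht unfolding P0(3) by auto
      then have "openin X U" using P0(1) by (auto simp: P_def)
      moreover have "\<not> ennreal r < \<nu> U" using n U(1) coreD(1)[OF \<nu>] by (auto simp: G0_def)
      ultimately show ?thesis
        unfolding U(2,3) by (simp add: val_integral_indicator[OF coreD(2)[OF \<nu>]])
    qed
    have "val_integral X \<nu> k \<le> s"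
      by (rule cone_hull_le_val_integral[OF S0(3) coreD(2)[OF \<nu>] S[OF subsetD[OF S0(2)]] le])
    then show False using coreD(3)[OF \<nu> kX] F' by simp
  qed
  have "finite G0" "G0 \<subseteq> G" using P0(1,2) by (auto simp: G0_def P_def)
  moreover have "F \<in> {F \<in> DP_set b X. s < F k}" using F ks(2) by simp
  ultimately show ?thesis
    using openin_DP_eval[OF kX, of b s] cover
    by (intro exI[of _ G0] exI[of _ "{F \<in> DP_set b X. s < F k}"] conjI ballI) simp_all
qed

text \<open>Compactness needs finite subcovers of subbasic covers only, and for these \<open>core_cover_open\<close> already yields them.\<close>

lemma core_Q_set:
  assumes F: "F \<in> DP_set b X"
  shows "core b X F \<in> Q_set (V_space b X)"
  unfolding Q_set_def
proof (intro CollectI conjI ballI impI)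
  show "core b X F \<noteq> {}" using core_attains[OF F LX_zero] by blast
  have "compactin (topology_generated_by (V_subbase b X)) (core b X F)"
  proof (rule compactin_generated)
    show "core b X F \<subseteq> \<Union>(V_subbase b X)" by (auto simp: eval_subbase_def dest: coreD(1))
    fix \<C> assume "\<C> \<subseteq> V_subbase b X" "core b X F \<subseteq> \<Union>\<C>"
    from core_cover_open[OF F this]
    show "\<exists>\<C>'. finite \<C>' \<and> \<C>' \<subseteq> \<C> \<and> core b X F \<subseteq> \<Union>\<C>'" by blast
  qed
  then show "compactin (V_space b X) (core b X F)" by (simp only: V_space_generated[symmetric])
  fix \<nu> \<nu>' assume \<nu>: "\<nu> \<in> core b X F" "\<nu>' \<in> topspace (V_space b X)" "spec_le (V_space b X) \<nu> \<nu>'"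
  then have "val_integral X \<nu> h \<le> val_integral X \<nu>' h" if "h \<in> LX X" for h
    using that spec_le_V[OF coreD(1)[OF \<nu>(1)] \<nu>(2)] by (intro val_integral_mono_valuation) auto
  then show "\<nu>' \<in> core b X F" using \<nu>(2) coreD(3)[OF \<nu>(1)] unfolding core_def by (blast intro: order.trans)
qed

text \<open>An open set around a compact set contains a finite intersection of finite unions of subbasic sets around
  it, and for each of the unions \<open>core_cover_open\<close> gives an open set of previsions.\<close>

lemma continuous_map_core: "continuous_map (DP_space b X) (Q_space (V_space b X)) (core b X)"
proof (rule continuous_map_into_Q)
  fix F assume "F \<in> topspace (DP_space b X)"
  then show "core b X F \<in> Q_set (V_space b X)" by (simp add: topspace_DP_space core_Q_set)
next
  fix U assume U: "openin (V_space b X) U"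
  show "openin (DP_space b X) {F \<in> topspace (DP_space b X). core b X F \<subseteq> U}"
  proof (subst openin_subopen, intro ballI)
    fix F assume "F \<in> {F \<in> topspace (DP_space b X). core b X F \<subseteq> U}"
    then have F: "F \<in> DP_set b X" and FU: "core b X F \<subseteq> U" by (auto simp: topspace_DP_space)
    obtain \<G> where G: "finite \<G>" "\<forall>G\<in>\<G>. G \<subseteq> V_subbase b X \<and> core b X F \<subseteq> \<Union>G" "(\<Inter>G\<in>\<G>. \<Union>G) \<subseteq> U"
      using compactin_generated_clauses[of "V_subbase b X" "core b X F" U, folded V_space_generated,
          OF Q_setD(2)[OF core_Q_set[OF F]] U FU] by (elim exE conjE)
    have "\<forall>G\<in>\<G>. \<exists>N. openin (DP_space b X) N \<and> F \<in> N \<and> (\<forall>F'\<in>N. core b X F' \<subseteq> \<Union>G)"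
    proof
      fix G assume "G \<in> \<G>"
      then have "G \<subseteq> V_subbase b X" "core b X F \<subseteq> \<Union>G" using G(2) by simp_all
      from core_cover_open[OF F this] obtain G0 N where
        "G0 \<subseteq> G" "openin (DP_space b X) N" "F \<in> N" "\<forall>F'\<in>N. core b X F' \<subseteq> \<Union>G0" by (elim exE conjE)
      then show "\<exists>N. openin (DP_space b X) N \<and> F \<in> N \<and> (\<forall>F'\<in>N. core b X F' \<subseteq> \<Union>G)"
        by (meson Union_mono order.trans)
    qed
    then obtain N where N: "\<And>G. G \<in> \<G> \<Longrightarrow> openin (DP_space b X) (N G) \<and> F \<in> N G \<and> (\<forall>F'\<in>N G. core b X F' \<subseteq> \<Union>G)"
      by metis
    define M where "M = topspace (DP_space b X) \<inter> (\<Inter>G\<in>\<G>. N G)"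
    have "openin (DP_space b X) M"
      unfolding M_def using G(1) N by (cases "\<G> = {}") (auto intro!: openin_Int openin_Inter)
    moreover have "F \<in> M" using F N by (auto simp: M_def topspace_DP_space)
    moreover have "M \<subseteq> {F \<in> topspace (DP_space b X). core b X F \<subseteq> U}"
    proof
      fix F' assume F': "F' \<in> M"
      then have "core b X F' \<subseteq> \<Union>G" if "G \<in> \<G>" for G
        using N[OF that] that by (simp add: M_def)
      then have "core b X F' \<subseteq> (\<Inter>G\<in>\<G>. \<Union>G)" by (rule INT_greatest)
      then show "F' \<in> {F \<in> topspace (DP_space b X). core b X F \<subseteq> U}"
        using F' G(3) by (simp add: M_def)
    qed
    ultimately show "\<exists>T. openin (DP_space b X) T \<and> F \<in> T \<and> T \<subseteq> {F \<in> topspace (DP_space b X). core b X F \<subseteq> U}"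
      by blast
  qed
qed

text \<open>As \<open>T\<close> is superadditive, every pair in the cone generated by the constraints \<open>(T h, \<integral> h d\<nu>)\<close> has the form
  \<open>(g, \<integral> h d\<nu>)\<close> with \<open>g \<le> T h\<close>; so \<open>F\<close> lies below the cone as soon as it lies below the constraints.
  The existence halves of naturality, of the two multiplication laws and of the description of the idempotent
  are instances.\<close>

theorem core_push:
  assumes F: "F \<in> DP_set b Z" and \<nu>: "\<nu> \<in> valuations X"
    and T: "\<And>h. h \<in> LX X \<Longrightarrow> T h \<in> LX Z"
    and add: "\<And>h k z. h \<in> LX X \<Longrightarrow> k \<in> LX X \<Longrightarrow> T h z + T k z \<le> T (\<lambda>x. h x + k x) z"
    and scale: "\<And>a h z. h \<in> LX X \<Longrightarrow> 0 < a \<Longrightarrow> T (\<lambda>x. ennreal a * h x) z = ennreal a * T h z"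
    and le: "\<And>h. h \<in> LX X \<Longrightarrow> F (T h) \<le> val_integral X \<nu> h"
  shows "\<exists>\<xi>\<in>core b Z F. \<forall>h\<in>LX X. val_integral Z \<xi> (T h) \<le> val_integral X \<nu> h"
proof -
  define S where "S = (\<lambda>h. (T h, val_integral X \<nu> h)) ` LX X"
  have S: "g \<in> LX Z" if "(g, r) \<in> S" for g r using that T by (auto simp: S_def)
  have "\<exists>h\<in>LX X. g \<le> T h \<and> r = val_integral X \<nu> h" if "cone_hull S g r" for g r
    using that
  proof induction
    case (base g r)
    then show ?case by (auto simp: S_def)
  next
    case zero
    show ?case by (intro bexI[OF _ LX_zero]) (auto simp: le_fun_def val_integral_zero[OF \<nu>])
  next
    case (add g r g' r')
    then obtain h h' where "h \<in> LX X" "g \<le> T h" "r = val_integral X \<nu> h"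
      "h' \<in> LX X" "g' \<le> T h'" "r' = val_integral X \<nu> h'" by blast
    then show ?case
      by (intro bexI[of _ "\<lambda>x. h x + h' x"])
        (auto simp: le_fun_def val_integral_add[OF \<nu>] intro: LX_add order.trans[OF add_mono assms(4)])
  next
    case (scale g r a)
    then obtain h where "h \<in> LX X" "g \<le> T h" "r = val_integral X \<nu> h" by blast
    then show ?case
      using scale.hyps by (intro bexI[of _ "\<lambda>x. ennreal a * h x"])
        (auto simp: le_fun_def val_integral_scale[OF \<nu>] assms(5) intro: LX_scale mult_left_mono)
  qed
  note hull = this
  have FS: "F g \<le> r" if gr: "cone_hull S g r" for g r
  proof -
    obtain h where h: "h \<in> LX X" "g \<le> T h" "r = val_integral X \<nu> h" using hull[OF gr] by blast
    have "F g \<le> F (T h)"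
      by (rule scott_superlinear_mono[OF DP_set_scott_superlinear[OF F] cone_hull_LX[OF gr S] T[OF h(1)] h(2)])
    then show ?thesis using le[OF h(1)] h(3) by simp
  qed
  have "\<exists>\<xi>\<in>core b Z F. \<forall>(g, r)\<in>S. val_integral Z \<xi> g \<le> r"
    by (rule core_extend[OF F S FS])
  then show ?thesis by (simp add: S_def)
qed

section \<open>Kernels into the space of superlinear previsions\<close>

lemma scott_superlinear_Sup:
  "scott_superlinear X F \<Longrightarrow> D \<subseteq> LX X \<Longrightarrow> directed D \<Longrightarrow> F (Sup D) = (SUP d\<in>D. F d)"
  unfolding scott_superlinear_def by (elim conjE) (rule scott_continuous_on_Sup)

lemma directed_image:
  assumes "directed D" and "\<And>d e. d \<in> D \<Longrightarrow> e \<in> D \<Longrightarrow> d \<le> e \<Longrightarrow> f d \<le> f e"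
  shows "directed (f ` D)"
  unfolding directed_def
proof (intro conjI ballI)
  show "f ` D \<noteq> {}" using assms(1) by (simp add: directed_def)
  fix x y assume "x \<in> f ` D" "y \<in> f ` D"
  then obtain d e where "d \<in> D" "e \<in> D" "x = f d" "y = f e" by blast
  moreover from this obtain c where "c \<in> D" "d \<le> c" "e \<le> c" using assms(1) unfolding directed_def by blast
  ultimately show "\<exists>z\<in>f ` D. x \<le> z \<and> y \<le> z" using assms(2) by blast
qed

lemma directed_finite_bound:
  assumes D: "directed D" and "finite F" "F \<subseteq> D"
  shows "\<exists>u\<in>D. \<forall>x\<in>F. x \<le> u"
  using assms(2,3)
proof (induction F rule: finite_induct)
  case empty
  then show ?case using D by (auto simp: directed_def)
next
  case (insert x F)
  then obtain u where "u \<in> D" "\<forall>y\<in>F. y \<le> u" by auto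
  have "x \<in> D" using insert.prems by simp
  with \<open>u \<in> D\<close> D obtain v where "v \<in> D" "x \<le> v" "u \<le> v" unfolding directed_def by blast
  then show ?case using \<open>\<forall>y\<in>F. y \<le> u\<close> by (intro bexI[of _ v]) auto
qed

lemma compactin_directed:
  assumes Q: "compactin Z Q" and D: "directed \<U>" and o: "\<And>U. U \<in> \<U> \<Longrightarrow> openin Z U" and cov: "Q \<subseteq> \<Union>\<U>"
  shows "\<exists>U\<in>\<U>. Q \<subseteq> U"
proof -
  obtain \<F> where "finite \<F>" "\<F> \<subseteq> \<U>" "Q \<subseteq> \<Union>\<F>" using Q o cov unfolding compactin_def by meson
  moreover from directed_finite_bound[OF D this(1,2)] obtain U where "U \<in> \<U>" "\<forall>V\<in>\<F>. V \<subseteq> U" by blast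
  ultimately show ?thesis by blast
qed

text \<open>A lower semicontinuous function attains its infimum on a compact set.\<close>

lemma less_INF_compact:
  assumes Q: "Q \<in> Q_set Z" and g: "g \<in> LX Z"
  shows "t < (INF z\<in>Q. g z) \<longleftrightarrow> Q \<subseteq> {z. t < g z}"
proof
  show "t < (INF z\<in>Q. g z) \<Longrightarrow> Q \<subseteq> {z. t < g z}" by (auto intro: order_less_le_trans INF_lower)
next
  assume sub: "Q \<subseteq> {z. t < g z}"
  let ?l = "\<lambda>s. {z. s < g z}"
  obtain z where z: "z \<in> Q" using Q_setD(1)[OF Q] by blast
  then have tz: "t < g z" using sub by blast
  then obtain s0 where s0: "t < s0" using dense by blast
  have dir: "directed (?l ` {t<..})"
    unfolding directed_def
  proof (intro conjI ballI)
    show "?l ` {t<..} \<noteq> {}" using s0 by auto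
    fix A B assume "A \<in> ?l ` {t<..}" "B \<in> ?l ` {t<..}"
    then obtain a b where "t < a" "t < b" "A = ?l a" "B = ?l b" by auto
    then show "\<exists>C\<in>?l ` {t<..}. A \<le> C \<and> B \<le> C"
      by (intro bexI[of _ "?l (min a b)"] imageI) (auto simp: min_less_iff_disj)
  qed
  have "Q \<subseteq> \<Union>(?l ` {t<..})"
  proof
    fix z assume "z \<in> Q"
    then have "t < g z" using sub by blast
    then obtain s where "t < s" "s < g z" using dense by blast
    then show "z \<in> \<Union>(?l ` {t<..})" by auto
  qed
  moreover have "openin Z U" if "U \<in> ?l ` {t<..}" for U using that LX_open[OF g] by blast
  ultimately have "\<exists>U\<in>?l ` {t<..}. Q \<subseteq> U"
    by (intro compactin_directed[OF Q_setD(2)[OF Q] dir])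
  then obtain s where s: "t < s" "Q \<subseteq> ?l s" by auto
  then have "s \<le> (INF z\<in>Q. g z)" by (intro INF_greatest) auto
  then show "t < (INF z\<in>Q. g z)" using s(1) by simp
qed

definition inf_on :: "'a topology \<Rightarrow> 'a set \<Rightarrow> ('a \<Rightarrow> ennreal) \<Rightarrow> ennreal" where
  "inf_on Z Q = zero_ext (LX Z) (\<lambda>g. INF z\<in>Q. g z)"

lemma inf_on_LX: "g \<in> LX Z \<Longrightarrow> inf_on Z Q g = (INF z\<in>Q. g z)"
  by (simp add: inf_on_def zero_ext_def)

text \<open>Scott-continuity is compactness: a compact set covered by a directed union of level sets lies in one of them.\<close>

lemma inf_on_DP:
  assumes Q: "Q \<in> Q_set Z"
  shows "inf_on Z Q \<in> DP_set b Z"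
proof (rule DP_setI)
  have ne: "Q \<noteq> {}" by (rule Q_setD(1)[OF Q])
  show "scott_superlinear Z (inf_on Z Q)"
    unfolding scott_superlinear_def scott_continuous_on_def
  proof (intro conjI ballI allI impI)
    fix g k assume "g \<in> LX Z" "k \<in> LX Z" "g \<le> k"
    then show "inf_on Z Q g \<le> inf_on Z Q k"
      by (simp add: inf_on_LX le_fun_def) (intro INF_mono, auto)
  next
    fix D assume "D \<subseteq> LX Z \<and> directed D"
    then have D: "D \<subseteq> LX Z" and dir: "directed D" by auto
    have S: "Sup D \<in> LX Z" by (rule LX_Sup) (rule D)
    have "(INF z\<in>Q. Sup D z) = (SUP d\<in>D. INF z\<in>Q. d z)"
    proof (rule antisym)
      show "(SUP d\<in>D. INF z\<in>Q. d z) \<le> (INF z\<in>Q. Sup D z)"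
        by (intro SUP_least INF_greatest) (auto intro: INF_lower2 SUP_upper)
      show "(INF z\<in>Q. Sup D z) \<le> (SUP d\<in>D. INF z\<in>Q. d z)"
      proof (rule dense_le)
        fix t assume "t < (INF z\<in>Q. Sup D z)"
        then have "Q \<subseteq> {z. t < Sup D z}" by (simp only: less_INF_compact[OF Q S])
        also have "\<dots> = \<Union>((\<lambda>d. {z. t < d z}) ` D)" by (auto simp: less_SUP_iff)
        finally have cov: "Q \<subseteq> \<Union>((\<lambda>d. {z. t < d z}) ` D)" .
        have "directed ((\<lambda>d. {z. t < d z}) ` D)"
          by (rule directed_image[OF dir]) (auto simp: le_fun_def intro: order_less_le_trans)
        moreover have "openin Z U" if "U \<in> (\<lambda>d. {z. t < d z}) ` D" for U
          using that D LX_open by blast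
        ultimately have "\<exists>U\<in>(\<lambda>d. {z. t < d z}) ` D. Q \<subseteq> U"
          by (intro compactin_directed[OF Q_setD(2)[OF Q] _ _ cov])
        then obtain d where d: "d \<in> D" "Q \<subseteq> {z. t < d z}" by auto
        then have "t < (INF z\<in>Q. d z)" using less_INF_compact[OF Q, of d t] D by blast
        also have "\<dots> \<le> (SUP d\<in>D. INF z\<in>Q. d z)" using d(1) by (rule SUP_upper)
        finally show "t \<le> (SUP d\<in>D. INF z\<in>Q. d z)" by simp
      qed
    qed
    then show "inf_on Z Q (Sup D) = (SUP d\<in>D. inf_on Z Q d)"
      using D S by (simp add: inf_on_LX subset_iff cong: SUP_cong_simp)
  next
    fix a :: real and g assume g: "g \<in> LX Z" and "0 \<le> a"
    then consider "a = 0" | "0 < a" by linarith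
    then show "inf_on Z Q (\<lambda>x. ennreal a * g x) = ennreal a * inf_on Z Q g"
    proof cases
      case 1
      then show ?thesis using ne by (simp add: inf_on_LX g LX_zero)
    next
      case 2
      have "(INF z\<in>Q. ennreal a * g z) = ennreal a * (INF z\<in>Q. g z)"
      proof (rule antisym)
        show "(INF z\<in>Q. ennreal a * g z) \<le> ennreal a * (INF z\<in>Q. g z)"
          by (rule le_mult_INF[OF 2]) (rule INF_lower)
        show "ennreal a * (INF z\<in>Q. g z) \<le> (INF z\<in>Q. ennreal a * g z)"
          by (intro INF_greatest mult_left_mono INF_lower) auto
      qed
      then show ?thesis by (simp add: inf_on_LX g LX_scale)
    qed
  next
    fix g k assume "g \<in> LX Z" "k \<in> LX Z"
    then show "inf_on Z Q g + inf_on Z Q k \<le> inf_on Z Q (\<lambda>x. g x + k x)"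
      by (simp add: inf_on_LX LX_add) (intro INF_greatest add_mono INF_lower)
  qed
  have eq: "inf_on Z Q (\<lambda>x. one_on Z x + g x) = 1 + inf_on Z Q g" if g: "g \<in> LX Z" for g
  proof -
    have one: "one_on Z z = 1" if "z \<in> Q" for z
      using that Q_setD(3)[OF Q] by (auto simp: one_on_def zero_ext_def)
    have "(INF z\<in>Q. one_on Z z + g z) = (INF z\<in>Q. 1 + g z)" using one by (intro INF_cong) auto
    also have "\<dots> = 1 + (INF z\<in>Q. g z)"
    proof (rule antisym)
      have "(INF z\<in>Q. 1 + g z) \<le> (INF u\<in>{()}. 1) + (INF z\<in>Q. g z)"
        by (rule le_INF_add) (rule INF_lower)
      then show "(INF z\<in>Q. 1 + g z) \<le> 1 + (INF z\<in>Q. g z)" by simp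
      show "1 + (INF z\<in>Q. g z) \<le> (INF z\<in>Q. 1 + g z)"
        by (intro INF_greatest add_left_mono INF_lower)
    qed
    finally show ?thesis using g by (simp add: inf_on_LX LX_add LX_one_on)
  qed
  then show "prev_mass_ok b Z (inf_on Z Q)" by (cases b) auto
qed (simp add: inf_on_def zero_ext_def)

definition integral_prev :: "'a topology \<Rightarrow> ('a set \<Rightarrow> ennreal) \<Rightarrow> ('a \<Rightarrow> ennreal) \<Rightarrow> ennreal" where
  "integral_prev X \<nu> = zero_ext (LX X) (val_integral X \<nu>)"

lemma integral_prev_LX: "h \<in> LX X \<Longrightarrow> integral_prev X \<nu> h = val_integral X \<nu> h"
  by (simp add: integral_prev_def zero_ext_def)

lemma scott_continuous_on_zero_ext:
  assumes "scott_continuous_on (LX X) G"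
  shows "scott_continuous_on (LX X) (zero_ext (LX X) G)"
  unfolding scott_continuous_on_def
proof (intro conjI ballI allI impI)
  fix D assume D: "D \<subseteq> LX X \<and> directed D"
  then have "G (Sup D) = (SUP d\<in>D. G d)" using assms by (intro scott_continuous_on_Sup) auto
  moreover have "(SUP d\<in>D. zero_ext (LX X) G d) = (SUP d\<in>D. G d)"
    using D by (intro SUP_cong) (auto simp: zero_ext_def)
  ultimately show "zero_ext (LX X) G (Sup D) = (SUP d\<in>D. zero_ext (LX X) G d)"
    using D LX_Sup[of D X] by (simp add: zero_ext_def)
qed (use assms in \<open>simp add: zero_ext_def scott_continuous_on_mono\<close>)

lemma scott_linear_zero_ext:
  assumes G: "scott_linear X G"
  shows "scott_linear X (zero_ext (LX X) G)"
  unfolding scott_linear_def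
proof (intro conjI ballI allI impI)
  show "scott_continuous_on (LX X) (zero_ext (LX X) G)"
    by (rule scott_continuous_on_zero_ext[OF scott_linear_scott[OF G]])
qed (simp_all add: zero_ext_def LX_add LX_scale scott_linear_add[OF G] scott_linear_scale[OF G])

lemma scott_linear_superlinear: "scott_linear X G \<Longrightarrow> scott_superlinear X G"
  by (simp add: scott_linear_def scott_superlinear_def)

lemma integral_prev_DP:
  assumes "\<nu> \<in> topspace (V_space b X)"
  shows "integral_prev X \<nu> \<in> DP_set b X"
proof (rule DP_setI)
  have \<nu>: "\<nu> \<in> valuations X" by (rule topspace_V_valuations[OF assms])
  show "scott_superlinear X (integral_prev X \<nu>)"
    unfolding integral_prev_def
    by (intro scott_linear_superlinear scott_linear_zero_ext scott_linear_val_integral \<nu>)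
  have "integral_prev X \<nu> (\<lambda>x. one_on X x + h x) = \<nu> (topspace X) + integral_prev X \<nu> h" if "h \<in> LX X" for h
    using that val_integral_indicator[OF \<nu>, of "topspace X"]
    by (simp add: integral_prev_LX LX_add LX_one_on val_integral_add[OF \<nu>])
      (simp add: one_on_eq_indicator)
  then show "prev_mass_ok b X (integral_prev X \<nu>)"
    using topspace_V_mass[OF assms] by (cases b) (auto intro: add_right_mono)
qed (simp add: integral_prev_def zero_ext_def)

text \<open>A continuous map \<open>f\<close> from \<open>Z\<close> to the previsions on \<open>X\<close> transforms functions on \<open>X\<close> into functions on \<open>Z\<close>;
  composition with this transformation is the Kleisli extension of \<open>f\<close>.\<close>

definition transform :: "'z topology \<Rightarrow> ('z \<Rightarrow> ('a \<Rightarrow> ennreal) \<Rightarrow> ennreal) \<Rightarrow> ('a \<Rightarrow> ennreal) \<Rightarrow> 'z \<Rightarrow> ennreal" where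
  "transform Z f h = zero_ext (topspace Z) (\<lambda>z. f z h)"

definition kleisli :: "'a topology \<Rightarrow> 'z topology \<Rightarrow> ('z \<Rightarrow> ('a \<Rightarrow> ennreal) \<Rightarrow> ennreal)
    \<Rightarrow> (('z \<Rightarrow> ennreal) \<Rightarrow> ennreal) \<Rightarrow> ('a \<Rightarrow> ennreal) \<Rightarrow> ennreal" where
  "kleisli X Z f F = zero_ext (LX X) (\<lambda>h. F (transform Z f h))"

lemma transform_eq: "z \<in> topspace Z \<Longrightarrow> transform Z f h z = f z h"
  by (simp add: transform_def zero_ext_def)

lemma transform_outside: "z \<notin> topspace Z \<Longrightarrow> transform Z f h z = 0"
  by (simp add: transform_def zero_ext_def)

lemma kleisli_LX: "h \<in> LX X \<Longrightarrow> kleisli X Z f F h = F (transform Z f h)"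
  by (simp add: kleisli_def zero_ext_def)

lemma continuous_map_DP_set: "continuous_map Z (DP_space b X) f \<Longrightarrow> z \<in> topspace Z \<Longrightarrow> f z \<in> DP_set b X"
  by (auto simp: continuous_map_def topspace_DP_space)

context
  fixes Z :: "'z topology" and X :: "'a topology" and b f
  assumes f: "continuous_map Z (DP_space b X) f"
begin

lemma kernel_superlinear: "z \<in> topspace Z \<Longrightarrow> scott_superlinear X (f z)"
  by (rule DP_set_scott_superlinear[OF continuous_map_DP_set[OF f]])

lemma transform_LX:
  assumes h: "h \<in> LX X"
  shows "transform Z f h \<in> LX Z"
  unfolding transform_def
proof (rule zero_ext_LX)
  fix t
  have "openin Z {z \<in> topspace Z. f z \<in> {F \<in> DP_set b X. t < F h}}"
    using f openin_DP_eval[OF h, of b t] unfolding continuous_map_def by blast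
  moreover have "{z \<in> topspace Z. f z \<in> {F \<in> DP_set b X. t < F h}} = {z \<in> topspace Z. t < f z h}"
    using continuous_map_DP_set[OF f] by auto
  ultimately show "openin Z {z \<in> topspace Z. t < f z h}" by simp
qed

lemma transform_mono: "h \<in> LX X \<Longrightarrow> k \<in> LX X \<Longrightarrow> h \<le> k \<Longrightarrow> transform Z f h \<le> transform Z f k"
  by (auto simp: le_fun_def transform_def zero_ext_def intro: scott_superlinear_mono[OF kernel_superlinear])

lemma transform_scale: "h \<in> LX X \<Longrightarrow> 0 \<le> a \<Longrightarrow> transform Z f (\<lambda>x. ennreal a * h x) = (\<lambda>z. ennreal a * transform Z f h z)"
  by (auto simp: transform_def zero_ext_def fun_eq_iff scott_superlinear_scale[OF kernel_superlinear])

lemma transform_superadd: "h \<in> LX X \<Longrightarrow> k \<in> LX X \<Longrightarrow> transform Z f h z + transform Z f k z \<le> transform Z f (\<lambda>x. h x + k x) z"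
  by (auto simp: transform_def zero_ext_def scott_superlinear_superadd[OF kernel_superlinear])

lemma transform_Sup:
  assumes "D \<subseteq> LX X" "directed D"
  shows "transform Z f (Sup D) = Sup (transform Z f ` D)"
proof
  fix z
  have "Sup (transform Z f ` D) z = (SUP d\<in>D. transform Z f d z)" by (simp add: image_image)
  then show "transform Z f (Sup D) z = Sup (transform Z f ` D) z"
    using scott_superlinear_Sup[OF kernel_superlinear assms, of z] assms(2)
    by (cases "z \<in> topspace Z") (simp_all add: transform_eq transform_outside directed_def)
qed

lemma transform_directed: "D \<subseteq> LX X \<Longrightarrow> directed D \<Longrightarrow> directed (transform Z f ` D)"
  by (rule directed_image) (auto intro: transform_mono)

lemma kleisli_scott:
  assumes G: "scott_continuous_on (LX Z) G"
  shows "scott_continuous_on (LX X) (\<lambda>h. G (transform Z f h))"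
  unfolding scott_continuous_on_def
proof (intro conjI ballI allI impI)
  fix D assume "D \<subseteq> LX X \<and> directed D"
  then have D: "D \<subseteq> LX X" "directed D" by auto
  have "G (Sup (transform Z f ` D)) = (SUP g\<in>transform Z f ` D. G g)"
    using D transform_LX by (intro scott_continuous_on_Sup[OF G] transform_directed) auto
  then show "G (transform Z f (Sup D)) = (SUP d\<in>D. G (transform Z f d))"
    by (simp only: transform_Sup[OF D] image_image)
qed (intro scott_continuous_on_mono[OF G] transform_LX transform_mono)

lemma kleisli_DP:
  assumes F: "F \<in> DP_set b Z"
  shows "kleisli X Z f F \<in> DP_set b X"
proof (rule DP_setI)
  note sl = DP_set_scott_superlinear[OF F]
  have "scott_continuous_on (LX X) (kleisli X Z f F)"
    unfolding kleisli_def using sl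
    by (intro scott_continuous_on_zero_ext kleisli_scott) (simp add: scott_superlinear_def)
  moreover have "kleisli X Z f F (\<lambda>x. ennreal a * h x) = ennreal a * kleisli X Z f F h" if "0 \<le> a" "h \<in> LX X" for a h
    using that by (simp add: kleisli_LX LX_scale transform_scale scott_superlinear_scale[OF sl] transform_LX)
  moreover have "kleisli X Z f F h + kleisli X Z f F k \<le> kleisli X Z f F (\<lambda>x. h x + k x)" if "h \<in> LX X" "k \<in> LX X" for h k
  proof -
    have "F (transform Z f h) + F (transform Z f k) \<le> F (\<lambda>z. transform Z f h z + transform Z f k z)"
      using that by (intro scott_superlinear_superadd[OF sl] transform_LX)
    also have "\<dots> \<le> F (transform Z f (\<lambda>x. h x + k x))"
      using that by (intro scott_superlinear_mono[OF sl] LX_add transform_LX le_funI transform_superadd)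
    finally show ?thesis using that by (simp add: kleisli_LX LX_add)
  qed
  ultimately show "scott_superlinear X (kleisli X Z f F)" by (simp add: scott_superlinear_def)
  have one: "one_on Z z = 1" if "z \<in> topspace Z" for z using that by (simp add: one_on_def zero_ext_def)
  have one': "one_on Z z = 0" if "z \<notin> topspace Z" for z using that by (simp add: one_on_def zero_ext_def)
  show "prev_mass_ok b X (kleisli X Z f F)"
  proof (cases b)
    case Mass_Le_1
    have "kleisli X Z f F (\<lambda>x. one_on X x + h x) \<le> 1 + kleisli X Z f F h" if h: "h \<in> LX X" for h
    proof -
      have h1: "(\<lambda>x. one_on X x + h x) \<in> LX X" by (intro LX_add LX_one_on h)
      have "transform Z f (\<lambda>x. one_on X x + h x) z \<le> one_on Z z + transform Z f h z" for z
        using DP_set_mass[OF continuous_map_DP_set[OF f], of z] h Mass_Le_1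
        by (cases "z \<in> topspace Z") (auto simp: transform_eq transform_outside one one')
      then have "F (transform Z f (\<lambda>x. one_on X x + h x)) \<le> F (\<lambda>z. one_on Z z + transform Z f h z)"
        by (intro scott_superlinear_mono[OF sl] transform_LX h1 LX_add LX_one_on h le_funI)
      also have "\<dots> \<le> 1 + F (transform Z f h)"
        using DP_set_mass[OF F] Mass_Le_1 transform_LX[OF h] by simp
      finally show ?thesis using h h1 by (simp add: kleisli_LX)
    qed
    then show ?thesis using Mass_Le_1 by simp
  next
    case Mass_1
    have "kleisli X Z f F (\<lambda>x. one_on X x + h x) = 1 + kleisli X Z f F h" if h: "h \<in> LX X" for h
    proof -
      have h1: "(\<lambda>x. one_on X x + h x) \<in> LX X" by (intro LX_add LX_one_on h)
      have "transform Z f (\<lambda>x. one_on X x + h x) = (\<lambda>z. one_on Z z + transform Z f h z)"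
      proof
        fix z
        show "transform Z f (\<lambda>x. one_on X x + h x) z = one_on Z z + transform Z f h z"
          using DP_set_mass[OF continuous_map_DP_set[OF f], of z] h Mass_1
          by (cases "z \<in> topspace Z") (auto simp: transform_eq transform_outside one one')
      qed
      then show ?thesis
        using DP_set_mass[OF F] Mass_1 transform_LX[OF h] h h1 by (simp add: kleisli_LX)
    qed
    then show ?thesis using Mass_1 by simp
  qed simp
qed (simp add: kleisli_def zero_ext_def)

lemma continuous_map_kleisli: "continuous_map (DP_space b Z) (DP_space b X) (kleisli X Z f)"
proof (rule continuous_map_into_DP)
  fix F assume "F \<in> topspace (DP_space b Z)"
  then show "kleisli X Z f F \<in> DP_set b X" by (simp add: topspace_DP_space kleisli_DP)
next
  fix h t assume "h \<in> LX X"
  then show "openin (DP_space b Z) {F \<in> topspace (DP_space b Z). t < kleisli X Z f F h}"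
    using openin_DP_eval[OF transform_LX, of h b t] by (simp add: kleisli_LX topspace_DP_space)
qed

lemma scott_linear_kleisli:
  assumes lin: "\<And>z. z \<in> topspace Z \<Longrightarrow> scott_linear X (f z)" and G: "scott_linear Z G"
  shows "scott_linear X (kleisli X Z f G)"
  unfolding kleisli_def
proof (rule scott_linear_zero_ext)
  have "transform Z f (\<lambda>x. h x + k x) = (\<lambda>z. transform Z f h z + transform Z f k z)" if "h \<in> LX X" "k \<in> LX X" for h k
    using that scott_linear_add[OF lin] by (auto simp: fun_eq_iff transform_def zero_ext_def)
  then show "scott_linear X (\<lambda>h. G (transform Z f h))"
    using kleisli_scott[OF scott_linear_scott[OF G]]
    by (simp add: scott_linear_def[of X] transform_scale scott_linear_scale[OF G] scott_linear_add[OF G] transform_LX)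
qed

text \<open>A kernel acts on functions superadditively and homogeneously, as \<open>core_push\<close> requires.\<close>

lemma core_push_kernel:
  assumes F: "F \<in> DP_set b Z" and \<nu>: "\<nu> \<in> valuations X"
    and le: "\<And>h. h \<in> LX X \<Longrightarrow> F (transform Z f h) \<le> val_integral X \<nu> h"
  shows "\<exists>\<xi>\<in>core b Z F. \<forall>h\<in>LX X. val_integral Z \<xi> (transform Z f h) \<le> val_integral X \<nu> h"
proof (rule core_push[where T = "transform Z f", OF F \<nu> transform_LX transform_superadd _ le])
  fix a :: real and h z assume "h \<in> LX X" "0 < a"
  then show "transform Z f (\<lambda>x. ennreal a * h x) z = ennreal a * transform Z f h z" by (simp add: transform_scale)
qed

end

lemma scott_linear_eval: "scott_linear X (\<lambda>h. h x)"
  by (auto simp: scott_linear_def scott_continuous_on_def le_fun_def)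

lemma DP_unit_LX: "h \<in> LX X \<Longrightarrow> DP_unit X x h = h x"
  by (simp add: DP_unit_def zero_ext_def)

lemma scott_linear_DP_unit: "scott_linear X (DP_unit X x)"
  unfolding DP_unit_def by (rule scott_linear_zero_ext) (rule scott_linear_eval)

lemma DP_unit_DP:
  assumes x: "x \<in> topspace X"
  shows "DP_unit X x \<in> DP_set b X"
proof (rule DP_setI)
  show "scott_superlinear X (DP_unit X x)" by (rule scott_linear_superlinear[OF scott_linear_DP_unit])
  have "DP_unit X x (\<lambda>y. one_on X y + h y) = 1 + DP_unit X x h" if "h \<in> LX X" for h
    using that x by (simp add: DP_unit_LX LX_add LX_one_on) (simp add: one_on_def zero_ext_def)
  then show "prev_mass_ok b X (DP_unit X x)" by (cases b) auto
qed (simp add: DP_unit_def zero_ext_def)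

lemma continuous_map_DP_unit:
  assumes f: "continuous_map X Y f"
  shows "continuous_map X (DP_space b Y) (\<lambda>x. DP_unit Y (f x))"
proof (rule continuous_map_into_DP)
  fix x assume "x \<in> topspace X"
  then have "f x \<in> topspace Y" using f by (auto simp: continuous_map_def)
  then show "DP_unit Y (f x) \<in> DP_set b Y" by (rule DP_unit_DP)
next
  fix h t assume h: "h \<in> LX Y"
  have "openin X {x \<in> topspace X. f x \<in> {y. t < h y}}"
    using f LX_open[OF h] unfolding continuous_map_def by blast
  then show "openin X {x \<in> topspace X. t < DP_unit Y (f x) h}" using h by (simp add: DP_unit_LX)
qed

lemma transform_DP_unit: "h \<in> LX Y \<Longrightarrow> transform X (\<lambda>x. DP_unit Y (f x)) h = zero_ext (topspace X) (h \<circ> f)"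
  by (simp add: transform_def DP_unit_LX comp_def)

lemma continuous_map_inf_on: "continuous_map (Q_space X) (DP_space b X) (inf_on X)"
proof (rule continuous_map_into_DP)
  fix Q assume "Q \<in> topspace (Q_space X)"
  then show "inf_on X Q \<in> DP_set b X" by (simp add: topspace_Q_space inf_on_DP)
next
  fix h t assume h: "h \<in> LX X"
  have "{Q \<in> topspace (Q_space X). t < inf_on X Q h} = box X {x. t < h x}"
    unfolding box_def using h by (auto simp: topspace_Q_space inf_on_LX less_INF_compact)
  then show "openin (Q_space X) {Q \<in> topspace (Q_space X). t < inf_on X Q h}"
    using openin_box[OF LX_open[OF h]] by simp
qed

lemma continuous_map_integral_prev: "continuous_map (V_space b X) (DP_space b X) (integral_prev X)"
proof (rule continuous_map_into_DP)
  fix h t assume h: "h \<in> LX X"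
  have "{\<nu> \<in> topspace (V_space b X). t < integral_prev X \<nu> h} = {\<nu>. t < ev b X h \<nu>}"
    using h by (auto simp: integral_prev_LX ev_def zero_ext_def split: if_splits)
  then show "openin (V_space b X) {\<nu> \<in> topspace (V_space b X). t < integral_prev X \<nu> h}"
    using LX_open[OF LX_ev[OF h]] by simp
qed (rule integral_prev_DP)

lemma transform_integral_prev: "h \<in> LX X \<Longrightarrow> transform (V_space b X) (integral_prev X) h = ev b X h"
  by (simp add: transform_def ev_def integral_prev_LX)

section \<open>The monad of continuous valuations\<close>

lemma valuations_eqI:
  assumes "\<nu> \<in> valuations X" "\<nu>' \<in> valuations X" "\<And>U. openin X U \<Longrightarrow> \<nu> U = \<nu>' U"
  shows "\<nu> = \<nu>'"
proof
  fix U show "\<nu> U = \<nu>' U" 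
    using assms(3) valuations_outside[OF assms(1)] valuations_outside[OF assms(2)] by (cases "openin X U") simp_all
qed

lemma scott_linear_integral_prev: "\<nu> \<in> valuations X \<Longrightarrow> scott_linear X (integral_prev X \<nu>)"
  unfolding integral_prev_def by (intro scott_linear_zero_ext scott_linear_val_integral)

text \<open>The linear previsions are the images of the valuations. The functor, the unit and the multiplication of
  the monad of valuations are therefore obtained from Kleisli extensions, which respect the mass constraint.\<close>

lemma val_of_space:
  assumes F: "F \<in> DP_set b X" and lin: "scott_linear X F"
  shows "val_of X F \<in> topspace (V_space b X)"
  using val_of_valuation[OF lin] DP_set_one[OF F]
  by (simp add: topspace_V_space val_of_open one_on_eq_indicator)

lemma V_map_val_of:
  assumes f: "continuous_map X Y f" and \<nu>: "\<nu> \<in> valuations X"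
  shows "V_map X Y f \<nu> = val_of Y (kleisli Y X (\<lambda>x. DP_unit Y (f x)) (integral_prev X \<nu>))"
proof
  fix V
  show "V_map X Y f \<nu> V = val_of Y (kleisli Y X (\<lambda>x. DP_unit Y (f x)) (integral_prev X \<nu>)) V"
  proof (cases "openin Y V")
    case True
    have o: "openin X {x \<in> topspace X. f x \<in> V}" using f True by (auto simp: continuous_map_def)
    have "transform X (\<lambda>x. DP_unit Y (f x)) (indicator V) = indicator {x \<in> topspace X. f x \<in> V}"
      by (auto simp: transform_DP_unit LX_indicator True zero_ext_def indicator_def fun_eq_iff)
    then show ?thesis
      using True val_integral_indicator[OF \<nu> o]
      by (simp add: V_map_def zero_ext_def val_of_open kleisli_LX LX_indicator integral_prev_LX o)
  qed (simp add: V_map_def zero_ext_def val_of_def)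
qed

lemma scott_linear_V_map:
  assumes f: "continuous_map X Y f" and \<nu>: "\<nu> \<in> valuations X"
  shows "scott_linear Y (kleisli Y X (\<lambda>x. DP_unit Y (f x)) (integral_prev X \<nu>))"
  by (rule scott_linear_kleisli[OF continuous_map_DP_unit[OF f, of Any_Mass] scott_linear_DP_unit
        scott_linear_integral_prev[OF \<nu>]])

lemma V_map_space:
  assumes f: "continuous_map X Y f" and \<nu>: "\<nu> \<in> topspace (V_space b X)"
  shows "V_map X Y f \<nu> \<in> topspace (V_space b Y)"
  unfolding V_map_val_of[OF f topspace_V_valuations[OF \<nu>]]
  by (rule val_of_space[OF kleisli_DP[OF continuous_map_DP_unit[OF f] integral_prev_DP[OF \<nu>]]
        scott_linear_V_map[OF f topspace_V_valuations[OF \<nu>]]])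

lemma val_integral_V_map:
  assumes f: "continuous_map X Y f" and \<nu>: "\<nu> \<in> valuations X" and h: "h \<in> LX Y"
  shows "val_integral Y (V_map X Y f \<nu>) h = val_integral X \<nu> (\<lambda>x. h (f x))"
proof -
  have "transform X (\<lambda>x. DP_unit Y (f x)) h \<in> LX X"
    by (rule transform_LX[OF continuous_map_DP_unit[OF f, of Any_Mass] h])
  then show ?thesis
    unfolding V_map_val_of[OF f \<nu>] val_integral_val_of[OF scott_linear_V_map[OF f \<nu>] h]
    by (simp add: kleisli_LX[OF h] integral_prev_LX transform_DP_unit[OF h] val_integral_zero_ext comp_def)
qed

lemma continuous_map_V_map:
  assumes f: "continuous_map X Y f"
  shows "continuous_map (V_space b X) (V_space b Y) (V_map X Y f)"
proof (rule continuous_map_into_V)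
  fix V t assume V: "openin Y V"
  then have o: "openin X {x \<in> topspace X. f x \<in> V}" using f by (auto simp: continuous_map_def)
  show "openin (V_space b X) {\<nu> \<in> topspace (V_space b X). t < V_map X Y f \<nu> V}"
    using openin_V_eval[OF o, of b t] V by (simp add: V_map_def zero_ext_def)
qed (rule V_map_space[OF f])

lemma V_unit_val_of: "V_unit X x = val_of X (DP_unit X x)"
  by (auto simp: V_unit_def val_of_def zero_ext_def indicator_def fun_eq_iff DP_unit_LX LX_indicator)

lemma V_unit_space: "x \<in> topspace X \<Longrightarrow> V_unit X x \<in> topspace (V_space b X)"
  unfolding V_unit_val_of by (rule val_of_space[OF DP_unit_DP scott_linear_DP_unit])

lemma val_integral_V_unit: "h \<in> LX X \<Longrightarrow> val_integral X (V_unit X x) h = h x"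
  by (simp add: V_unit_val_of val_integral_val_of[OF scott_linear_DP_unit] DP_unit_LX)

lemma continuous_map_V_unit: "continuous_map X (V_space b X) (V_unit X)"
proof (rule continuous_map_into_V)
  fix U t assume U: "openin X U"
  have "{x \<in> topspace X. t < V_unit X x U} = (if t < 1 then U else {})"
    using U openin_subset[OF U] by (auto simp: V_unit_def zero_ext_def split: if_splits)
  then show "openin X {x \<in> topspace X. t < V_unit X x U}" using U by simp
qed (rule V_unit_space)

lemma V_mult_val_of:
  assumes \<xi>: "\<xi> \<in> valuations (V_space b X)"
  shows "V_mult b X \<xi> = val_of X (kleisli X (V_space b X) (integral_prev X) (integral_prev (V_space b X) \<xi>))"
proof
  fix U
  show "V_mult b X \<xi> U = val_of X (kleisli X (V_space b X) (integral_prev X) (integral_prev (V_space b X) \<xi>)) U"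
  proof (cases "openin X U")
    case True
    have "val_integral (V_space b X) \<xi> (\<lambda>\<nu>. \<nu> U) = val_integral (V_space b X) \<xi> (ev b X (indicator U))"
      by (rule val_integral_cong) (simp add: ev_eq True val_integral_indicator topspace_V_valuations)
    then show ?thesis
      using True by (simp add: V_mult_def zero_ext_def[of "{U. _ U}"] val_of_open kleisli_LX LX_indicator
          transform_integral_prev integral_prev_LX LX_ev)
  qed (simp add: V_mult_def zero_ext_def val_of_def)
qed

lemma scott_linear_V_mult:
  assumes \<xi>: "\<xi> \<in> valuations (V_space b X)"
  shows "scott_linear X (kleisli X (V_space b X) (integral_prev X) (integral_prev (V_space b X) \<xi>))"
  by (rule scott_linear_kleisli[OF continuous_map_integral_prev scott_linear_integral_prev
        scott_linear_integral_prev[OF \<xi>]]) (rule topspace_V_valuations)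

lemma V_mult_space:
  assumes \<xi>: "\<xi> \<in> topspace (V_space b (V_space b X))"
  shows "V_mult b X \<xi> \<in> topspace (V_space b X)"
  unfolding V_mult_val_of[OF topspace_V_valuations[OF \<xi>]]
  by (rule val_of_space[OF kleisli_DP[OF continuous_map_integral_prev integral_prev_DP[OF \<xi>]]
        scott_linear_V_mult[OF topspace_V_valuations[OF \<xi>]]])

lemma val_integral_V_mult:
  assumes \<xi>: "\<xi> \<in> valuations (V_space b X)" and h: "h \<in> LX X"
  shows "val_integral X (V_mult b X \<xi>) h = val_integral (V_space b X) \<xi> (ev b X h)"
  unfolding V_mult_val_of[OF \<xi>] val_integral_val_of[OF scott_linear_V_mult[OF \<xi>] h]
  by (simp add: kleisli_LX[OF h] transform_integral_prev[OF h] integral_prev_LX LX_ev[OF h])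

lemma V_mult_open:
  assumes \<xi>: "\<xi> \<in> topspace (V_space b (V_space b X))" and U: "openin X U"
  shows "V_mult b X \<xi> U = val_integral (V_space b X) \<xi> (ev b X (indicator U))"
  using val_integral_V_mult[OF topspace_V_valuations[OF \<xi>] LX_indicator[OF U]]
    val_integral_indicator[OF topspace_V_valuations[OF V_mult_space[OF \<xi>]] U] by simp

lemma continuous_map_V_mult: "continuous_map (V_space b (V_space b X)) (V_space b X) (V_mult b X)"
proof (rule continuous_map_into_V)
  fix U t assume U: "openin X U"
  let ?g = "ev b (V_space b X) (ev b X (indicator U))"
  have "{\<xi> \<in> topspace (V_space b (V_space b X)). t < V_mult b X \<xi> U} = {\<xi>. t < ?g \<xi>}"
    using V_mult_open[OF _ U]
    by (auto simp: ev_def[of b "V_space b X"] zero_ext_def split: if_splits)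
  then show "openin (V_space b (V_space b X)) {\<xi> \<in> topspace (V_space b (V_space b X)). t < V_mult b X \<xi> U}"
    using LX_open[OF LX_ev[OF LX_ev[OF LX_indicator[OF U]]]] by simp
qed (rule V_mult_space)

lemma V_eqI:
  assumes "\<nu> \<in> topspace (V_space b X)" "\<nu>' \<in> topspace (V_space b X)"
    and "\<And>h. h \<in> LX X \<Longrightarrow> val_integral X \<nu> h = val_integral X \<nu>' h"
  shows "\<nu> = \<nu>'"
proof (rule valuations_eqI)
  fix U assume U: "openin X U"
  show "\<nu> U = \<nu>' U"
    using assms(3)[OF LX_indicator[OF U]] val_integral_indicator[OF topspace_V_valuations U] assms(1,2) by metis
qed (rule topspace_V_valuations[OF assms(1)], rule topspace_V_valuations[OF assms(2)])

text \<open>Valuations with the same integrals are equal, so that each law becomes an identity of iterated integrals.\<close>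

theorem free_algebra_is_algebra: "is_algebra b (free_algebra b X)"
  unfolding is_algebra_def free_algebra_def
proof (simp, intro conjI ballI)
  show "continuous_map (V_space b (V_space b X)) (V_space b X) (V_mult b X)" by (rule continuous_map_V_mult)
next
  fix \<nu> assume \<nu>: "\<nu> \<in> topspace (V_space b X)"
  let ?\<delta> = "V_unit (V_space b X) \<nu>"
  have \<delta>: "?\<delta> \<in> topspace (V_space b (V_space b X))" by (rule V_unit_space[OF \<nu>])
  show "V_mult b X ?\<delta> = \<nu>"
    by (rule V_eqI[OF V_mult_space[OF \<delta>] \<nu>])
      (simp add: val_integral_V_mult[OF topspace_V_valuations[OF \<delta>]] val_integral_V_unit LX_ev ev_eq[OF \<nu>])
next
  fix \<xi> assume \<xi>: "\<xi> \<in> topspace (V_space b (V_space b (V_space b X)))"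
  have m: "V_mult b (V_space b X) \<xi> \<in> topspace (V_space b (V_space b X))" by (rule V_mult_space[OF \<xi>])
  have m': "V_map (V_space b (V_space b X)) (V_space b X) (V_mult b X) \<xi> \<in> topspace (V_space b (V_space b X))"
    by (rule V_map_space[OF continuous_map_V_mult \<xi>])
  show "V_mult b X (V_mult b (V_space b X) \<xi>)
      = V_mult b X (V_map (V_space b (V_space b X)) (V_space b X) (V_mult b X) \<xi>)"
  proof (rule V_eqI[OF V_mult_space[OF m] V_mult_space[OF m']])
    fix h assume h: "h \<in> LX X"
    show "val_integral X (V_mult b X (V_mult b (V_space b X) \<xi>)) h
        = val_integral X (V_mult b X (V_map (V_space b (V_space b X)) (V_space b X) (V_mult b X) \<xi>)) h"
      unfolding val_integral_V_mult[OF topspace_V_valuations[OF m] h]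
        val_integral_V_mult[OF topspace_V_valuations[OF m'] h]
        val_integral_V_mult[OF topspace_V_valuations[OF \<xi>] LX_ev[OF h]]
        val_integral_V_map[OF continuous_map_V_mult topspace_V_valuations[OF \<xi>] LX_ev[OF h]]
      by (rule val_integral_cong)
        (simp add: ev_eq V_mult_space val_integral_V_mult[OF topspace_V_valuations h])
  qed
qed

section \<open>The upper Vietoris monad\<close>

lemma spec_le_refl: "spec_le X x x"
  by (simp add: spec_le_def)

lemma spec_le_trans: "spec_le X x y \<Longrightarrow> spec_le X y z \<Longrightarrow> spec_le X x z"
  by (simp add: spec_le_def)

lemma spec_le_LX:
  assumes "spec_le X x y" "h \<in> LX X"
  shows "h x \<le> h y"
proof (rule ccontr)
  assume "\<not> h x \<le> h y"
  then have "x \<in> {x. h y < h x}" by simp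
  then have "y \<in> {x. h y < h x}" using assms(1) LX_open[OF assms(2)] unfolding spec_le_def by blast
  then show False by simp
qed

lemma spec_le_continuous:
  assumes f: "continuous_map X Y f" and "spec_le X x y" "x \<in> topspace X" "y \<in> topspace X"
  shows "spec_le Y (f x) (f y)"
  unfolding spec_le_def
proof (intro allI impI)
  fix V assume V: "openin Y V \<and> f x \<in> V"
  then have "openin X {x \<in> topspace X. f x \<in> V}" using f by (auto simp: continuous_map_def)
  then have "y \<in> {x \<in> topspace X. f x \<in> V}" using assms V unfolding spec_le_def by blast
  then show "f y \<in> V" by simp
qed

lemma up_closure_superset: "K \<subseteq> topspace X \<Longrightarrow> K \<subseteq> up_closure X K"
  unfolding up_closure_def using spec_le_refl by fastforce

lemma up_closure_Q_set:
  assumes K: "compactin X K" and ne: "K \<noteq> {}"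
  shows "up_closure X K \<in> Q_set X"
  unfolding Q_set_def
proof (intro CollectI conjI ballI impI)
  have sub: "K \<subseteq> up_closure X K"
    by (rule up_closure_superset[OF compactin_subset_topspace[OF K]])
  then show "up_closure X K \<noteq> {}" using ne by blast
  show "compactin X (up_closure X K)"
    unfolding compactin_def
  proof (intro conjI allI impI)
    show "up_closure X K \<subseteq> topspace X" by (auto simp: up_closure_def)
    fix \<U> assume U: "(\<forall>U\<in>\<U>. openin X U) \<and> up_closure X K \<subseteq> \<Union>\<U>"
    then have "K \<subseteq> \<Union>\<U>" using sub by blast
    then obtain \<F> where \<F>: "finite \<F>" "\<F> \<subseteq> \<U>" "K \<subseteq> \<Union>\<F>"
      using K U unfolding compactin_def by meson
    have "up_closure X K \<subseteq> \<Union>\<F>"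
    proof
      fix y assume "y \<in> up_closure X K"
      then obtain x where x: "x \<in> K" "spec_le X x y" by (auto simp: up_closure_def)
      then obtain V where "V \<in> \<F>" "x \<in> V" using \<F>(3) by blast
      then show "y \<in> \<Union>\<F>" using x(2) U \<F>(2) unfolding spec_le_def by blast
    qed
    then show "\<exists>\<F>. finite \<F> \<and> \<F> \<subseteq> \<U> \<and> up_closure X K \<subseteq> \<Union>\<F>" using \<F> by blast
  qed
  fix x y assume "x \<in> up_closure X K" "y \<in> topspace X" "spec_le X x y"
  then obtain z where "z \<in> K" "spec_le X z x" by (auto simp: up_closure_def)
  moreover from this(2) \<open>spec_le X x y\<close> have "spec_le X z y" by (rule spec_le_trans)
  ultimately show "y \<in> up_closure X K" using \<open>y \<in> topspace X\<close> by (auto simp: up_closure_def)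
qed

lemma INF_up_closure:
  assumes "K \<subseteq> topspace X" "h \<in> LX X"
  shows "(INF x\<in>up_closure X K. h x) = (INF x\<in>K. h x)"
proof (rule antisym)
  show "(INF x\<in>up_closure X K. h x) \<le> (INF x\<in>K. h x)"
    by (rule INF_superset_mono[OF up_closure_superset[OF assms(1)]]) simp
  show "(INF x\<in>K. h x) \<le> (INF x\<in>up_closure X K. h x)"
    by (rule INF_greatest) (auto simp: up_closure_def intro: INF_lower2 spec_le_LX[OF _ assms(2)])
qed

lemma up_closure_subset_open:
  assumes "K \<subseteq> topspace X" "openin X U"
  shows "up_closure X K \<subseteq> U \<longleftrightarrow> K \<subseteq> U"
proof
  show "up_closure X K \<subseteq> U \<Longrightarrow> K \<subseteq> U" using up_closure_superset[OF assms(1)] by blast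
  show "K \<subseteq> U \<Longrightarrow> up_closure X K \<subseteq> U" using assms(2) by (auto simp: up_closure_def spec_le_def)
qed

lemma image_Q_subset: "continuous_map X Y f \<Longrightarrow> Q \<in> Q_set X \<Longrightarrow> f ` Q \<subseteq> topspace Y"
  using Q_setD(3)[of Q X] by (auto simp: continuous_map_def)

lemma Q_map_Q_set:
  assumes f: "continuous_map X Y f" and Q: "Q \<in> Q_set X"
  shows "Q_map Y f Q \<in> Q_set Y"
  unfolding Q_map_def
  by (intro up_closure_Q_set image_compactin[OF _ f] Q_setD(2)[OF Q]) (simp add: Q_setD(1)[OF Q])

lemma INF_Q_map:
  assumes f: "continuous_map X Y f" and Q: "Q \<in> Q_set X" and h: "h \<in> LX Y"
  shows "(INF y\<in>Q_map Y f Q. h y) = (INF x\<in>Q. h (f x))"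
  unfolding Q_map_def INF_up_closure[OF image_Q_subset[OF f Q] h] by (simp add: image_image)

lemma continuous_map_Q_map:
  assumes f: "continuous_map X Y f"
  shows "continuous_map (Q_space X) (Q_space Y) (Q_map Y f)"
proof (rule continuous_map_into_Q)
  fix Q assume "Q \<in> topspace (Q_space X)"
  then show "Q_map Y f Q \<in> Q_set Y" using Q_map_Q_set[OF f] by (simp add: topspace_Q_space)
next
  fix V assume V: "openin Y V"
  have "{Q \<in> topspace (Q_space X). Q_map Y f Q \<subseteq> V} = box X {x \<in> topspace X. f x \<in> V}"
  proof (rule set_eqI)
    fix Q
    show "Q \<in> {Q \<in> topspace (Q_space X). Q_map Y f Q \<subseteq> V} \<longleftrightarrow> Q \<in> box X {x \<in> topspace X. f x \<in> V}"
      using up_closure_subset_open[OF image_Q_subset[OF f, of Q] V] Q_setD(3)[of Q X]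
      by (auto simp: topspace_Q_space box_def Q_map_def)
  qed
  moreover have "openin X {x \<in> topspace X. f x \<in> V}" using f V by (auto simp: continuous_map_def)
  ultimately show "openin (Q_space X) {Q \<in> topspace (Q_space X). Q_map Y f Q \<subseteq> V}"
    using openin_box by simp
qed

lemma Q_map_comp:
  assumes f: "continuous_map X Y f" and g: "continuous_map Y Z g" and Q: "Q \<in> Q_set X"
  shows "Q_map Z g (Q_map Y f Q) = Q_map Z (\<lambda>x. g (f x)) Q"
proof (rule set_eqI)
  fix z
  have fQ: "f x \<in> topspace Y" if "x \<in> Q" for x using image_Q_subset[OF f Q] that by blast
  show "z \<in> Q_map Z g (Q_map Y f Q) \<longleftrightarrow> z \<in> Q_map Z (\<lambda>x. g (f x)) Q"
  proof
    assume "z \<in> Q_map Z g (Q_map Y f Q)"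
    then obtain x y where "z \<in> topspace Z" "x \<in> Q" "y \<in> topspace Y" "spec_le Y (f x) y" "spec_le Z (g y) z"
      by (auto simp: Q_map_def up_closure_def)
    moreover from this have "spec_le Z (g (f x)) (g y)" using fQ by (intro spec_le_continuous[OF g])
    ultimately show "z \<in> Q_map Z (\<lambda>x. g (f x)) Q"
      unfolding Q_map_def up_closure_def using spec_le_trans by fast
  next
    assume "z \<in> Q_map Z (\<lambda>x. g (f x)) Q"
    then show "z \<in> Q_map Z g (Q_map Y f Q)"
      using fQ spec_le_refl[of Y] by (fastforce simp: Q_map_def up_closure_def)
  qed
qed

lemma Q_map_cong: "(\<And>x. x \<in> Q \<Longrightarrow> f x = g x) \<Longrightarrow> Q_map Y f Q = Q_map Y g Q"
  by (simp add: Q_map_def cong: image_cong_simp)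

lemma Q_unit_Q_set: "x \<in> topspace X \<Longrightarrow> Q_unit X x \<in> Q_set X"
  unfolding Q_unit_def by (intro up_closure_Q_set) auto

lemma INF_Q_unit: "x \<in> topspace X \<Longrightarrow> h \<in> LX X \<Longrightarrow> (INF y\<in>Q_unit X x. h y) = h x"
  unfolding Q_unit_def by (subst INF_up_closure) auto

lemma Q_unit_subset_open: "x \<in> topspace X \<Longrightarrow> openin X U \<Longrightarrow> Q_unit X x \<subseteq> U \<longleftrightarrow> x \<in> U"
  unfolding Q_unit_def by (subst up_closure_subset_open) auto

lemma Q_mult_Q_set:
  assumes \<Q>: "\<Q> \<in> Q_set (Q_space X)"
  shows "Q_mult \<Q> \<in> Q_set X"
proof -
  have Q: "Q \<in> Q_set X" if "Q \<in> \<Q>" for Q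
    using Q_setD(3)[OF \<Q>] that by (auto simp: topspace_Q_space)
  have "compactin X (\<Union>\<Q>)"
    unfolding compactin_def
  proof (intro conjI allI impI)
    show "\<Union>\<Q> \<subseteq> topspace X" using Q Q_setD(3) by blast
    fix \<U> assume U: "(\<forall>U\<in>\<U>. openin X U) \<and> \<Union>\<Q> \<subseteq> \<Union>\<U>"
    define \<W> where "\<W> = {\<F>. finite \<F> \<and> \<F> \<subseteq> \<U>}"
    have dir: "directed ((\<lambda>\<F>. box X (\<Union>\<F>)) ` \<W>)"
    proof (rule directed_image)
      show "directed \<W>" unfolding directed_def
      proof (intro conjI ballI)
        show "\<W> \<noteq> {}" by (auto simp: \<W>_def)
        fix x y assume "x \<in> \<W>" "y \<in> \<W>"
        then show "\<exists>z\<in>\<W>. x \<le> z \<and> y \<le> z" by (intro bexI[of _ "x \<union> y"]) (auto simp: \<W>_def)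
      qed
    next
      fix d e :: "'a set set" assume "d \<le> e"
      then have "\<Union>d \<subseteq> \<Union>e" by (rule Union_mono)
      then show "box X (\<Union>d) \<subseteq> box X (\<Union>e)" unfolding box_def by blast
    qed
    have op: "openin (Q_space X) B" if "B \<in> (\<lambda>\<F>. box X (\<Union>\<F>)) ` \<W>" for B
      using that U by (auto simp: \<W>_def intro!: openin_box openin_Union)
    have "\<Q> \<subseteq> \<Union>((\<lambda>\<F>. box X (\<Union>\<F>)) ` \<W>)"
    proof
      fix Q assume "Q \<in> \<Q>"
      then have "Q \<in> Q_set X" "Q \<subseteq> \<Union>\<U>" using Q U by blast+
      then obtain \<F> where "finite \<F>" "\<F> \<subseteq> \<U>" "Q \<subseteq> \<Union>\<F>"
        using Q_setD(2)[of Q X] U unfolding compactin_def by meson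
      then show "Q \<in> \<Union>((\<lambda>\<F>. box X (\<Union>\<F>)) ` \<W>)" using \<open>Q \<in> Q_set X\<close> by (auto simp: \<W>_def box_def)
    qed
    from compactin_directed[OF Q_setD(2)[OF \<Q>] dir op this]
    obtain \<F> where "finite \<F>" "\<F> \<subseteq> \<U>" "\<Q> \<subseteq> box X (\<Union>\<F>)" by (auto simp: \<W>_def)
    then show "\<exists>\<F>. finite \<F> \<and> \<F> \<subseteq> \<U> \<and> \<Union>\<Q> \<subseteq> \<Union>\<F>"
      by (intro exI[of _ \<F>]) (auto simp: box_def)
  qed
  moreover have "\<Union>\<Q> \<noteq> {}"
  proof -
    obtain Q where "Q \<in> \<Q>" using Q_setD(1)[OF \<Q>] by blast
    then show ?thesis using Q_setD(1)[OF Q] by blast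
  qed
  ultimately show ?thesis
    unfolding Q_mult_def Q_set_def using Q_setD(4)[OF Q] by blast
qed

lemma continuous_map_Q_mult: "continuous_map (Q_space (Q_space X)) (Q_space X) Q_mult"
proof (rule continuous_map_into_Q)
  fix \<Q> assume "\<Q> \<in> topspace (Q_space (Q_space X))"
  then show "Q_mult \<Q> \<in> Q_set X" by (simp add: topspace_Q_space Q_mult_Q_set)
next
  fix U assume U: "openin X U"
  have "{\<Q> \<in> topspace (Q_space (Q_space X)). Q_mult \<Q> \<subseteq> U} = box (Q_space X) (box X U)"
  proof (rule set_eqI)
    fix \<Q>
    show "\<Q> \<in> {\<Q> \<in> topspace (Q_space (Q_space X)). Q_mult \<Q> \<subseteq> U} \<longleftrightarrow> \<Q> \<in> box (Q_space X) (box X U)"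
      using Q_setD(3)[of \<Q> "Q_space X"]
      by (auto simp: topspace_Q_space[of "Q_space X"] topspace_Q_space[of X] Q_mult_def box_def)
  qed
  then show "openin (Q_space (Q_space X)) {\<Q> \<in> topspace (Q_space (Q_space X)). Q_mult \<Q> \<subseteq> U}"
    using openin_box[OF openin_box[OF U]] by simp
qed

lemma INF_Q_mult: "(INF x\<in>Q_mult \<Q>. (h x :: ennreal)) = (INF Q\<in>\<Q>. INF x\<in>Q. h x)"
  unfolding Q_mult_def
proof (rule antisym)
  show "(INF x\<in>\<Union>\<Q>. h x) \<le> (INF Q\<in>\<Q>. INF x\<in>Q. h x)"
    by (intro INF_greatest INF_lower) blast
  show "(INF Q\<in>\<Q>. INF x\<in>Q. h x) \<le> (INF x\<in>\<Union>\<Q>. h x)"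
  proof (rule INF_greatest)
    fix x assume "x \<in> \<Union>\<Q>"
    then obtain Q where "Q \<in> \<Q>" "x \<in> Q" by blast
    then show "(INF Q\<in>\<Q>. INF x\<in>Q. h x) \<le> h x" by (intro INF_lower2[of Q] INF_lower)
  qed
qed

text \<open>Since the specialization preordering of the upper Vietoris topology is reverse inclusion, the upward
  closure adds nothing to a union of compact saturated sets.\<close>

lemma Q_mult_Q_map:
  assumes f: "\<And>z. z \<in> K \<Longrightarrow> f z \<in> Q_set X"
  shows "Q_mult (Q_map (Q_space X) f K) = (\<Union>z\<in>K. f z)"
proof
  show "Q_mult (Q_map (Q_space X) f K) \<subseteq> (\<Union>z\<in>K. f z)"
    using f by (fastforce simp: Q_mult_def Q_map_def up_closure_def topspace_Q_space spec_le_Q)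
  show "(\<Union>z\<in>K. f z) \<subseteq> Q_mult (Q_map (Q_space X) f K)"
    using f spec_le_refl by (fastforce simp: Q_mult_def Q_map_def up_closure_def topspace_Q_space)
qed

section \<open>The weak distributive law\<close>

definition lower_prev :: "'a topology \<Rightarrow> ('a set set \<Rightarrow> ennreal) \<Rightarrow> ('a \<Rightarrow> ennreal) \<Rightarrow> ennreal" where
  "lower_prev X \<mu> = kleisli X (Q_space X) (inf_on X) (integral_prev (Q_space X) \<mu>)"

abbreviation minf :: "'a topology \<Rightarrow> ('a \<Rightarrow> ennreal) \<Rightarrow> 'a set \<Rightarrow> ennreal" where
  "minf X \<equiv> transform (Q_space X) (inf_on X)"

lemma minf_LX: "h \<in> LX X \<Longrightarrow> minf X h \<in> LX (Q_space X)"
  by (rule transform_LX[OF continuous_map_inf_on])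

lemma minf_eq: "Q \<in> Q_set X \<Longrightarrow> h \<in> LX X \<Longrightarrow> minf X h Q = (INF x\<in>Q. h x)"
  by (simp add: transform_eq topspace_Q_space inf_on_LX)

lemma lower_prev_LX: "h \<in> LX X \<Longrightarrow> lower_prev X \<mu> h = val_integral (Q_space X) \<mu> (minf X h)"
  by (simp add: lower_prev_def kleisli_LX integral_prev_LX minf_LX)

lemma lower_prev_DP: "\<mu> \<in> topspace (V_space b (Q_space X)) \<Longrightarrow> lower_prev X \<mu> \<in> DP_set b X"
  unfolding lower_prev_def by (intro kleisli_DP[OF continuous_map_inf_on] integral_prev_DP)

lemma minf_level:
  assumes h: "h \<in> LX X"
  shows "{Q. t < minf X h Q} = box X {x. t < h x}"
proof (rule set_eqI)
  fix Q
  show "Q \<in> {Q. t < minf X h Q} \<longleftrightarrow> Q \<in> box X {x. t < h x}"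
    using h less_INF_compact[of Q X h t]
    by (cases "Q \<in> Q_set X") (auto simp: minf_eq box_def transform_outside topspace_Q_space)
qed

lemma minf_indicator:
  assumes U: "openin X U"
  shows "minf X (indicator U) = indicator (box X U)"
proof
  fix Q
  show "minf X (indicator U) Q = indicator (box X U) Q"
  proof (cases "Q \<in> Q_set X")
    case True
    have "(INF x\<in>Q. indicator U x) = (indicator (box X U) Q :: ennreal)"
    proof (cases "Q \<subseteq> U")
      case sub: True
      have "(INF x\<in>Q. indicator U x) = (INF x\<in>Q. 1 :: ennreal)" using sub by (intro INF_cong) auto
      then show ?thesis using sub True Q_setD(1)[OF True] by (simp add: box_def)
    next
      case False
      then obtain x where "x \<in> Q" "x \<notin> U" by blast
      then have "(INF x\<in>Q. indicator U x) \<le> (0 :: ennreal)" by (intro INF_lower2[of x]) auto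
      then show ?thesis using False by (simp add: box_def)
    qed
    then show ?thesis using True U by (simp add: minf_eq LX_indicator)
  qed (simp add: transform_outside topspace_Q_space box_def)
qed

text \<open>Membership in \<open>lam b X \<mu>\<close> compares \<open>\<mu> (box X U)\<close> with \<open>\<nu> U\<close>; integrating over the level sets of \<open>h\<close>,
  this is the comparison of the \<open>\<mu>\<close>-integral of the infimum of \<open>h\<close> with the \<open>\<nu>\<close>-integral of \<open>h\<close>.\<close>

theorem lam_eq_core:
  assumes \<mu>: "\<mu> \<in> topspace (V_space b (Q_space X))"
  shows "lam b X \<mu> = core b X (lower_prev X \<mu>)"
proof
  note \<mu>' = topspace_V_valuations[OF \<mu>]
  show "lam b X \<mu> \<subseteq> core b X (lower_prev X \<mu>)"
  proof
    fix \<nu> assume "\<nu> \<in> lam b X \<mu>"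
    then have \<nu>: "\<nu> \<in> topspace (V_space b X)" "\<And>U. openin X U \<Longrightarrow> \<mu> (box X U) \<le> \<nu> U" by (auto simp: lam_def)
    have "lower_prev X \<mu> h \<le> val_integral X \<nu> h" if h: "h \<in> LX X" for h
      unfolding lower_prev_LX[OF h] val_integral_LX[OF h] val_integral_LX[OF minf_LX[OF h]] minf_level[OF h]
      by (intro nn_integral_mono mult_right_mono \<nu>(2) LX_open[OF h]) auto
    then show "\<nu> \<in> core b X (lower_prev X \<mu>)" using \<nu>(1) by (simp add: core_def)
  qed
  show "core b X (lower_prev X \<mu>) \<subseteq> lam b X \<mu>"
  proof
    fix \<nu> assume \<nu>: "\<nu> \<in> core b X (lower_prev X \<mu>)"
    have "\<mu> (box X U) \<le> \<nu> U" if U: "openin X U" for U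
      using coreD(3)[OF \<nu> LX_indicator[OF U]] val_integral_indicator[OF \<mu>' openin_box[OF U]]
        val_integral_indicator[OF coreD(2)[OF \<nu>] U]
      by (simp add: lower_prev_LX LX_indicator U minf_indicator)
    then show "\<nu> \<in> lam b X \<mu>" using coreD(1)[OF \<nu>] by (simp add: lam_def)
  qed
qed

lemma lam_Q_set: "\<mu> \<in> topspace (V_space b (Q_space X)) \<Longrightarrow> lam b X \<mu> \<in> Q_set (V_space b X)"
  by (simp add: lam_eq_core core_Q_set lower_prev_DP)

lemma INF_lam:
  "\<mu> \<in> topspace (V_space b (Q_space X)) \<Longrightarrow> h \<in> LX X \<Longrightarrow>
    (INF \<nu>\<in>lam b X \<mu>. val_integral X \<nu> h) = val_integral (Q_space X) \<mu> (minf X h)"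
  by (simp add: lam_eq_core INF_core lower_prev_DP lower_prev_LX)

lemma continuous_map_lam: "continuous_map (V_space b (Q_space X)) (Q_space (V_space b X)) (lam b X)"
proof (rule continuous_map_eq)
  show "continuous_map (V_space b (Q_space X)) (Q_space (V_space b X))
      (core b X \<circ> (kleisli X (Q_space X) (inf_on X) \<circ> integral_prev (Q_space X)))"
    by (intro continuous_map_compose[OF continuous_map_compose[OF continuous_map_integral_prev
          continuous_map_kleisli[OF continuous_map_inf_on]] continuous_map_core])
qed (simp add: lam_eq_core lower_prev_def)

lemma core_cong: "(\<And>h. h \<in> LX X \<Longrightarrow> F h = G h) \<Longrightarrow> core b X F = core b X G"
  by (auto simp: core_def)

text \<open>One inclusion is monotonicity of integrals, the other one is \<open>core_push_kernel\<close>. In the two instances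
  below \<open>\<Phi>\<close> is the functorial action, resp. the multiplication, of the monad of valuations.\<close>

theorem Q_map_core:
  assumes k: "continuous_map Z (DP_space b Y) k" and F: "F \<in> DP_set b Z"
    and \<Phi>: "\<And>\<xi>. \<xi> \<in> topspace (V_space b Z) \<Longrightarrow> \<Phi> \<xi> \<in> topspace (V_space b Y)"
    and int: "\<And>\<xi> h. \<xi> \<in> topspace (V_space b Z) \<Longrightarrow> h \<in> LX Y \<Longrightarrow>
      val_integral Y (\<Phi> \<xi>) h = val_integral Z \<xi> (transform Z k h)"
  shows "Q_map (V_space b Y) \<Phi> (core b Z F) = core b Y (kleisli Y Z k F)"
proof
  show "Q_map (V_space b Y) \<Phi> (core b Z F) \<subseteq> core b Y (kleisli Y Z k F)"
  proof
    fix \<nu> assume "\<nu> \<in> Q_map (V_space b Y) \<Phi> (core b Z F)"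
    then obtain \<xi> where \<nu>: "\<nu> \<in> topspace (V_space b Y)" and \<xi>: "\<xi> \<in> core b Z F" "spec_le (V_space b Y) (\<Phi> \<xi>) \<nu>"
      by (auto simp: Q_map_def up_closure_def)
    note \<xi>' = coreD(1)[OF \<xi>(1)]
    have "kleisli Y Z k F h \<le> val_integral Y \<nu> h" if h: "h \<in> LX Y" for h
    proof -
      have "kleisli Y Z k F h \<le> val_integral Z \<xi> (transform Z k h)"
        unfolding kleisli_LX[OF h] by (rule coreD(3)[OF \<xi>(1) transform_LX[OF k h]])
      also have "\<dots> = val_integral Y (\<Phi> \<xi>) h" by (rule int[OF \<xi>' h, symmetric])
      also have "\<dots> \<le> val_integral Y \<nu> h"
        using \<xi>(2) by (intro val_integral_mono_valuation h) (simp add: spec_le_V[OF \<Phi>[OF \<xi>'] \<nu>])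
      finally show ?thesis .
    qed
    then show "\<nu> \<in> core b Y (kleisli Y Z k F)" using \<nu> by (simp add: core_def)
  qed
  show "core b Y (kleisli Y Z k F) \<subseteq> Q_map (V_space b Y) \<Phi> (core b Z F)"
  proof
    fix \<nu> assume \<nu>: "\<nu> \<in> core b Y (kleisli Y Z k F)"
    have "F (transform Z k h) \<le> val_integral Y \<nu> h" if h: "h \<in> LX Y" for h
      using coreD(3)[OF \<nu> h] by (simp add: kleisli_LX[OF h])
    from core_push_kernel[OF k F coreD(2)[OF \<nu>] this]
    obtain \<xi> where \<xi>: "\<xi> \<in> core b Z F" "\<And>h. h \<in> LX Y \<Longrightarrow> val_integral Z \<xi> (transform Z k h) \<le> val_integral Y \<nu> h"
      by blast
    note \<xi>' = coreD(1)[OF \<xi>(1)]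
    have "\<Phi> \<xi> U \<le> \<nu> U" if U: "openin Y U" for U
      using \<xi>(2)[OF LX_indicator[OF U]] int[OF \<xi>' LX_indicator[OF U]]
        val_integral_indicator[OF topspace_V_valuations[OF \<Phi>[OF \<xi>']] U] val_integral_indicator[OF coreD(2)[OF \<nu>] U]
      by simp
    then have "spec_le (V_space b Y) (\<Phi> \<xi>) \<nu>" using spec_le_V[OF \<Phi>[OF \<xi>'] coreD(1)[OF \<nu>]] by simp
    then show "\<nu> \<in> Q_map (V_space b Y) \<Phi> (core b Z F)"
      using \<xi>(1) coreD(1)[OF \<nu>] by (auto simp: Q_map_def up_closure_def)
  qed
qed

lemma Q_map_V_map_core:
  assumes f: "continuous_map X Y f" and F: "F \<in> DP_set b X"
  shows "Q_map (V_space b Y) (V_map X Y f) (core b X F) = core b Y (kleisli Y X (\<lambda>x. DP_unit Y (f x)) F)"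
proof (rule Q_map_core[OF continuous_map_DP_unit[OF f] F V_map_space[OF f]])
  fix \<xi> h assume "\<xi> \<in> topspace (V_space b X)" and h: "h \<in> LX Y"
  then show "val_integral Y (V_map X Y f \<xi>) h = val_integral X \<xi> (transform X (\<lambda>x. DP_unit Y (f x)) h)"
    by (simp add: val_integral_V_map[OF f topspace_V_valuations h] transform_DP_unit[OF h] val_integral_zero_ext comp_def)
qed

lemma Q_map_V_mult_core:
  assumes F: "F \<in> DP_set b (V_space b X)"
  shows "Q_map (V_space b X) (V_mult b X) (core b (V_space b X) F)
    = core b X (kleisli X (V_space b X) (integral_prev X) F)"
proof (rule Q_map_core[OF continuous_map_integral_prev F V_mult_space])
  fix \<xi> h assume "\<xi> \<in> topspace (V_space b (V_space b X))" and h: "h \<in> LX X"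
  then show "val_integral X (V_mult b X \<xi>) h = val_integral (V_space b X) \<xi> (transform (V_space b X) (integral_prev X) h)"
    by (simp add: val_integral_V_mult[OF topspace_V_valuations h] transform_integral_prev[OF h])
qed

text \<open>Both sides are sets of valuations above a prevision, and both previsions map \<open>h\<close> to the \<open>\<mu>\<close>-integral of
  the infimum of \<open>h \<circ> f\<close>.\<close>

theorem lam_naturality: "lam_natural b X Y"
  unfolding lam_natural_def
proof (intro allI impI ballI)
  fix f \<mu> assume f: "continuous_map X Y f" and \<mu>: "\<mu> \<in> topspace (V_space b (Q_space X))"
  let ?k = "\<lambda>x. DP_unit Y (f x)"
  note Qf = continuous_map_Q_map[OF f]
  note k = continuous_map_DP_unit[OF f, of b]
  have "Q_map (V_space b Y) (V_map X Y f) (lam b X \<mu>) = core b Y (kleisli Y X ?k (lower_prev X \<mu>))"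
    by (simp add: lam_eq_core[OF \<mu>] Q_map_V_map_core[OF f lower_prev_DP[OF \<mu>]])
  also have "\<dots> = core b Y (lower_prev Y (V_map (Q_space X) (Q_space Y) (Q_map Y f) \<mu>))"
  proof (rule core_cong)
    fix h assume h: "h \<in> LX Y"
    have "val_integral (Q_space X) \<mu> (minf X (transform X ?k h)) = val_integral (Q_space X) \<mu> (\<lambda>Q. minf Y h (Q_map Y f Q))"
    proof (rule val_integral_cong)
      fix Q assume "Q \<in> topspace (Q_space X)"
      then have Q: "Q \<in> Q_set X" by (simp add: topspace_Q_space)
      have "transform X ?k h x = h (f x)" if "x \<in> Q" for x
        using that Q_setD(3)[OF Q] h by (simp add: transform_eq DP_unit_LX subset_iff)
      then have "(INF x\<in>Q. transform X ?k h x) = (INF x\<in>Q. h (f x))" by (intro INF_cong) auto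
      then show "minf X (transform X ?k h) Q = minf Y h (Q_map Y f Q)"
        by (simp add: minf_eq[OF Q transform_LX[OF k h]] minf_eq[OF Q_map_Q_set[OF f Q] h] INF_Q_map[OF f Q h])
    qed
    then show "kleisli Y X ?k (lower_prev X \<mu>) h = lower_prev Y (V_map (Q_space X) (Q_space Y) (Q_map Y f) \<mu>) h"
      by (simp add: kleisli_LX[OF h] lower_prev_LX[OF h] lower_prev_LX[OF transform_LX[OF k h]]
          val_integral_V_map[OF Qf topspace_V_valuations[OF \<mu>] minf_LX[OF h]])
  qed
  also have "\<dots> = lam b Y (V_map (Q_space X) (Q_space Y) (Q_map Y f) \<mu>)"
    by (simp add: lam_eq_core[OF V_map_space[OF Qf \<mu>]])
  finally show "Q_map (V_space b Y) (V_map X Y f) (lam b X \<mu>) = lam b Y (V_map (Q_space X) (Q_space Y) (Q_map Y f) \<mu>)" .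
qed

lemma lam_Q_unit:
  assumes \<nu>: "\<nu> \<in> topspace (V_space b X)"
  shows "lam b X (V_map X (Q_space X) (Q_unit X) \<nu>) = Q_unit (V_space b X) \<nu>"
proof -
  have "{x \<in> topspace X. Q_unit X x \<in> box X U} = U" if U: "openin X U" for U
    using openin_subset[OF U] Q_unit_Q_set[of _ X] Q_unit_subset_open[OF _ U] unfolding box_def by blast
  then have "V_map X (Q_space X) (Q_unit X) \<nu> (box X U) = \<nu> U" if "openin X U" for U
    using that by (simp add: V_map_def zero_ext_def openin_box)
  then show ?thesis
    using \<nu> by (auto simp: lam_def Q_unit_def up_closure_def spec_le_V)
qed

text \<open>The right-hand side is the union of the sets \<open>lam b X \<omega>\<close> over the \<open>\<omega>\<close> above the prevision of \<open>\<mu>\<close>.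
  For a valuation \<open>\<nu>\<close> on the left, a suitable \<open>\<omega>\<close> comes from \<open>core_push_kernel\<close>.\<close>

lemma lam_Q_mult:
  assumes \<mu>: "\<mu> \<in> topspace (V_space b (Q_space (Q_space X)))"
  shows "lam b X (V_map (Q_space (Q_space X)) (Q_space X) Q_mult \<mu>)
    = Q_mult (Q_map (Q_space (V_space b X)) (lam b X) (lam b (Q_space X) \<mu>))"
proof -
  let ?F = "lower_prev (Q_space X) \<mu>"
  let ?K = "core b (Q_space X) ?F"
  note \<mu>' = topspace_V_valuations[OF \<mu>]
  note F = lower_prev_DP[OF \<mu>]
  have K: "\<omega> \<in> topspace (V_space b (Q_space X))" if "\<omega> \<in> ?K" for \<omega> by (rule coreD(1)[OF that])
  have "lower_prev X (V_map (Q_space (Q_space X)) (Q_space X) Q_mult \<mu>) h = ?F (minf X h)" if h: "h \<in> LX X" for h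
    unfolding lower_prev_LX[OF h] lower_prev_LX[OF minf_LX[OF h]]
      val_integral_V_map[OF continuous_map_Q_mult \<mu>' minf_LX[OF h]]
  proof (rule val_integral_cong)
    fix \<Q> assume "\<Q> \<in> topspace (Q_space (Q_space X))"
    then have \<Q>: "\<Q> \<in> Q_set (Q_space X)" by (simp add: topspace_Q_space)
    have "minf X h Q = (INF x\<in>Q. h x)" if "Q \<in> \<Q>" for Q
      using that Q_setD(3)[OF \<Q>] h by (intro minf_eq) (auto simp: topspace_Q_space)
    then have "(INF Q\<in>\<Q>. minf X h Q) = (INF Q\<in>\<Q>. INF x\<in>Q. h x)" by (intro INF_cong) auto
    then show "minf X h (Q_mult \<Q>) = minf (Q_space X) (minf X h) \<Q>"
      by (simp add: minf_eq[OF Q_mult_Q_set[OF \<Q>] h] minf_eq[OF \<Q> minf_LX[OF h]] INF_Q_mult)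
  qed
  then have lhs: "lam b X (V_map (Q_space (Q_space X)) (Q_space X) Q_mult \<mu>) = core b X (\<lambda>h. ?F (minf X h))"
    unfolding lam_eq_core[OF V_map_space[OF continuous_map_Q_mult \<mu>]] by (rule core_cong)
  have "Q_mult (Q_map (Q_space (V_space b X)) (lam b X) (lam b (Q_space X) \<mu>)) = (\<Union>\<omega>\<in>?K. lam b X \<omega>)"
    unfolding lam_eq_core[OF \<mu>] by (rule Q_mult_Q_map) (rule lam_Q_set[OF K])
  also have "\<dots> = (\<Union>\<omega>\<in>?K. core b X (lower_prev X \<omega>))"
    by (intro SUP_cong refl lam_eq_core K)
  also have "\<dots> = core b X (\<lambda>h. ?F (minf X h))"
  proof
    show "(\<Union>\<omega>\<in>?K. core b X (lower_prev X \<omega>)) \<subseteq> core b X (\<lambda>h. ?F (minf X h))"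
    proof (rule UN_least, rule subsetI)
      fix \<omega> \<nu> assume \<omega>: "\<omega> \<in> ?K" and \<nu>: "\<nu> \<in> core b X (lower_prev X \<omega>)"
      have "?F (minf X h) \<le> val_integral X \<nu> h" if h: "h \<in> LX X" for h
        using coreD(3)[OF \<omega> minf_LX[OF h]] coreD(3)[OF \<nu> h] unfolding lower_prev_LX[OF h] by (rule order.trans)
      then show "\<nu> \<in> core b X (\<lambda>h. ?F (minf X h))" using coreD(1)[OF \<nu>] by (simp add: core_def)
    qed
    show "core b X (\<lambda>h. ?F (minf X h)) \<subseteq> (\<Union>\<omega>\<in>?K. core b X (lower_prev X \<omega>))"
    proof
      fix \<nu> assume \<nu>: "\<nu> \<in> core b X (\<lambda>h. ?F (minf X h))"
      have "\<exists>\<omega>\<in>?K. \<forall>h\<in>LX X. val_integral (Q_space X) \<omega> (minf X h) \<le> val_integral X \<nu> h"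
        by (rule core_push_kernel[OF continuous_map_inf_on F coreD(2)[OF \<nu>] coreD(3)[OF \<nu>]])
      then obtain \<omega> where "\<omega> \<in> ?K" "\<forall>h\<in>LX X. val_integral (Q_space X) \<omega> (minf X h) \<le> val_integral X \<nu> h"
        by (elim bexE)
      then show "\<nu> \<in> (\<Union>\<omega>\<in>?K. core b X (lower_prev X \<omega>))"
        using coreD(1)[OF \<nu>] by (intro UN_I[of \<omega>]) (simp_all add: core_def[of b X] lower_prev_LX)
    qed
  qed
  finally show ?thesis using lhs by simp
qed

text \<open>The infimum over \<open>lam b X \<mu>\<close> of the integrals of \<open>h\<close> is the prevision of \<open>\<mu>\<close> at \<open>h\<close>; with this, both sides
  become the valuations above the same iterated integral.\<close>

lemma lam_V_mult:
  assumes \<xi>: "\<xi> \<in> topspace (V_space b (V_space b (Q_space X)))"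
  shows "lam b X (V_mult b (Q_space X) \<xi>)
    = Q_map (V_space b X) (V_mult b X)
        (lam b (V_space b X) (V_map (V_space b (Q_space X)) (Q_space (V_space b X)) (lam b X) \<xi>))"
proof -
  let ?\<zeta> = "V_map (V_space b (Q_space X)) (Q_space (V_space b X)) (lam b X) \<xi>"
  note \<xi>' = topspace_V_valuations[OF \<xi>]
  have \<zeta>: "?\<zeta> \<in> topspace (V_space b (Q_space (V_space b X)))" by (rule V_map_space[OF continuous_map_lam \<xi>])
  have "Q_map (V_space b X) (V_mult b X) (lam b (V_space b X) ?\<zeta>)
      = core b X (kleisli X (V_space b X) (integral_prev X) (lower_prev (V_space b X) ?\<zeta>))"
    unfolding lam_eq_core[OF \<zeta>] by (rule Q_map_V_mult_core[OF lower_prev_DP[OF \<zeta>]])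
  also have "\<dots> = core b X (lower_prev X (V_mult b (Q_space X) \<xi>))"
  proof (rule core_cong)
    fix h assume h: "h \<in> LX X"
    have "val_integral (V_space b (Q_space X)) \<xi> (\<lambda>\<mu>. minf (V_space b X) (ev b X h) (lam b X \<mu>))
        = val_integral (V_space b (Q_space X)) \<xi> (ev b (Q_space X) (minf X h))"
    proof (rule val_integral_cong)
      fix \<mu> assume \<mu>: "\<mu> \<in> topspace (V_space b (Q_space X))"
      have "minf (V_space b X) (ev b X h) (lam b X \<mu>) = (INF \<nu>\<in>lam b X \<mu>. ev b X h \<nu>)"
        by (rule minf_eq[OF lam_Q_set[OF \<mu>] LX_ev[OF h]])
      also have "\<dots> = (INF \<nu>\<in>lam b X \<mu>. val_integral X \<nu> h)"
        by (intro INF_cong refl ev_eq) (simp add: lam_def)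
      finally show "minf (V_space b X) (ev b X h) (lam b X \<mu>) = ev b (Q_space X) (minf X h) \<mu>"
        by (simp add: INF_lam[OF \<mu> h] ev_eq[OF \<mu>])
    qed
    then show "kleisli X (V_space b X) (integral_prev X) (lower_prev (V_space b X) ?\<zeta>) h
        = lower_prev X (V_mult b (Q_space X) \<xi>) h"
      by (simp add: kleisli_LX[OF h] transform_integral_prev[OF h] lower_prev_LX[OF h] lower_prev_LX[OF LX_ev[OF h]]
          val_integral_V_map[OF continuous_map_lam \<xi>' minf_LX[OF LX_ev[OF h]]]
          val_integral_V_mult[OF \<xi>' minf_LX[OF h]])
  qed
  also have "\<dots> = lam b X (V_mult b (Q_space X) \<xi>)" by (simp add: lam_eq_core[OF V_mult_space[OF \<xi>]])
  finally show ?thesis by simp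
qed

theorem lam_weak_distributive_law: "lam_weak_distributive b X"
  unfolding lam_weak_distributive_def
  using continuous_map_lam lam_Q_unit lam_Q_mult lam_V_mult by blast

section \<open>The idempotent of an algebra and its splittings\<close>

lemma V_unit_natural:
  assumes "continuous_map X Y f" "x \<in> topspace X"
  shows "V_map X Y f (V_unit X x) = V_unit Y (f x)"
proof
  fix V
  have "openin X {x \<in> topspace X. f x \<in> V}" if "openin Y V" using assms(1) that by (auto simp: continuous_map_def)
  then show "V_map X Y f (V_unit X x) V = V_unit Y (f x) V"
    using assms(2) by (simp add: V_map_def V_unit_def zero_ext_def)
qed

lemma is_algebraD:
  assumes "is_algebra b A"
  shows "continuous_map (V_space b (alg_space A)) (alg_space A) (alg_map A)"
    and "\<And>x. x \<in> topspace (alg_space A) \<Longrightarrow> alg_map A (V_unit (alg_space A) x) = x"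
    and "\<And>\<xi>. \<xi> \<in> topspace (V_space b (V_space b (alg_space A))) \<Longrightarrow>
      alg_map A (V_mult b (alg_space A) \<xi>) = alg_map A (V_map (V_space b (alg_space A)) (alg_space A) (alg_map A) \<xi>)"
  using assms unfolding is_algebra_def by blast+

lemma V_mult_V_unit:
  "\<nu> \<in> topspace (V_space b X) \<Longrightarrow> V_mult b X (V_unit (V_space b X) \<nu>) = \<nu>"
  using is_algebraD(2)[OF free_algebra_is_algebra[of b X]] by (simp add: free_algebra_def)

lemma continuous_map_alg_idem:
  assumes A: "is_algebra b A"
  shows "continuous_map (Q_space (alg_space A)) (Q_space (alg_space A)) (alg_idem b A)"
  unfolding alg_idem_def
  by (rule continuous_map_compose[OF continuous_map_V_unit
        continuous_map_compose[OF continuous_map_lam continuous_map_Q_map[OF is_algebraD(1)[OF A]]]])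

text \<open>Idempotence is formal: naturality of the unit turns the inner copy of the idempotent into the image of a
  point mass, naturality of the law and associativity of the algebra replace the two structure maps by one
  after \<open>V_mult\<close>, and compatibility of the law with \<open>V_mult\<close> removes \<open>V_mult\<close> against the unit.\<close>

lemma alg_idem_idem:
  assumes A: "is_algebra b A" and Q: "Q \<in> Q_set (alg_space A)"
  shows "alg_idem b A (alg_idem b A Q) = alg_idem b A Q"
proof -
  let ?S = "alg_space A" and ?\<alpha> = "alg_map A"
  let ?VS = "V_space b ?S"
  note \<alpha> = is_algebraD(1)[OF A]
  define \<delta> where "\<delta> = V_unit (Q_space ?S) Q"
  have \<delta>: "\<delta> \<in> topspace (V_space b (Q_space ?S))"
    unfolding \<delta>_def using Q by (intro V_unit_space) (simp add: topspace_Q_space)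
  define \<xi> where "\<xi> = V_unit (V_space b (Q_space ?S)) \<delta>"
  have \<xi>: "\<xi> \<in> topspace (V_space b (V_space b (Q_space ?S)))" unfolding \<xi>_def by (rule V_unit_space[OF \<delta>])
  define \<mu> where "\<mu> = V_unit (Q_space ?VS) (lam b ?S \<delta>)"
  have P: "lam b ?S \<delta> \<in> topspace (Q_space ?VS)" using lam_Q_set[OF \<delta>] by (simp add: topspace_Q_space)
  have \<mu>: "\<mu> \<in> topspace (V_space b (Q_space ?VS))" unfolding \<mu>_def by (rule V_unit_space[OF P])
  have \<mu>_eq: "\<mu> = V_map (V_space b (Q_space ?S)) (Q_space ?VS) (lam b ?S) \<xi>"
    unfolding \<mu>_def \<xi>_def by (rule V_unit_natural[OF continuous_map_lam \<delta>, symmetric])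
  note lamQ = lam_Q_set[OF \<mu>]
  have e: "alg_idem b A Q = Q_map ?S ?\<alpha> (lam b ?S \<delta>)" by (simp add: alg_idem_def \<delta>_def)
  have "V_unit (Q_space ?S) (alg_idem b A Q) = V_map (Q_space ?VS) (Q_space ?S) (Q_map ?S ?\<alpha>) \<mu>"
    unfolding \<mu>_def e by (rule V_unit_natural[OF continuous_map_Q_map[OF \<alpha>] P, symmetric])
  then have "alg_idem b A (alg_idem b A Q) = Q_map ?S ?\<alpha> (lam b ?S (V_map (Q_space ?VS) (Q_space ?S) (Q_map ?S ?\<alpha>) \<mu>))"
    by (simp add: alg_idem_def)
  also have "\<dots> = Q_map ?S ?\<alpha> (Q_map ?VS (V_map ?VS ?S ?\<alpha>) (lam b ?VS \<mu>))"
    using lam_naturality[of b ?VS ?S] \<alpha> \<mu> unfolding lam_natural_def by metis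
  also have "\<dots> = Q_map ?S (\<lambda>\<zeta>. ?\<alpha> (V_map ?VS ?S ?\<alpha> \<zeta>)) (lam b ?VS \<mu>)"
    by (rule Q_map_comp[OF continuous_map_V_map[OF \<alpha>] \<alpha> lamQ])
  also have "\<dots> = Q_map ?S (\<lambda>\<zeta>. ?\<alpha> (V_mult b ?S \<zeta>)) (lam b ?VS \<mu>)"
    by (rule Q_map_cong) (use Q_setD(3)[OF lamQ] is_algebraD(3)[OF A] in auto)
  also have "\<dots> = Q_map ?S ?\<alpha> (Q_map ?VS (V_mult b ?S) (lam b ?VS \<mu>))"
    by (rule Q_map_comp[OF continuous_map_V_mult \<alpha> lamQ, symmetric])
  also have "\<dots> = Q_map ?S ?\<alpha> (lam b ?S (V_mult b (Q_space ?S) \<xi>))"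
    unfolding \<mu>_eq lam_V_mult[OF \<xi>] ..
  also have "\<dots> = alg_idem b A Q"
    unfolding \<xi>_def V_mult_V_unit[OF \<delta>] e ..
  finally show ?thesis .
qed

text \<open>In topological spaces an idempotent splits through its image.\<close>

lemma splitting_exists:
  assumes A: "is_algebra b (A :: 'x algebra)"
  shows "\<exists>s :: ('x, 'x set) splitting. is_splitting b A s"
proof -
  let ?S = "Q_space (alg_space A)"
  let ?e = "alg_idem b A"
  let ?s = "\<lparr>spl_space = subtopology ?S (?e ` topspace ?S), spl_proj = ?e, spl_incl = (\<lambda>Q. Q)\<rparr>"
  note cont = continuous_map_alg_idem[OF A]
  have proj: "continuous_map ?S (subtopology ?S (?e ` topspace ?S)) ?e"
    using cont by (simp add: continuous_map_in_subtopology)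
  have incl: "continuous_map (subtopology ?S (?e ` topspace ?S)) ?S (\<lambda>Q. Q)"
    by (rule continuous_map_from_subtopology) simp
  have fixed: "?e Q = Q" if "Q \<in> topspace (subtopology ?S (?e ` topspace ?S))" for Q
    using that alg_idem_idem[OF A] by (auto simp: topspace_Q_space)
  have "is_splitting b A ?s"
    unfolding is_splitting_def splitting.simps using A proj incl fixed by blast
  then show ?thesis by blast
qed

definition val_env :: "'a topology \<Rightarrow> ('a set \<Rightarrow> ennreal) set \<Rightarrow> ('a \<Rightarrow> ennreal) \<Rightarrow> ennreal" where
  "val_env X K = zero_ext (LX X) (\<lambda>h. INF \<nu>\<in>K. val_integral X \<nu> h)"

lemma DP_splitting_simps [simp]:
  "spl_space (DP_splitting b X) = DP_space b X"
  "spl_proj (DP_splitting b X) = val_env X"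
  "spl_incl (DP_splitting b X) = core b X"
  by (simp_all add: DP_splitting_def fun_eq_iff val_env_def core_def)

lemma free_algebra_simps [simp]:
  "alg_space (free_algebra b X) = V_space b X"
  "alg_map (free_algebra b X) = V_mult b X"
  by (simp_all add: free_algebra_def)

lemma val_env_LX: "h \<in> LX X \<Longrightarrow> val_env X K h = (INF \<nu>\<in>K. val_integral X \<nu> h)"
  by (simp add: val_env_def zero_ext_def)

lemma val_env_core:
  assumes F: "F \<in> DP_set b X"
  shows "val_env X (core b X F) = F"
proof
  fix h show "val_env X (core b X F) h = F h"
    using INF_core[OF F] DP_set_outside[OF F] by (cases "h \<in> LX X") (simp_all add: val_env_def zero_ext_def)
qed

lemma INF_ev:
  assumes "K \<in> Q_set (V_space b X)"
  shows "(INF \<nu>\<in>K. ev b X h \<nu>) = (INF \<nu>\<in>K. val_integral X \<nu> h)"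
  using Q_setD(3)[OF assms] by (intro INF_cong refl ev_eq) auto

lemma val_env_eq_kleisli:
  assumes K: "K \<in> Q_set (V_space b X)"
  shows "val_env X K = kleisli X (V_space b X) (integral_prev X) (inf_on (V_space b X) K)"
proof
  fix h
  show "val_env X K h = kleisli X (V_space b X) (integral_prev X) (inf_on (V_space b X) K) h"
    by (cases "h \<in> LX X")
      (simp_all add: val_env_def kleisli_def zero_ext_def transform_integral_prev inf_on_LX LX_ev INF_ev[OF K])
qed

lemma continuous_map_val_env: "continuous_map (Q_space (V_space b X)) (DP_space b X) (val_env X)"
proof (rule continuous_map_eq)
  show "continuous_map (Q_space (V_space b X)) (DP_space b X)
      (kleisli X (V_space b X) (integral_prev X) \<circ> inf_on (V_space b X))"
    by (rule continuous_map_compose[OF continuous_map_inf_on continuous_map_kleisli[OF continuous_map_integral_prev]])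
qed (simp add: topspace_Q_space val_env_eq_kleisli)

lemma lower_prev_V_unit:
  assumes Q: "Q \<in> Q_set X" and h: "h \<in> LX X"
  shows "lower_prev X (V_unit (Q_space X) Q) h = inf_on X Q h"
  by (simp add: lower_prev_LX[OF h] val_integral_V_unit minf_LX[OF h] minf_eq[OF Q h] inf_on_LX[OF h])

lemma lam_V_unit:
  assumes Q: "Q \<in> Q_set X"
  shows "lam b X (V_unit (Q_space X) Q) = core b X (inf_on X Q)"
proof -
  have "V_unit (Q_space X) Q \<in> topspace (V_space b (Q_space X))"
    using Q by (intro V_unit_space) (simp add: topspace_Q_space)
  then have "lam b X (V_unit (Q_space X) Q) = core b X (lower_prev X (V_unit (Q_space X) Q))"
    by (rule lam_eq_core)
  also have "\<dots> = core b X (inf_on X Q)" by (rule core_cong) (rule lower_prev_V_unit[OF Q])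
  finally show ?thesis .
qed

theorem DP_splitting_is_splitting: "is_splitting b (free_algebra b X) (DP_splitting b X)"
  unfolding is_splitting_def
proof (intro conjI ballI)
  show "is_algebra b (free_algebra b X)" by (rule free_algebra_is_algebra)
  show "continuous_map (Q_space (alg_space (free_algebra b X))) (spl_space (DP_splitting b X)) (spl_proj (DP_splitting b X))"
    by (simp add: continuous_map_val_env)
  show "continuous_map (spl_space (DP_splitting b X)) (Q_space (alg_space (free_algebra b X))) (spl_incl (DP_splitting b X))"
    by (simp add: continuous_map_core)
next
  fix F assume "F \<in> topspace (spl_space (DP_splitting b X))"
  then show "spl_proj (DP_splitting b X) (spl_incl (DP_splitting b X) F) = F"
    by (simp add: topspace_DP_space val_env_core)
next
  fix K assume "K \<in> topspace (Q_space (alg_space (free_algebra b X)))"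
  then have K: "K \<in> Q_set (V_space b X)" by (simp add: topspace_Q_space)
  show "spl_incl (DP_splitting b X) (spl_proj (DP_splitting b X) K) = alg_idem b (free_algebra b X) K"
    by (simp add: alg_idem_def lam_V_unit[OF K] Q_map_V_mult_core[OF inf_on_DP[OF K]] val_env_eq_kleisli[OF K])
qed

section \<open>The weak composite monad\<close>

abbreviation evDP :: "mass \<Rightarrow> 'a topology \<Rightarrow> ('a \<Rightarrow> ennreal) \<Rightarrow> (('a \<Rightarrow> ennreal) \<Rightarrow> ennreal) \<Rightarrow> ennreal" where
  "evDP b X \<equiv> transform (DP_space b X) (\<lambda>F. F)"

lemma evDP_LX: "h \<in> LX X \<Longrightarrow> evDP b X h \<in> LX (DP_space b X)"
  by (rule transform_LX[where f = "\<lambda>F. F" and b = b]) simp_all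

lemma evDP_eq: "F \<in> DP_set b X \<Longrightarrow> evDP b X h F = F h"
  by (simp add: transform_eq topspace_DP_space)

abbreviation lifted :: "mass \<Rightarrow> 'a topology \<Rightarrow> (('a \<Rightarrow> ennreal) \<Rightarrow> ennreal) algebra" where
  "lifted b X \<equiv> lift_alg b (free_algebra b X) (DP_splitting b X)"

lemma alg_space_lifted [simp]: "alg_space (lifted b X) = DP_space b X"
  by (simp add: lift_alg_def)

text \<open>The structure map of the lifted algebra averages previsions: the infimum of the integrals of \<open>h\<close> over the
  valuations above \<open>F\<close> is \<open>F h\<close>, and \<open>\<omega>\<close> integrates these infima.\<close>

lemma alg_map_lifted:
  assumes \<omega>: "\<omega> \<in> topspace (V_space b (DP_space b X))"
  shows "alg_map (lifted b X) \<omega> = kleisli X (DP_space b X) (\<lambda>F. F) (integral_prev (DP_space b X) \<omega>)"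
proof -
  let ?V = "V_space b X"
  let ?\<xi> = "V_map (DP_space b X) (Q_space ?V) (core b X) \<omega>"
  note \<omega>' = topspace_V_valuations[OF \<omega>]
  have \<xi>: "?\<xi> \<in> topspace (V_space b (Q_space ?V))" by (rule V_map_space[OF continuous_map_core \<omega>])
  let ?G = "kleisli X ?V (integral_prev X) (lower_prev ?V ?\<xi>)"
  have G: "?G \<in> DP_set b X" by (rule kleisli_DP[OF continuous_map_integral_prev lower_prev_DP[OF \<xi>]])
  have H: "kleisli X (DP_space b X) (\<lambda>F. F) (integral_prev (DP_space b X) \<omega>) \<in> DP_set b X"
    by (rule kleisli_DP[where f = "\<lambda>F. F", OF _ integral_prev_DP[OF \<omega>]]) simp
  have "alg_map (lifted b X) \<omega> = val_env X (Q_map ?V (V_mult b X) (lam b ?V ?\<xi>))"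
    by (simp add: lift_alg_def)
  also have "\<dots> = ?G"
    unfolding lam_eq_core[OF \<xi>] Q_map_V_mult_core[OF lower_prev_DP[OF \<xi>]] by (rule val_env_core[OF G])
  also have "\<dots> = kleisli X (DP_space b X) (\<lambda>F. F) (integral_prev (DP_space b X) \<omega>)"
  proof (rule DP_eqI[OF G H])
    fix h assume h: "h \<in> LX X"
    have "val_integral (DP_space b X) \<omega> (\<lambda>F. minf ?V (ev b X h) (core b X F)) = val_integral (DP_space b X) \<omega> (evDP b X h)"
    proof (rule val_integral_cong)
      fix F assume "F \<in> topspace (DP_space b X)"
      then have F: "F \<in> DP_set b X" by (simp add: topspace_DP_space)
      show "minf ?V (ev b X h) (core b X F) = evDP b X h F"
        by (simp add: minf_eq[OF core_Q_set[OF F] LX_ev[OF h]] INF_ev[OF core_Q_set[OF F]] INF_core[OF F h] evDP_eq[OF F])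
    qed
    then show "?G h = kleisli X (DP_space b X) (\<lambda>F. F) (integral_prev (DP_space b X) \<omega>) h"
      by (simp add: kleisli_LX[OF h] transform_integral_prev[OF h] lower_prev_LX[OF LX_ev[OF h]]
          val_integral_V_map[OF continuous_map_core \<omega>' minf_LX[OF LX_ev[OF h]]] integral_prev_LX evDP_LX[OF h])
  qed
  finally show ?thesis .
qed

lemma alg_map_lifted_LX:
  "\<omega> \<in> topspace (V_space b (DP_space b X)) \<Longrightarrow> h \<in> LX X \<Longrightarrow>
    alg_map (lifted b X) \<omega> h = val_integral (DP_space b X) \<omega> (evDP b X h)"
  by (simp add: alg_map_lifted kleisli_LX integral_prev_LX evDP_LX)

lemma continuous_map_alg_map_lifted:
  "continuous_map (V_space b (DP_space b X)) (DP_space b X) (alg_map (lifted b X))"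
proof (rule continuous_map_eq)
  have "continuous_map (DP_space b (DP_space b X)) (DP_space b X) (kleisli X (DP_space b X) (\<lambda>F. F))"
    by (rule continuous_map_kleisli) simp
  then show "continuous_map (V_space b (DP_space b X)) (DP_space b X)
      (kleisli X (DP_space b X) (\<lambda>F. F) \<circ> integral_prev (DP_space b X))"
    by (rule continuous_map_compose[OF continuous_map_integral_prev])
qed (simp add: alg_map_lifted)

lemma alg_map_lifted_DP:
  "\<omega> \<in> topspace (V_space b (DP_space b X)) \<Longrightarrow> alg_map (lifted b X) \<omega> \<in> DP_set b X"
  by (rule continuous_map_DP_set[OF continuous_map_alg_map_lifted])

theorem lifted_is_algebra: "is_algebra b (lifted b X)"
  unfolding is_algebra_def alg_space_lifted
proof (intro conjI ballI)
  show "continuous_map (V_space b (DP_space b X)) (DP_space b X) (alg_map (lifted b X))"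
    by (rule continuous_map_alg_map_lifted)
next
  fix F assume F: "F \<in> topspace (DP_space b X)"
  then have F': "F \<in> DP_set b X" by (simp add: topspace_DP_space)
  have u: "V_unit (DP_space b X) F \<in> topspace (V_space b (DP_space b X))" by (rule V_unit_space[OF F])
  show "alg_map (lifted b X) (V_unit (DP_space b X) F) = F"
  proof (rule DP_eqI[OF alg_map_lifted_DP[OF u] F'])
    fix h assume h: "h \<in> LX X"
    show "alg_map (lifted b X) (V_unit (DP_space b X) F) h = F h"
      by (simp only: alg_map_lifted_LX[OF u h] val_integral_V_unit[OF evDP_LX[OF h]] evDP_eq[OF F'])
  qed
next
  fix \<Xi> assume \<Xi>: "\<Xi> \<in> topspace (V_space b (V_space b (DP_space b X)))"
  let ?D = "DP_space b X" and ?\<beta> = "alg_map (lifted b X)"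
  note \<Xi>' = topspace_V_valuations[OF \<Xi>]
  note \<beta> = continuous_map_alg_map_lifted[of b X]
  have m: "V_mult b ?D \<Xi> \<in> topspace (V_space b ?D)" by (rule V_mult_space[OF \<Xi>])
  have m': "V_map (V_space b ?D) ?D ?\<beta> \<Xi> \<in> topspace (V_space b ?D)" by (rule V_map_space[OF \<beta> \<Xi>])
  show "?\<beta> (V_mult b ?D \<Xi>) = ?\<beta> (V_map (V_space b ?D) ?D ?\<beta> \<Xi>)"
  proof (rule DP_eqI[OF alg_map_lifted_DP[OF m] alg_map_lifted_DP[OF m']])
    fix h assume h: "h \<in> LX X"
    show "?\<beta> (V_mult b ?D \<Xi>) h = ?\<beta> (V_map (V_space b ?D) ?D ?\<beta> \<Xi>) h"
      unfolding alg_map_lifted_LX[OF m h] alg_map_lifted_LX[OF m' h]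
        val_integral_V_mult[OF \<Xi>' evDP_LX[OF h]] val_integral_V_map[OF \<beta> \<Xi>' evDP_LX[OF h]]
      by (rule val_integral_cong) (simp add: ev_eq evDP_eq alg_map_lifted_DP alg_map_lifted_LX h)
  qed
qed

lemma wc_map_DP:
  assumes f: "continuous_map X Y f" and F: "F \<in> DP_set b X"
  shows "wc_map b X (DP_splitting b X) Y (DP_splitting b Y) f F = DP_map X Y f F"
proof -
  have "wc_map b X (DP_splitting b X) Y (DP_splitting b Y) f F
      = val_env Y (Q_map (V_space b Y) (V_map X Y f) (core b X F))"
    by (simp add: wc_map_def lift_map_def)
  also have "\<dots> = kleisli Y X (\<lambda>x. DP_unit Y (f x)) F"
    unfolding Q_map_V_map_core[OF f F] by (rule val_env_core[OF kleisli_DP[OF continuous_map_DP_unit[OF f] F]])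
  also have "\<dots> = DP_map X Y f F"
    by (auto simp: kleisli_def DP_map_def zero_ext_def[of "LX Y"] transform_DP_unit fun_eq_iff)
  finally show ?thesis .
qed

lemma wc_unit_DP:
  assumes x: "x \<in> topspace X"
  shows "wc_unit b X (DP_splitting b X) x = DP_unit X x"
proof
  fix h
  have \<delta>: "V_unit X x \<in> topspace (V_space b X)" by (rule V_unit_space[OF x])
  have "wc_unit b X (DP_splitting b X) x = val_env X (Q_unit (V_space b X) (V_unit X x))"
    by (simp add: wc_unit_def lift_unit_def)
  moreover have "val_env X (Q_unit (V_space b X) (V_unit X x)) h = DP_unit X x h"
  proof (cases "h \<in> LX X")
    case True
    have "(INF \<nu>\<in>Q_unit (V_space b X) (V_unit X x). ev b X h \<nu>) = ev b X h (V_unit X x)"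
      by (rule INF_Q_unit[OF \<delta> LX_ev[OF True]])
    then show ?thesis
      by (simp add: val_env_LX True DP_unit_LX INF_ev[OF Q_unit_Q_set[OF \<delta>]] ev_eq[OF \<delta>] val_integral_V_unit)
  qed (simp add: val_env_def DP_unit_def zero_ext_def)
  ultimately show "wc_unit b X (DP_splitting b X) x h = DP_unit X x h" by simp
qed

text \<open>The idempotent of the lifted algebra maps \<open>\<Q>\<close> to the previsions above the averages against the
  valuations in the core of the infimum over \<open>\<Q>\<close>. By \<open>INF_core\<close> this does not change pointwise infima, which
  is why the multiplication does not depend on the splitting of this idempotent.\<close>

lemma INF_alg_idem_lifted:
  assumes \<Q>: "\<Q> \<in> Q_set (DP_space b X)" and h: "h \<in> LX X"
  shows "(INF G\<in>alg_idem b (lifted b X) \<Q>. evDP b X h G) = (INF G\<in>\<Q>. evDP b X h G)"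
proof -
  let ?D = "DP_space b X" and ?\<beta> = "alg_map (lifted b X)"
  let ?K = "core b ?D (inf_on ?D \<Q>)"
  have I: "inf_on ?D \<Q> \<in> DP_set b ?D" by (rule inf_on_DP[OF \<Q>])
  have "(INF G\<in>alg_idem b (lifted b X) \<Q>. evDP b X h G) = (INF G\<in>Q_map ?D ?\<beta> ?K. evDP b X h G)"
    by (simp add: alg_idem_def lam_V_unit[OF \<Q>])
  also have "\<dots> = (INF \<omega>\<in>?K. evDP b X h (?\<beta> \<omega>))"
    by (rule INF_Q_map[OF continuous_map_alg_map_lifted core_Q_set[OF I] evDP_LX[OF h]])
  also have "\<dots> = (INF \<omega>\<in>?K. val_integral ?D \<omega> (evDP b X h))"
    by (intro INF_cong refl) (simp add: evDP_eq alg_map_lifted_DP alg_map_lifted_LX h coreD(1))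
  also have "\<dots> = inf_on ?D \<Q> (evDP b X h)" by (rule INF_core[OF I evDP_LX[OF h]])
  also have "\<dots> = (INF G\<in>\<Q>. evDP b X h G)" by (rule inf_on_LX[OF evDP_LX[OF h]])
  finally show ?thesis .
qed

lemma wc_mult_DP:
  assumes s': "is_splitting b (lifted b X) s'" and \<F>: "\<F> \<in> DP_set b (DP_space b X)"
  shows "wc_mult b X (DP_splitting b X) (DP_splitting b (DP_space b X)) s' \<F> = DP_mult b X \<F>"
proof
  fix h
  let ?D = "DP_space b X" and ?\<beta> = "alg_map (lifted b X)"
  let ?\<Q> = "Q_map ?D ?\<beta> (core b ?D \<F>)"
  let ?E = "alg_idem b (lifted b X) ?\<Q>"
  have \<Q>: "?\<Q> \<in> Q_set ?D" by (rule Q_map_Q_set[OF continuous_map_alg_map_lifted core_Q_set[OF \<F>]])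
  have "continuous_map (Q_space ?D) (Q_space ?D) (alg_idem b (lifted b X))"
    using continuous_map_alg_idem[OF lifted_is_algebra[of b X]] by simp
  then have "?E \<in> topspace (Q_space ?D)" using \<Q> by (auto simp: continuous_map_def topspace_Q_space)
  then have E: "?E \<in> Q_set ?D" by (simp add: topspace_Q_space)
  have E_DP: "G \<in> DP_set b X" if "G \<in> ?E" for G using that Q_setD(3)[OF E] by (auto simp: topspace_DP_space)
  have "spl_incl s' (spl_proj s' ?\<Q>) = ?E"
    using s' \<Q> unfolding is_splitting_def by (simp add: topspace_Q_space)
  then have "wc_mult b X (DP_splitting b X) (DP_splitting b ?D) s' \<F>
      = val_env X (Q_mult (Q_map (Q_space (V_space b X)) (core b X) ?E))"
    by (simp add: wc_mult_def lift_mult_def lift_map_def Let_def)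
  also have "Q_mult (Q_map (Q_space (V_space b X)) (core b X) ?E) = (\<Union>G\<in>?E. core b X G)"
    by (rule Q_mult_Q_map) (rule core_Q_set[OF E_DP])
  finally have wc: "wc_mult b X (DP_splitting b X) (DP_splitting b ?D) s' \<F> = val_env X (\<Union>G\<in>?E. core b X G)" .
  show "wc_mult b X (DP_splitting b X) (DP_splitting b ?D) s' \<F> h = DP_mult b X \<F> h"
  proof (cases "h \<in> LX X")
    case h: True
    have "val_env X (\<Union>G\<in>?E. core b X G) h = (INF G\<in>?E. INF \<nu>\<in>core b X G. val_integral X \<nu> h)"
      unfolding val_env_LX[OF h]
      using INF_Q_mult[of "\<lambda>\<nu>. val_integral X \<nu> h" "core b X ` ?E"] by (simp add: Q_mult_def image_image)
    also have "\<dots> = (INF G\<in>?E. evDP b X h G)"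
      by (intro INF_cong refl) (simp add: INF_core E_DP h evDP_eq)
    also have "\<dots> = (INF G\<in>?\<Q>. evDP b X h G)" by (rule INF_alg_idem_lifted[OF \<Q> h])
    also have "\<dots> = (INF \<omega>\<in>core b ?D \<F>. evDP b X h (?\<beta> \<omega>))"
      by (rule INF_Q_map[OF continuous_map_alg_map_lifted core_Q_set[OF \<F>] evDP_LX[OF h]])
    also have "\<dots> = (INF \<omega>\<in>core b ?D \<F>. val_integral ?D \<omega> (evDP b X h))"
      by (intro INF_cong refl) (simp add: evDP_eq alg_map_lifted_DP alg_map_lifted_LX h coreD(1))
    also have "\<dots> = \<F> (evDP b X h)" by (rule INF_core[OF \<F> evDP_LX[OF h]])
    also have "\<dots> = DP_mult b X \<F> h" using h by (simp add: DP_mult_def zero_ext_def[of "LX X"] transform_def topspace_DP_space)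
    finally show ?thesis by (simp add: wc)
  qed (simp add: wc val_env_def DP_mult_def zero_ext_def)
qed

theorem theorem5p4:
  fixes b :: mass and X :: "'a topology" and Y :: "'b topology"
  shows
    "lam_natural b X Y \<and> lam_weak_distributive b X \<and>
     is_splitting b (free_algebra b X) (DP_splitting b X) \<and>
     spl_space (DP_splitting b X) = DP_space b X \<and>
     (\<forall>f. continuous_map X Y f \<longrightarrow>
        (\<forall>F \<in> topspace (DP_space b X).
           wc_map b X (DP_splitting b X) Y (DP_splitting b Y) f F = DP_map X Y f F)) \<and>
     (\<forall>x \<in> topspace X. wc_unit b X (DP_splitting b X) x = DP_unit X x) \<and>
     (\<exists>s' :: (('a \<Rightarrow> ennreal) \<Rightarrow> ennreal, (('a \<Rightarrow> ennreal) \<Rightarrow> ennreal) set) splitting.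
        is_splitting b (lift_alg b (free_algebra b X) (DP_splitting b X)) s') \<and>
     (\<forall>s' :: (('a \<Rightarrow> ennreal) \<Rightarrow> ennreal, 'e) splitting.
        is_splitting b (lift_alg b (free_algebra b X) (DP_splitting b X)) s' \<longrightarrow>
        (\<forall>\<F> \<in> topspace (DP_space b (DP_space b X)).
           wc_mult b X (DP_splitting b X) (DP_splitting b (DP_space b X)) s' \<F> = DP_mult b X \<F>))"
proof (intro conjI allI impI ballI)
  show "lam_natural b X Y" by (rule lam_naturality)
  show "lam_weak_distributive b X" by (rule lam_weak_distributive_law)
  show "is_splitting b (free_algebra b X) (DP_splitting b X)" by (rule DP_splitting_is_splitting)
  show "spl_space (DP_splitting b X) = DP_space b X" by simp
  show "\<exists>s' :: (('a \<Rightarrow> ennreal) \<Rightarrow> ennreal, (('a \<Rightarrow> ennreal) \<Rightarrow> ennreal) set) splitting.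
      is_splitting b (lifted b X) s'"
    by (rule splitting_exists[OF lifted_is_algebra])
qed (simp_all add: wc_map_DP wc_unit_DP wc_mult_DP topspace_DP_space)

end
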